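(* Let $n\ge 1$ and let $\boldsymbol{a}=(a_1,\dots,a_n)$ and $\boldsymbol{a}'=(a'_1,\dots,a'_n)$ be vectors with positive components. (i) If $\boldsymbol{a}$ and $\boldsymbol{a}'$ are related by a permutation of the components, then the tori $T(\boldsymbol{a})$ and $T(\boldsymbol{a}')$ are Hamiltonian isotopic in the ball $B^{2n}(|\boldsymbol{a}|)$. (ii) If $\boldsymbol{a}\simeq\boldsymbol{a}'$, then the tori $T(\boldsymbol{a})$ and $T(\boldsymbol{a}')$ are Hamiltonian isotopic in the ball $B^{2n}\bigl(\max(\|\boldsymbol{a}\|,\|\boldsymbol{a}'\|)\bigr)$.
   Context: $\mathbb{R}^{2n}$ carries the standard symplectic form $\omega_n=\sum_{j=1}^n dx_j\wedge dy_j$. For $a>0$, $T(a)\subset\mathbb{R}^2$ is the boundary of the disc of area $a$ centred at the origin; for $\boldsymbol{a}=(a_1,\dots,a_n)$ with positive components, $T(\boldsymbol{a})=T(a_1)\times\dots\times T(a_n)\subset\mathbb{R}^{2n}$. $B^{2n}(b)$ is the closed ball of radius $\sqrt{b/\pi}$ in $\mathbb{R}^{2n}$ centred at the origin. Notation: $\underline{a}=\min_{1\le i\le n} a_i$; $m(\boldsymbol{a})=\#\{i\mid a_i=\underline{a}\}$; $|\boldsymbol{a}|=\sum_{i=1}^n a_i$; $\|\boldsymbol{a}\|=|\boldsymbol{a}|+\underline{a}$; $\Gamma(\boldsymbol{a})\subset\mathbb{R}$ is the subgroup of all integer combinations of $a_1-\underline{a},\dots,a_n-\underline{a}$. One writes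 $\boldsymbol{a}\simeq\boldsymbol{a}'$ if $\underline{a}=\underline{a}'$, $m(\boldsymbol{a})=m(\boldsymbol{a}')$ and $\Gamma(\boldsymbol{a})=\Gamma(\boldsymbol{a}')$. A Hamiltonian isotopy of $\mathbb{R}^{2n}$ is a family $\{\Phi_s\}_{s\in[0,1]}$ where $\Phi_s$ is the time $s$ flow map of the Hamiltonian vector fields $X_t$ (given by $\omega_n(X_t,\cdot)=dH_t$) of a family of smooth functions $H_t$, $t\in[0,1]$, depending smoothly on $t$, such that each $\Phi_s$ is a well-defined diffeomorphism. Two Lagrangian submanifolds $L,L'\subset\mathbb{R}^{2n}$ are Hamiltonian isotopic in the ball $B^{2n}(b)$ if there is a Hamiltonian isotopy $\{\Phi_s\}$, $s\in[0,1]$, of $\mathbb{R}^{2n}$ with $\Phi_0=\mathrm{id}$, $\Phi_1(L)=L'$ and $\Phi_s(L)\subset B^{2n}(b)$ for all $s\in[0,1]$. *)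

theory Defs
  imports "HOL-Analysis.Analysis"
begin

text \<open>
  The space R^2n is \<open>complex ^ 'n\<close>, with \<open>n = CARD('n)\<close>: the j-th factor R^2 is \<open>complex\<close> as a
  Euclidean plane, with coordinates \<open>x_j = Re (z $ j)\<close> and \<open>y_j = Im (z $ j)\<close>. The norm of
  \<open>complex ^ 'n\<close> is then the Euclidean norm of R^2n.
\<close>

section \<open>Smooth maps\<close>

text \<open>Meant for open \<open>U\<close>: all iterated directional derivatives up to order \<open>k\<close> exist and are
  continuous on \<open>U\<close>, the derivatives of order less than \<open>k\<close> being differentiable.\<close>

primrec Ck_on :: "nat \<Rightarrow> 'a::euclidean_space set \<Rightarrow> ('a \<Rightarrow> 'b::euclidean_space) \<Rightarrow> bool" where
  "Ck_on 0 U f \<longleftrightarrow> continuous_on U f"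
| "Ck_on (Suc k) U f \<longleftrightarrow>
     (\<forall>x\<in>U. f differentiable (at x)) \<and> (\<forall>v. Ck_on k U (\<lambda>x. frechet_derivative f (at x) v))"

text \<open>Smoothness on an arbitrary subset means, as usual, the existence of a smooth extension to an
  open neighbourhood. This matters for \<open>{0..1} \<times> UNIV\<close>, which has a boundary.\<close>

definition smooth_on :: "'a::euclidean_space set \<Rightarrow> ('a \<Rightarrow> 'b::euclidean_space) \<Rightarrow> bool" where
  "smooth_on S f \<longleftrightarrow>
     (\<exists>U g. open U \<and> S \<subseteq> U \<and> (\<forall>k. Ck_on k U g) \<and> (\<forall>x\<in>S. g x = f x))"

definition diffeomorphism :: "('a::euclidean_space \<Rightarrow> 'a) \<Rightarrow> bool" where
  "diffeomorphism \<phi> \<longleftrightarrow> bij \<phi> \<and> smooth_on UNIV \<phi> \<and> smooth_on UNIV (inv \<phi>)"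

section \<open>Hamiltonian isotopies\<close>

definition omega :: "complex ^ 'n \<Rightarrow> complex ^ 'n \<Rightarrow> real" where
  "omega u v = (\<Sum>j\<in>UNIV. Re (u $ j) * Im (v $ j) - Im (u $ j) * Re (v $ j))"

definition hamiltonian_vector_field ::
    "(complex ^ 'n \<Rightarrow> real) \<Rightarrow> (complex ^ 'n \<Rightarrow> complex ^ 'n) \<Rightarrow> bool" where
  "hamiltonian_vector_field h X \<longleftrightarrow> (\<forall>z. (h has_derivative omega (X z)) (at z))"

text \<open>\<open>\<Phi> s\<close> is the time \<open>s\<close> flow map, starting at time 0, of the time-dependent vector field \<open>X\<close>.\<close>

definition is_flow :: "(real \<Rightarrow> complex ^ 'n \<Rightarrow> complex ^ 'n)
    \<Rightarrow> (real \<Rightarrow> complex ^ 'n \<Rightarrow> complex ^ 'n) \<Rightarrow> bool" where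
  "is_flow X \<Phi> \<longleftrightarrow>
     (\<forall>z. \<Phi> 0 z = z \<and>
       (\<forall>s\<in>{0..1}. ((\<lambda>t. \<Phi> t z) has_vector_derivative X s (\<Phi> s z)) (at s within {0..1})))"

definition hamiltonian_isotopy :: "(real \<Rightarrow> complex ^ 'n \<Rightarrow> complex ^ 'n) \<Rightarrow> bool" where
  "hamiltonian_isotopy \<Phi> \<longleftrightarrow>
     (\<exists>H X. smooth_on ({0..1} \<times> UNIV) (\<lambda>(t, z). H t z) \<and>
        (\<forall>t\<in>{0..1}. hamiltonian_vector_field (H t) (X t)) \<and>
        is_flow X \<Phi> \<and>
        (\<forall>s\<in>{0..1}. diffeomorphism (\<Phi> s)))"

definition ball2n :: "real \<Rightarrow> (complex ^ 'n) set" where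
  "ball2n b = cball 0 (sqrt (b / pi))"

definition hamiltonian_isotopic_in_ball ::
    "real \<Rightarrow> (complex ^ 'n) set \<Rightarrow> (complex ^ 'n) set \<Rightarrow> bool" where
  "hamiltonian_isotopic_in_ball b L L' \<longleftrightarrow>
     (\<exists>\<Phi>. hamiltonian_isotopy \<Phi> \<and> \<Phi> 0 = id \<and> \<Phi> 1 ` L = L' \<and>
        (\<forall>s\<in>{0..1}. \<Phi> s ` L \<subseteq> ball2n b))"

section \<open>Product tori\<close>

definition circle_of_area :: "real \<Rightarrow> complex set" where
  "circle_of_area r = frontier (cball 0 (sqrt (r / pi)))"

lemma measure_disc: "0 \<le> r \<Longrightarrow> measure lborel (cball (0::complex) (sqrt (r / pi))) = r"
  by (simp add: content_cball unit_ball_vol_2)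

definition product_torus :: "real ^ 'n \<Rightarrow> (complex ^ 'n) set" where
  "product_torus a = {z. \<forall>j. z $ j \<in> circle_of_area (a $ j)}"

section \<open>Invariants of the area vector\<close>

definition min_area :: "real ^ 'n \<Rightarrow> real" where
  "min_area a = Min (range (\<lambda>i. a $ i))"

definition min_mult :: "real ^ 'n \<Rightarrow> nat" where
  "min_mult a = card {i. a $ i = min_area a}"

text \<open>\<open>total_area a\<close> is |a| and \<open>big_area a\<close> is ||a||; neither is the Euclidean norm of \<open>a\<close>.\<close>

definition total_area :: "real ^ 'n \<Rightarrow> real" where
  "total_area a = (\<Sum>i\<in>UNIV. a $ i)"

definition big_area :: "real ^ 'n \<Rightarrow> real" where
  "big_area a = total_area a + min_area a"

definition Gamma_group :: "real ^ 'n \<Rightarrow> real set" where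
  "Gamma_group a = {(\<Sum>i\<in>UNIV. of_int (k i) * (a $ i - min_area a)) |k :: 'n \<Rightarrow> int. True}"

definition area_equiv :: "real ^ 'n \<Rightarrow> real ^ 'n \<Rightarrow> bool" (infix "\<simeq>" 50) where
  "a \<simeq> a' \<longleftrightarrow>
     min_area a = min_area a' \<and> min_mult a = min_mult a' \<and> Gamma_group a = Gamma_group a'"

end

theory Submission
  imports Defs
begin

text \<open>
  Write \<open>\<mu>\<close> for the smallest area and \<open>d i = a i - \<mu>\<close>, so that \<open>T(a)\<close> is given by \<open>\<mu>\<close> and the positive
  ones among the \<open>d i\<close>. Permutations of the components are realised by unitary rotations of two
  coordinates; these preserve the norm, which gives the first claim.

  The second claim rests on one nonlinear isotopy. Take indices \<open>i, j, k\<close> with \<open>a i < a k\<close>. The function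
  \<open>Im (z i * cnj (z j) * sgn (z k))\<close> rotates the plane with coordinates \<open>z i * sgn (z k)\<close> and \<open>z j\<close>,
  while \<open>sgn (z k)\<close> stays constant and \<open>|z k|^2 - |z i|^2\<close> is conserved. After a quarter turn the areas
  \<open>a i\<close> and \<open>a j\<close> are exchanged and \<open>a k\<close> has become \<open>a k - a i + a j\<close>. The function is
  singular at \<open>z k = 0\<close>, but it may be multiplied by a cut-off function of the conserved quantity, which
  equals \<open>a k - a i\<close> (up to a factor) on the whole torus: the flow keeps a closed form and
  extends to the whole space by the identity (locale \<open>shear_flow\<close>, lemma \<open>shear_tori\<close>). On the way,
  \<open>pi * |z k|^2\<close> exceeds \<open>a k\<close> by at most \<open>a j\<close>. If \<open>a i = \<mu>\<close>, a subsequent exchange of \<open>i\<close> and \<open>j\<close> shows that \<open>d k\<close>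
  can be replaced by \<open>d k + d j\<close>, where the ball of the larger torus, \<open>|a'| + \<mu>\<close>, is large enough
  (lemma \<open>add_tori\<close>).

  What remains is arithmetic: two families of \<open>l\<close> positive reals that generate the same subgroup \<open>\<Gamma>\<close> are
  related by moves \<open>d k := d k + d j\<close>, their inverses and transpositions, and the sum never
  exceeds the larger one of the two given sums (theorem \<open>conn_common_form\<close>). If \<open>\<Gamma>\<close> is cyclic, the Euclidean
  algorithm makes all members equal to the generator. Otherwise it produces arbitrarily small
  members. For \<open>l = 2\<close>, one family is shrunk until the other one lies in its cone, and a nonnegative
  unimodular matrix of size two is a product of elementary ones. For \<open>l \<ge> 3\<close>, both families are brought to the
  same normal form: fix a basis of \<open>\<Gamma>\<close> with all members in \<open>(0, v]\<close>, where \<open>v\<close> is a member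
  of the basis and is so small that sums up to \<open>(l + 1) v\<close> are harmless. Once a family contains \<open>v\<close>, all
  elementary operations modulo \<open>v\<close> are available, signs included, and the basis can be inserted step by step,
  because the coefficients that occur are coprime. Combinations of the basis are then
  subtracted from the remaining members until these vanish modulo \<open>v\<close>, that is, are copies of \<open>v\<close> (lemma
  \<open>conn_canonical\<close>).
\<close>

section \<open>Calculus of smooth maps\<close>

definition smooth :: "'a::euclidean_space set \<Rightarrow> ('a \<Rightarrow> 'b::euclidean_space) \<Rightarrow> bool" where
  "smooth U f \<longleftrightarrow> (\<forall>k. Ck_on k U f)"

lemma Ck_on_subset: "Ck_on k U f \<Longrightarrow> V \<subseteq> U \<Longrightarrow> Ck_on k V f"
  by (induction k arbitrary: f) (auto intro: continuous_on_subset)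

lemma Ck_on_SucD: "Ck_on (Suc k) U f \<Longrightarrow> Ck_on k U f"
proof (induction k arbitrary: f)
  case 0
  then show ?case
    by (auto intro!: continuous_at_imp_continuous_on differentiable_imp_continuous_within)
next
  case (Suc k)
  then show ?case by (metis Ck_on.simps(2))
qed

lemma Ck_on_cong:
  assumes "open U" "\<And>x. x \<in> U \<Longrightarrow> f x = g x" "Ck_on k U f"
  shows "Ck_on k U g"
  using assms(2,3)
proof (induction k arbitrary: f g)
  case 0
  then show ?case by (metis Ck_on.simps(1) continuous_on_cong)
next
  case (Suc k)
  have d: "(g has_derivative D) (at x)" if "x \<in> U" "(f has_derivative D) (at x)" for x D
    using has_derivative_transform_within_open[OF that(2) assms(1) that(1)] Suc.prems(1) by blast
  have fd: "frechet_derivative g (at x) = frechet_derivative f (at x)" if "x \<in> U" for x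
    using d[OF that] Suc.prems(2) that
    by (metis Ck_on.simps(2) frechet_derivative_at frechet_derivative_works)
  show ?case
    using Suc d fd unfolding Ck_on.simps
    by (metis (no_types, lifting) differentiable_def)
qed

lemma Ck_on_Un:
  assumes "open U" "open V" "Ck_on k U f" "Ck_on k V f"
  shows "Ck_on k (U \<union> V) f"
  using assms(3,4)
  by (induction k arbitrary: f) (auto intro: continuous_on_open_Un assms)

text \<open>A derivative computed by hand may be used in place of the one chosen by
  \<^const>\<open>frechet_derivative\<close>.\<close>

lemma Ck_on_SucI:
  assumes "open U" "\<And>x. x \<in> U \<Longrightarrow> (f has_derivative D x) (at x)"
    "\<And>v. Ck_on k U (\<lambda>x. D x v)"
  shows "Ck_on (Suc k) U f"
proof -
  have "frechet_derivative f (at x) = D x" if "x \<in> U" for x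
    using frechet_derivative_at[OF assms(2)[OF that]] by simp
  then show ?thesis
    using assms by (auto simp: differentiable_def intro: Ck_on_cong[OF assms(1) _ assms(3)])
qed

lemma Ck_on_SucE:
  assumes "Ck_on (Suc k) U f"
  shows "x \<in> U \<Longrightarrow> (f has_derivative frechet_derivative f (at x)) (at x)"
    "Ck_on k U (\<lambda>x. frechet_derivative f (at x) v)"
  using assms by (auto simp flip: frechet_derivative_works)

lemma Ck_on_const: "open U \<Longrightarrow> Ck_on k U (\<lambda>x. c)"
  by (induction k arbitrary: c) (auto intro!: Ck_on_SucI continuous_intros derivative_eq_intros simp del: Ck_on.simps(2))

lemma Ck_on_linear:
  assumes "open U" "bounded_linear f"
  shows "Ck_on k U f"
proof (cases k)
  case 0
  then show ?thesis by (simp add: assms(2) linear_continuous_on)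
next
  case (Suc m)
  then show ?thesis
    using Ck_on_SucI[where D="\<lambda>x. f", OF assms(1)] bounded_linear_imp_has_derivative[OF assms(2)]
      Ck_on_const[OF assms(1)] by blast
qed

lemma Ck_on_add:
  assumes "open U" "Ck_on k U f" "Ck_on k U g"
  shows "Ck_on k U (\<lambda>x. f x + g x)"
  using assms(2,3)
proof (induction k arbitrary: f g)
  case 0
  then show ?case by (auto intro: continuous_intros)
next
  case (Suc k)
  show ?case
    by (rule Ck_on_SucI[OF assms(1)])
      (auto intro!: has_derivative_add Ck_on_SucE[OF Suc.prems(1)] Ck_on_SucE[OF Suc.prems(2)] Suc.IH
        simp del: Ck_on.simps)
qed

lemma Ck_on_sum:
  assumes "open U" "finite I" "\<And>i. i \<in> I \<Longrightarrow> Ck_on k U (f i)"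
  shows "Ck_on k U (\<lambda>x. \<Sum>i\<in>I. f i x)"
  using assms(2,3)
  by (induction I) (auto intro: Ck_on_add Ck_on_const assms(1))

lemma Ck_on_bilinear:
  assumes "bounded_bilinear B" "open U" "Ck_on k U f" "Ck_on k U g"
  shows "Ck_on k U (\<lambda>x. B (f x) (g x))"
  using assms(3,4)
proof (induction k arbitrary: f g)
  case 0
  then show ?case using bounded_bilinear.continuous_on[OF assms(1)] by auto
next
  case (Suc k)
  show ?case
  proof (rule Ck_on_SucI[OF assms(2)])
    fix x assume "x \<in> U"
    then show "((\<lambda>x. B (f x) (g x)) has_derivative
       (\<lambda>v. B (f x) (frechet_derivative g (at x) v) + B (frechet_derivative f (at x) v) (g x))) (at x)"
      using bounded_bilinear.FDERIV[OF assms(1)] Ck_on_SucE(1)[OF Suc.prems(1)] Ck_on_SucE(1)[OF Suc.prems(2)]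
      by blast
  next
    fix v
    show "Ck_on k U (\<lambda>x. B (f x) (frechet_derivative g (at x) v) + B (frechet_derivative f (at x) v) (g x))"
      by (intro Ck_on_add assms Suc.IH Ck_on_SucE(2) Suc.prems Ck_on_SucD)
  qed
qed

text \<open>The derivative of a composition is expanded in the standard basis: this turns it into a sum of products of
  functions to which the induction hypothesis and the product rule apply.\<close>

lemma Ck_on_compose:
  assumes "open U" "open V" "Ck_on k U f" "Ck_on k V g" "\<And>x. x \<in> U \<Longrightarrow> f x \<in> V"
  shows "Ck_on k U (\<lambda>x. g (f x))"
  using assms(3,4)
proof (induction k arbitrary: g)
  case 0
  then show ?case using assms(5) by (auto intro: continuous_on_compose2)
next
  case (Suc k)
  show ?case
  proof (rule Ck_on_SucI[OF assms(1)])
    fix x assume x: "x \<in> U"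
    have "((\<lambda>x. g (f x)) has_derivative
        (\<lambda>v. frechet_derivative g (at (f x)) (frechet_derivative f (at x) v))) (at x)"
      using has_derivative_compose Ck_on_SucE(1)[OF Suc.prems(1) x] Ck_on_SucE(1)[OF Suc.prems(2) assms(5)[OF x]]
      by blast
    moreover have "(\<lambda>v. frechet_derivative g (at (f x)) (frechet_derivative f (at x) v)) =
        (\<lambda>v. \<Sum>b\<in>Basis. (frechet_derivative f (at x) v \<bullet> b) *\<^sub>R frechet_derivative g (at (f x)) b)"
    proof
      fix v
      have "linear (frechet_derivative g (at (f x)))"
        using Ck_on_SucE(1)[OF Suc.prems(2) assms(5)[OF x]] has_derivative_linear by blast
      then show "frechet_derivative g (at (f x)) (frechet_derivative f (at x) v) =
          (\<Sum>b\<in>Basis. (frechet_derivative f (at x) v \<bullet> b) *\<^sub>R frechet_derivative g (at (f x)) b)"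
        using linear_sum[of "frechet_derivative g (at (f x))"
            "\<lambda>b. (frechet_derivative f (at x) v \<bullet> b) *\<^sub>R b" Basis]
        by (simp add: linear_cmul euclidean_representation)
    qed
    ultimately show "((\<lambda>x. g (f x)) has_derivative (\<lambda>v. \<Sum>b\<in>Basis.
        (frechet_derivative f (at x) v \<bullet> b) *\<^sub>R frechet_derivative g (at (f x)) b)) (at x)"
      by metis
  next
    fix v
    show "Ck_on k U (\<lambda>x. \<Sum>b\<in>Basis.
        (frechet_derivative f (at x) v \<bullet> b) *\<^sub>R frechet_derivative g (at (f x)) b)"
      by (intro Ck_on_sum assms finite_Basis Ck_on_bilinear[OF bounded_bilinear_scaleR] Suc.IH[OF Ck_on_SucD]
          Suc.prems Ck_on_SucE(2)[OF Suc.prems(2)] Ck_on_bilinear[OF bounded_bilinear_inner]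
          Ck_on_SucE(2)[OF Suc.prems(1)] Ck_on_const)
  qed
qed

lemma smooth_mono: "smooth U f \<Longrightarrow> V \<subseteq> U \<Longrightarrow> smooth V f"
  unfolding smooth_def using Ck_on_subset by blast

lemma smooth_const: "open U \<Longrightarrow> smooth U (\<lambda>x. c)"
  by (simp add: smooth_def Ck_on_const)

lemma smooth_linear: "open U \<Longrightarrow> bounded_linear f \<Longrightarrow> smooth U f"
  by (simp add: smooth_def Ck_on_linear)

lemma smooth_id: "open U \<Longrightarrow> smooth U (\<lambda>x. x)"
  by (intro smooth_linear bounded_linear_ident)

lemma smooth_add: "open U \<Longrightarrow> smooth U f \<Longrightarrow> smooth U g \<Longrightarrow> smooth U (\<lambda>x. f x + g x)"
  by (simp add: smooth_def Ck_on_add)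

lemma smooth_sum: "open U \<Longrightarrow> finite I \<Longrightarrow> (\<And>i. i \<in> I \<Longrightarrow> smooth U (f i)) \<Longrightarrow> smooth U (\<lambda>x. \<Sum>i\<in>I. f i x)"
  by (simp add: smooth_def Ck_on_sum)

lemma smooth_bilinear:
  "bounded_bilinear B \<Longrightarrow> open U \<Longrightarrow> smooth U f \<Longrightarrow> smooth U g \<Longrightarrow> smooth U (\<lambda>x. B (f x) (g x))"
  by (simp add: smooth_def Ck_on_bilinear)

lemmas smooth_mult = smooth_bilinear[OF bounded_bilinear_mult]
lemmas smooth_scaleR = smooth_bilinear[OF bounded_bilinear_scaleR]

lemma smooth_compose:
  "open U \<Longrightarrow> open V \<Longrightarrow> smooth U f \<Longrightarrow> smooth V g \<Longrightarrow> (\<And>x. x \<in> U \<Longrightarrow> f x \<in> V) \<Longrightarrow> smooth U (\<lambda>x. g (f x))"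
  unfolding smooth_def using Ck_on_compose by blast

lemma smooth_cong:
  "open U \<Longrightarrow> (\<And>x. x \<in> U \<Longrightarrow> f x = g x) \<Longrightarrow> smooth U f \<Longrightarrow> smooth U g"
  unfolding smooth_def using Ck_on_cong by blast

lemma smooth_Un: "open U \<Longrightarrow> open V \<Longrightarrow> smooth U f \<Longrightarrow> smooth V f \<Longrightarrow> smooth (U \<union> V) f"
  by (simp add: smooth_def Ck_on_Un)

lemma smooth_linear_compose:
  "bounded_linear g \<Longrightarrow> open U \<Longrightarrow> smooth U f \<Longrightarrow> smooth U (\<lambda>x. g (f x))"
  using smooth_compose[of U UNIV f g] smooth_linear by auto

lemmas smooth_Im = smooth_linear_compose[OF bounded_linear_Im]
  and smooth_cnj = smooth_linear_compose[OF bounded_linear_cnj]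
  and smooth_of_real = smooth_linear_compose[OF bounded_linear_of_real]
  and smooth_minus = smooth_linear_compose[OF bounded_linear_minus[OF bounded_linear_ident]]
  and smooth_nth = smooth_linear_compose[OF bounded_linear_vec_nth]
  and smooth_fst = smooth_linear_compose[OF bounded_linear_fst]
  and smooth_snd = smooth_linear_compose[OF bounded_linear_snd]

lemma smooth_diff: "open U \<Longrightarrow> smooth U f \<Longrightarrow> smooth U g \<Longrightarrow> smooth U (\<lambda>x. f x - g x)"
  using smooth_add[of U f "\<lambda>x. - g x"] smooth_minus[of U g] by simp

lemma smooth_Pair:
  assumes "open U" "smooth U f" "smooth U g"
  shows "smooth U (\<lambda>x. (f x, g x))"
proof -
  have "smooth U (\<lambda>x. (f x, 0) + (0, g x))"
    using assms by (intro smooth_add smooth_linear_compose[of "\<lambda>y. (y, 0)"] smooth_linear_compose[of "\<lambda>y. (0, y)"])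
      (auto intro!: bounded_linear_Pair bounded_linear_zero bounded_linear_ident)
  then show ?thesis by simp
qed

lemma bounded_linear_axis: "bounded_linear (axis i :: 'b::euclidean_space \<Rightarrow> 'b ^ 'n)"
  by (intro linear_conv_bounded_linear[THEN iffD1] linearI) (auto simp: vec_eq_iff axis_def)

lemma smooth_vec:
  assumes "open U" "\<And>i. smooth U (\<lambda>x. f x $ i)"
  shows "smooth U (f :: 'a::euclidean_space \<Rightarrow> ('b::euclidean_space) ^ 'n)"
proof -
  have "smooth U (\<lambda>x. \<Sum>i\<in>UNIV. axis i (f x $ i))"
    using assms by (intro smooth_sum smooth_linear_compose[OF bounded_linear_axis]) auto
  moreover have "(\<lambda>x. \<Sum>i\<in>UNIV. axis i (f x $ i)) = f"
    by (auto simp: fun_eq_iff vec_eq_iff axis_def sum.delta' cong: if_cong)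
  ultimately show ?thesis by simp
qed

section \<open>Elementary smooth functions of one variable\<close>

lemma Ck_on_Suc_real:
  fixes f :: "real \<Rightarrow> real"
  assumes "open U" "\<And>x. x \<in> U \<Longrightarrow> (f has_real_derivative f' x) (at x)" "Ck_on k U f'"
  shows "Ck_on (Suc k) U f"
  by (rule Ck_on_SucI[OF assms(1), where D="\<lambda>x v. f' x * v"])
    (use assms in \<open>auto simp: has_field_derivative_def intro!: Ck_on_bilinear[OF bounded_bilinear_mult] Ck_on_const\<close>)

lemma Ck_on_real_continuous:
  fixes f :: "real \<Rightarrow> real"
  assumes "\<And>x. x \<in> U \<Longrightarrow> (f has_real_derivative f' x) (at x)"
  shows "Ck_on 0 U f"
  using assms by (auto intro!: continuous_at_imp_continuous_on DERIV_isCont)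

lemma smooth_sin_cos: "smooth UNIV (sin :: real \<Rightarrow> real)" "smooth UNIV (cos :: real \<Rightarrow> real)"
proof -
  have "Ck_on k UNIV (sin :: real \<Rightarrow> real) \<and> Ck_on k UNIV (cos :: real \<Rightarrow> real)" for k
  proof (induction k)
    case 0
    then show ?case by (auto intro: continuous_intros)
  next
    case (Suc k)
    then have "Ck_on k UNIV (\<lambda>x. - sin x :: real)"
      using Ck_on_compose[of UNIV UNIV k sin uminus] Ck_on_linear[OF _ bounded_linear_minus[OF bounded_linear_ident]] by auto
    with Suc show ?case
      by (auto intro!: Ck_on_Suc_real derivative_eq_intros simp del: Ck_on.simps)
  qed
  then show "smooth UNIV (sin :: real \<Rightarrow> real)" "smooth UNIV (cos :: real \<Rightarrow> real)"
    by (auto simp: smooth_def)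
qed

lemma smooth_inverse_fun: "smooth (- {0}) (inverse :: real \<Rightarrow> real)"
proof -
  have o: "open (- {0::real})" by auto
  have "Ck_on k (- {0}) (inverse :: real \<Rightarrow> real)" for k
  proof (induction k)
    case 0
    then show ?case by (auto intro!: continuous_intros)
  next
    case (Suc k)
    have "Ck_on k (- {0}) (\<lambda>x. (-1) * (inverse x * inverse x) :: real)"
      by (intro Ck_on_bilinear[OF bounded_bilinear_mult] Ck_on_const o Suc)
    then show ?case
      by (rule Ck_on_Suc_real[OF o, rotated]) (auto intro!: derivative_eq_intros simp: power2_eq_square)
  qed
  then show ?thesis by (simp add: smooth_def)
qed

lemma smooth_sqrt_fun: "smooth {0<..} sqrt"
proof -
  have "Ck_on k {0<..} sqrt" for k
  proof (induction k)
    case 0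
    then show ?case by (auto intro!: continuous_intros)
  next
    case (Suc k)
    have "Ck_on k {0<..} (\<lambda>x. inverse (sqrt x) * (1/2))"
      using smooth_inverse_fun
      by (intro Ck_on_bilinear[OF bounded_bilinear_mult] Ck_on_const Ck_on_compose[OF _ _ Suc, of "- {0}"])
        (auto simp: smooth_def)
    then show ?case
      by (rule Ck_on_Suc_real[rotated 2]) (auto intro!: DERIV_real_sqrt)
  qed
  then show ?thesis by (simp add: smooth_def)
qed

lemma smooth_inverse: "open U \<Longrightarrow> smooth U f \<Longrightarrow> (\<And>x. x \<in> U \<Longrightarrow> f x \<noteq> 0) \<Longrightarrow> smooth U (\<lambda>x. inverse (f x) :: real)"
  by (rule smooth_compose[OF _ _ _ smooth_inverse_fun]) auto

lemma smooth_sqrt: "open U \<Longrightarrow> smooth U f \<Longrightarrow> (\<And>x. x \<in> U \<Longrightarrow> f x > 0) \<Longrightarrow> smooth U (\<lambda>x. sqrt (f x))"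
  by (rule smooth_compose[OF _ _ _ smooth_sqrt_fun]) auto

lemma smooth_sin: "open U \<Longrightarrow> smooth U f \<Longrightarrow> smooth U (\<lambda>x. sin (f x) :: real)"
  by (rule smooth_compose[OF _ _ _ smooth_sin_cos(1)]) auto

lemma smooth_cos: "open U \<Longrightarrow> smooth U f \<Longrightarrow> smooth U (\<lambda>x. cos (f x) :: real)"
  by (rule smooth_compose[OF _ _ _ smooth_sin_cos(2)]) auto

text \<open>The functions \<open>exp (- 1 / x) / x ^ m\<close>, extended by \<open>0\<close>. The derivative of \<open>flat m\<close> is a combination of
  \<open>flat (m + 2)\<close> and \<open>flat (m + 1)\<close>, also at \<open>0\<close>, which gives smoothness for all of them together.\<close>

definition flat :: "nat \<Rightarrow> real \<Rightarrow> real" where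
  "flat m x = (if x > 0 then inverse x ^ m * exp (- inverse x) else 0)"

lemma flat_tendsto_0: "(flat m \<longlongrightarrow> 0) (at 0)"
proof -
  have "((\<lambda>y::real. y ^ m / exp y) \<longlongrightarrow> 0) at_top"
    by (rule tendsto_power_div_exp_0)
  then have "((\<lambda>x::real. inverse x ^ m / exp (inverse x)) \<longlongrightarrow> 0) (at_right 0)"
    by (rule filterlim_compose) (rule filterlim_inverse_at_top_right)
  then have r: "(flat m \<longlongrightarrow> 0) (at_right 0)"
    by (rule Lim_transform_eventually)
      (auto simp: eventually_at_filter flat_def exp_minus field_simps)
  have l: "(flat m \<longlongrightarrow> 0) (at_left 0)"
    by (rule Lim_transform_eventually[OF tendsto_const]) (auto simp: eventually_at_filter flat_def)
  from r l show ?thesis by (simp add: filterlim_split_at)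
qed

lemma flat_has_derivative:
  "(flat m has_real_derivative flat (m + 2) x - real m * flat (m + 1) x) (at x)"
proof -
  consider "x > 0" | "x < 0" | "x = 0" by linarith
  then show ?thesis
  proof cases
    case 1
    have "((\<lambda>x. inverse x ^ m * exp (- inverse x)) has_real_derivative
        flat (m + 2) x - real m * flat (m + 1) x) (at x)"
      by (rule derivative_eq_intros refl less_imp_neq[OF 1, symmetric])+
        (use 1 in \<open>cases m; simp add: flat_def algebra_simps\<close>)
    then show ?thesis
      by (rule has_field_derivative_transform_within_open[where S="{0<..}"]) (use 1 in \<open>auto simp: flat_def\<close>)
  next
    case 2
    have "((\<lambda>x. 0) has_real_derivative flat (m + 2) x - real m * flat (m + 1) x) (at x)"
      using 2 by (auto simp: flat_def)
    then show ?thesis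
      by (rule has_field_derivative_transform_within_open[where S="{..<0}"]) (use 2 in \<open>auto simp: flat_def\<close>)
  next
    case 3
    have "((\<lambda>h. flat (Suc m) h) \<longlongrightarrow> 0) (at 0)" by (rule flat_tendsto_0)
    then have "((\<lambda>h. (flat m (0 + h) - flat m 0) / h) \<longlongrightarrow> 0) (at 0)"
      by (rule Lim_transform_eventually) (auto simp: eventually_at_filter flat_def field_simps)
    then show ?thesis using 3 by (simp add: DERIV_def flat_def)
  qed
qed

lemma smooth_flat: "smooth UNIV (flat m)"
proof -
  have "Ck_on k UNIV (flat m)" for k
  proof (induction k arbitrary: m)
    case 0
    show ?case by (rule Ck_on_real_continuous) (rule flat_has_derivative)
  next
    case (Suc k)
    have "Ck_on k UNIV (\<lambda>x. flat (m + 2) x + (- real m) * flat (m + 1) x)"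
      by (intro Ck_on_add Ck_on_bilinear[OF bounded_bilinear_mult] Ck_on_const Suc open_UNIV)
    then show ?case
      by (rule Ck_on_Suc_real[OF open_UNIV, rotated]) (use flat_has_derivative in auto)
  qed
  then show ?thesis by (simp add: smooth_def)
qed

definition smooth_step :: "real \<Rightarrow> real" where
  "smooth_step x = flat 0 x * inverse (flat 0 x + flat 0 (1 - x))"

lemma flat_0_pos: "flat 0 x + flat 0 (1 - x) > 0"
  by (auto simp: flat_def intro: add_pos_pos)

lemma smooth_smooth_step: "smooth UNIV smooth_step"
  unfolding smooth_step_def
  by (intro smooth_mult smooth_flat open_UNIV smooth_inverse smooth_add
      smooth_compose[OF _ _ _ smooth_flat[of 0]] smooth_diff smooth_const smooth_id UNIV_I)
    (use flat_0_pos in \<open>auto simp: less_imp_neq[symmetric]\<close>)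

lemma smooth_step_0: "x \<le> 0 \<Longrightarrow> smooth_step x = 0"
  by (simp add: smooth_step_def flat_def)

lemma smooth_step_1: "x \<ge> 1 \<Longrightarrow> smooth_step x = 1"
  by (simp add: smooth_step_def flat_def)

lemma smooth_step_range: "smooth_step x \<in> {0..1}"
  using flat_0_pos[of x] by (auto simp: smooth_step_def flat_def field_simps)

text \<open>For \<open>p < q\<close>, a smooth transition from \<open>0\<close> to \<open>1\<close> that is constant on both sides of \<open>[p, q]\<close>. It serves
  as a time change and as a cut-off.\<close>

definition ramp :: "real \<Rightarrow> real \<Rightarrow> real \<Rightarrow> real" where
  "ramp p q t = smooth_step ((t - p) * inverse (q - p))"

definition ramp' :: "real \<Rightarrow> real \<Rightarrow> real \<Rightarrow> real" where
  "ramp' p q t = frechet_derivative (ramp p q) (at t) 1"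

lemma smooth_ramp: "smooth UNIV (ramp p q)"
  unfolding ramp_def
  by (intro smooth_compose[OF _ _ _ smooth_smooth_step] smooth_mult smooth_diff smooth_const smooth_id open_UNIV UNIV_I)

lemma smooth_ramp': "smooth UNIV (ramp' p q)"
  unfolding smooth_def ramp'_def
  using smooth_ramp[of p q] Ck_on_SucE(2) unfolding smooth_def by blast

lemma ramp_has_derivative: "(ramp p q has_real_derivative ramp' p q t) (at t)"
proof -
  have "(ramp p q has_derivative frechet_derivative (ramp p q) (at t)) (at t)"
    using smooth_ramp[of p q] Ck_on_SucE(1) unfolding smooth_def by blast
  moreover from this have "linear (frechet_derivative (ramp p q) (at t))"
    by (rule has_derivative_linear)
  then have "frechet_derivative (ramp p q) (at t) v = ramp' p q t * v" for v
    using linear_cmul[of "frechet_derivative (ramp p q) (at t)" v 1] by (simp add: ramp'_def mult.commute)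
  then have "frechet_derivative (ramp p q) (at t) = (*) (ramp' p q t)" by auto
  ultimately show ?thesis by (simp add: has_field_derivative_def)
qed

lemma ramp_range: "ramp p q t \<in> {0..1}"
  by (simp only: ramp_def smooth_step_range)

lemma ramp_0: "p < q \<Longrightarrow> t \<le> p \<Longrightarrow> ramp p q t = 0"
  unfolding ramp_def by (rule smooth_step_0) (auto simp: field_simps)

lemma ramp_1: "p < q \<Longrightarrow> q \<le> t \<Longrightarrow> ramp p q t = 1"
  unfolding ramp_def by (rule smooth_step_1) (auto simp: field_simps)

text \<open>Both constant values are extremal, so the derivative vanishes there, end points included.\<close>

lemma ramp'_0:
  assumes "p < q" "t \<le> p \<or> q \<le> t"
  shows "ramp' p q t = 0"
proof (cases "t \<le> p")
  case True
  then have "ramp p q t \<le> ramp p q y" for y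
    using assms(1) ramp_range[of p q y] by (simp add: ramp_0)
  then show ?thesis
    by (intro DERIV_local_min[OF ramp_has_derivative[of p q t] zero_less_one]) auto
next
  case False
  then have "ramp p q y \<le> ramp p q t" for y
    using assms ramp_range[of p q y] by (simp add: ramp_1)
  then show ?thesis
    by (intro DERIV_local_max[OF ramp_has_derivative[of p q t] zero_less_one]) auto
qed


section \<open>Operations on Hamiltonian isotopies\<close>

lemma smooth_on_UNIV: "smooth_on UNIV f \<longleftrightarrow> smooth UNIV f"
proof
  assume "smooth_on UNIV f"
  then obtain U g where "open U" "UNIV \<subseteq> U" "smooth U g" "\<forall>x\<in>UNIV. g x = f x"
    unfolding smooth_on_def smooth_def by blast
  then show "smooth UNIV f"
    by (metis UNIV_I ext top.extremum_uniqueI)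
qed (auto simp: smooth_on_def smooth_def)

lemma smooth_onD:
  assumes "smooth_on S f"
  obtains U g where "open U" "S \<subseteq> U" "smooth U g" "\<And>x. x \<in> S \<Longrightarrow> g x = f x"
  using assms unfolding smooth_on_def smooth_def by blast

lemma smooth_onI:
  "open U \<Longrightarrow> S \<subseteq> U \<Longrightarrow> smooth U f \<Longrightarrow> smooth_on S f"
  unfolding smooth_on_def smooth_def by blast

lemma diffeomorphism_compose:
  fixes f g :: "'a::euclidean_space \<Rightarrow> 'a"
  assumes "diffeomorphism f" "diffeomorphism g"
  shows "diffeomorphism (f \<circ> g)"
proof -
  have c: "smooth UNIV (h \<circ> k)" if "smooth UNIV h" "smooth UNIV k" for h k :: "'a \<Rightarrow> 'a"
    using smooth_compose[OF open_UNIV open_UNIV that(2,1)] by (simp add: o_def)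
  show ?thesis
    using assms c unfolding diffeomorphism_def smooth_on_UNIV
    by (simp add: bij_comp o_inv_distrib)
qed

lemma diffeomorphism_inv: "diffeomorphism f \<Longrightarrow> diffeomorphism (inv f)"
  unfolding diffeomorphism_def by (simp add: bij_imp_bij_inv inv_inv_eq)

lemma omega_add: "omega (u + u') v = omega u v + omega u' v"
  by (simp add: omega_def sum.distrib[symmetric] algebra_simps)

lemma omega_scaleR: "omega (c *\<^sub>R u) v = c * omega u v"
  by (simp add: omega_def sum_distrib_left algebra_simps)

lemma hamiltonian_vector_field_add:
  assumes "hamiltonian_vector_field h X" "hamiltonian_vector_field h' X'"
  shows "hamiltonian_vector_field (\<lambda>z. h z + h' z) (\<lambda>z. X z + X' z)"
proof -
  have "omega (X z + X' z) = (\<lambda>v. omega (X z) v + omega (X' z) v)" for z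
    by (simp add: omega_add fun_eq_iff)
  then show ?thesis
    using assms by (auto simp: hamiltonian_vector_field_def intro!: has_derivative_add)
qed

lemma hamiltonian_vector_field_scale:
  assumes "hamiltonian_vector_field h X"
  shows "hamiltonian_vector_field (\<lambda>z. c * h z) (\<lambda>z. c *\<^sub>R X z)"
proof -
  have "omega (c *\<^sub>R X z) = (\<lambda>v. c * omega (X z) v)" for z
    by (simp add: omega_scaleR fun_eq_iff)
  then show ?thesis
    using assms by (auto simp: hamiltonian_vector_field_def intro!: has_derivative_mult_right)
qed

text \<open>An autonomous Hamiltonian function with an explicit complete flow: the time \<open>s\<close> map is a
  diffeomorphism since the time \<open>- s\<close> map is its inverse.\<close>

lemma hamiltonian_isotopy_of_flow:
  assumes "smooth UNIV h" "hamiltonian_vector_field h X"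
    "\<And>z. \<Phi> 0 z = z" "\<And>s z. ((\<lambda>t. \<Phi> t z) has_vector_derivative X (\<Phi> s z)) (at s)"
    "\<And>s z. \<Phi> (- s) (\<Phi> s z) = z" "\<And>s. smooth UNIV (\<Phi> s)"
  shows "hamiltonian_isotopy \<Phi>"
proof -
  have "\<Phi> (- s) \<circ> \<Phi> s = id" "\<Phi> s \<circ> \<Phi> (- s) = id" for s
    using assms(5) assms(5)[of "- s"] by (auto simp: fun_eq_iff)
  then have "bij (\<Phi> s)" "inv (\<Phi> s) = \<Phi> (- s)" for s
    by (metis o_bij) (metis \<open>\<And>s. \<Phi> (- s) \<circ> \<Phi> s = id\<close> \<open>\<And>s. \<Phi> s \<circ> \<Phi> (- s) = id\<close> inv_unique_comp)
  then have "diffeomorphism (\<Phi> s)" for s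
    using assms(6) by (simp add: diffeomorphism_def smooth_on_UNIV)
  moreover have "smooth_on ({0..1} \<times> UNIV) (\<lambda>(t::real, z). h z)"
    by (rule smooth_onI[of UNIV])
      (auto simp: case_prod_beta' intro!: smooth_compose[OF _ _ _ assms(1)] smooth_snd smooth_id)
  ultimately show ?thesis
    unfolding hamiltonian_isotopy_def is_flow_def
    using assms(2-4) has_vector_derivative_at_within
    by (intro exI[of _ "\<lambda>_. h"] exI[of _ "\<lambda>_. X"]) blast
qed

lemma hamiltonian_isotopyE:
  assumes "hamiltonian_isotopy \<Phi>"
  obtains U h X where "open U" "{0..1} \<times> UNIV \<subseteq> U" "smooth U h"
    "\<And>t. t \<in> {0..1} \<Longrightarrow> hamiltonian_vector_field (\<lambda>z. h (t, z)) (X t)"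
    "is_flow X \<Phi>" "\<And>s. s \<in> {0..1} \<Longrightarrow> diffeomorphism (\<Phi> s)"
proof -
  obtain H X where H: "smooth_on ({0..1} \<times> UNIV) (\<lambda>(t, z). H t z)"
    and X: "\<And>t. t \<in> {0..1} \<Longrightarrow> hamiltonian_vector_field (H t) (X t)"
    and flow: "is_flow X \<Phi>" "\<And>s. s \<in> {0..1} \<Longrightarrow> diffeomorphism (\<Phi> s)"
    using assms unfolding hamiltonian_isotopy_def by blast
  obtain U h where U: "open U" "{0..1} \<times> UNIV \<subseteq> U" "smooth U h"
    and h: "\<And>x. x \<in> {0..1} \<times> UNIV \<Longrightarrow> h x = (\<lambda>(t, z). H t z) x"
    using smooth_onD[OF H] by blast
  have "hamiltonian_vector_field (\<lambda>z. h (t, z)) (X t)" if "t \<in> {0..1}" for t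
    using X[OF that] h that by simp
  then show thesis using that U flow by blast
qed

lemma hamiltonian_isotopic_refl:
  assumes "L \<subseteq> ball2n b"
  shows "hamiltonian_isotopic_in_ball b L L"
proof -
  have "hamiltonian_isotopy (\<lambda>_ z. z)"
    by (rule hamiltonian_isotopy_of_flow[where h="\<lambda>_. 0" and X="\<lambda>_. 0"])
      (auto simp: hamiltonian_vector_field_def omega_def[abs_def] intro!: smooth_const smooth_id)
  then show ?thesis
    unfolding hamiltonian_isotopic_in_ball_def using assms by (force simp: id_def)
qed

lemma ball2n_mono: "b \<le> b' \<Longrightarrow> ball2n b \<subseteq> ball2n b'"
  unfolding ball2n_def by (intro subset_cball) (simp add: divide_right_mono)

lemma hamiltonian_isotopic_mono:
  fixes L :: "(complex ^ 'n) set"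
  assumes "hamiltonian_isotopic_in_ball b L L'" "b \<le> b'"
  shows "hamiltonian_isotopic_in_ball b' L L'"
proof -
  have "(ball2n b :: (complex ^ 'n) set) \<subseteq> ball2n b'" by (rule ball2n_mono[OF assms(2)])
  moreover
  obtain \<Phi> where "hamiltonian_isotopy \<Phi>" "\<Phi> 0 = id" "\<Phi> 1 ` L = L'" "\<forall>s\<in>{0..1}. \<Phi> s ` L \<subseteq> ball2n b"
    using assms(1) unfolding hamiltonian_isotopic_in_ball_def by blast
  ultimately show ?thesis
    unfolding hamiltonian_isotopic_in_ball_def by (intro exI[of _ \<Phi>]) blast
qed

text \<open>The path \<open>\<Phi> (1 - t) \<circ> inv (\<Phi> 1)\<close> is generated by \<open>- H (1 - t)\<close> and traverses the same sets backwards.\<close>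

lemma hamiltonian_isotopic_sym:
  assumes "hamiltonian_isotopic_in_ball b L L'"
  shows "hamiltonian_isotopic_in_ball b L' L"
proof -
  obtain \<Phi> where iso: "hamiltonian_isotopy \<Phi>" and \<Phi>: "\<Phi> 0 = id" "\<Phi> 1 ` L = L'"
      "\<And>s. s \<in> {0..1} \<Longrightarrow> \<Phi> s ` L \<subseteq> ball2n b"
    using assms unfolding hamiltonian_isotopic_in_ball_def by blast
  obtain U g X where U: "open U" "{0..1} \<times> UNIV \<subseteq> U" "smooth U g"
    and X: "\<And>t. t \<in> {0..1} \<Longrightarrow> hamiltonian_vector_field (\<lambda>z. g (t, z)) (X t)"
    and flow: "is_flow X \<Phi>" and diff: "\<And>s. s \<in> {0..1} \<Longrightarrow> diffeomorphism (\<Phi> s)"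
    using hamiltonian_isotopyE[OF iso] by metis
  define \<Psi> where "\<Psi> = (\<lambda>t. \<Phi> (1 - t) \<circ> inv (\<Phi> 1))"
  define r where "r = (\<lambda>x :: real \<times> (complex ^ 'a). (1 - fst x, snd x))"
  have bij: "bij (\<Phi> 1)" using diff[of 1] by (simp add: diffeomorphism_def)
  have sr: "smooth UNIV r"
    unfolding r_def
    by (intro smooth_Pair smooth_diff smooth_const smooth_fst smooth_snd smooth_id open_UNIV)
  have "hamiltonian_isotopy \<Psi>"
    unfolding hamiltonian_isotopy_def
  proof (intro exI conjI ballI)
    have "open (r -` U)"
      using sr by (intro open_vimage U) (auto simp: smooth_def dest: spec[of _ 0])
    moreover have "smooth (r -` U) (\<lambda>x. (- 1) * g (r x))"
      by (intro smooth_mult smooth_const smooth_compose[OF _ U(1) _ U(3)] smooth_mono[OF sr] \<open>open (r -` U)\<close>) auto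
    ultimately have "smooth_on ({0..1} \<times> UNIV) (\<lambda>x. (- 1) * g (r x))"
      using U(2) by (intro smooth_onI[of "r -` U"]) (force simp: r_def)+
    then show "smooth_on ({0..1} \<times> UNIV) (\<lambda>(t, z). (- 1) * g (1 - t, z))"
      by (simp add: r_def case_prod_beta')
  next
    fix t :: real assume t: "t \<in> {0..1}"
    then show "hamiltonian_vector_field ((\<lambda>t z. (- 1) * g (1 - t, z)) t) ((\<lambda>t z. (- 1) *\<^sub>R X (1 - t) z) t)"
      by (auto intro!: hamiltonian_vector_field_scale[of _ _ "-1", simplified] X)
    show "diffeomorphism (\<Psi> t)"
      unfolding \<Psi>_def using t by (intro diffeomorphism_compose diffeomorphism_inv diff) auto
  next
    show "is_flow (\<lambda>t z. (- 1) *\<^sub>R X (1 - t) z) \<Psi>"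
      unfolding is_flow_def
    proof (intro allI conjI ballI)
      fix z show "\<Psi> 0 z = z" using bij by (simp add: \<Psi>_def bij_is_surj surj_f_inv_f)
    next
      fix z s assume s: "s \<in> {0..1::real}"
      let ?w = "inv (\<Phi> 1) z"
      have im: "(\<lambda>t::real. 1 - t) ` {0..1} = {0..1}" by (auto simp: image_iff intro: bexI[of _ "1 - _"])
      have "((\<lambda>t. \<Phi> t ?w) has_vector_derivative X (1 - s) (\<Phi> (1 - s) ?w)) (at (1 - s) within (\<lambda>t. 1 - t) ` {0..1})"
        using flow s unfolding im is_flow_def by auto
      moreover have "((\<lambda>t::real. 1 - t) has_vector_derivative - 1) (at s within {0..1})"
        by (auto intro!: derivative_eq_intros)
      ultimately have "((\<lambda>t. \<Phi> t ?w) \<circ> (\<lambda>t. 1 - t) has_vector_derivative (- 1) *\<^sub>R X (1 - s) (\<Phi> (1 - s) ?w)) (at s within {0..1})"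
        by (intro vector_diff_chain_within) auto
      then show "((\<lambda>t. \<Psi> t z) has_vector_derivative (- 1) *\<^sub>R X (1 - s) (\<Psi> s z)) (at s within {0..1})"
        by (simp add: \<Psi>_def o_def)
    qed
  qed
  moreover have "\<Psi> 0 = id" using bij by (simp add: \<Psi>_def bij_is_surj surj_iff[symmetric])
  moreover have inv_L: "inv (\<Phi> 1) ` L' = L"
    using \<Phi>(2) bij by (metis bij_is_inj image_inv_f_f)
  moreover have "\<Psi> s ` L' = \<Phi> (1 - s) ` L" for s
    unfolding \<Psi>_def image_comp[symmetric] inv_L ..
  ultimately show ?thesis
    unfolding hamiltonian_isotopic_in_ball_def using \<Phi> by (intro exI[of _ \<Psi>]) auto
qed

text \<open>Two isotopies are run one after the other, each with a time change that is constant near the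
  ends of its half of the time interval: so the concatenated Hamiltonian function is smooth in
  time, and it is a combination of the two given ones at every time.\<close>

lemma hamiltonian_isotopic_trans:
  assumes "hamiltonian_isotopic_in_ball b L L'" "hamiltonian_isotopic_in_ball b L' L''"
  shows "hamiltonian_isotopic_in_ball b L L''"
proof -
  obtain \<Phi> where iso1: "hamiltonian_isotopy \<Phi>" and \<Phi>: "\<Phi> 0 = id" "\<Phi> 1 ` L = L'"
      "\<And>s. s \<in> {0..1} \<Longrightarrow> \<Phi> s ` L \<subseteq> ball2n b"
    using assms(1) unfolding hamiltonian_isotopic_in_ball_def by blast
  obtain \<Psi> where iso2: "hamiltonian_isotopy \<Psi>" and \<Psi>: "\<Psi> 0 = id" "\<Psi> 1 ` L' = L''"
      "\<And>s. s \<in> {0..1} \<Longrightarrow> \<Psi> s ` L' \<subseteq> ball2n b"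
    using assms(2) unfolding hamiltonian_isotopic_in_ball_def by blast
  obtain U g X where U: "open U" "{0..1} \<times> UNIV \<subseteq> U" "smooth U g"
    and X: "\<And>t. t \<in> {0..1} \<Longrightarrow> hamiltonian_vector_field (\<lambda>z. g (t, z)) (X t)"
    and flow1: "is_flow X \<Phi>" and diff1: "\<And>s. s \<in> {0..1} \<Longrightarrow> diffeomorphism (\<Phi> s)"
    using hamiltonian_isotopyE[OF iso1] by metis
  obtain V k Y where V: "open V" "{0..1} \<times> UNIV \<subseteq> V" "smooth V k"
    and Y: "\<And>t. t \<in> {0..1} \<Longrightarrow> hamiltonian_vector_field (\<lambda>z. k (t, z)) (Y t)"
    and flow2: "is_flow Y \<Psi>" and diff2: "\<And>s. s \<in> {0..1} \<Longrightarrow> diffeomorphism (\<Psi> s)"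
    using hamiltonian_isotopyE[OF iso2] by metis
  let ?a = "ramp 0 (1/2)" and ?b = "ramp (1/2) 1" and ?a' = "ramp' 0 (1/2)" and ?b' = "ramp' (1/2) 1"
  have reparam: "smooth UNIV (\<lambda>x :: real \<times> (complex ^ 'a). c' (fst x) * f (c (fst x), snd x))"
    if "open W" "{0..1} \<times> UNIV \<subseteq> W" "smooth W f" "smooth UNIV c" "smooth UNIV c'" "\<And>t. c t \<in> {0..1::real}"
    for W and f :: "real \<times> (complex ^ 'a) \<Rightarrow> real" and c c' :: "real \<Rightarrow> real"
  proof -
    have fst: "smooth UNIV (\<lambda>x :: real \<times> (complex ^ 'a). fst x)" and snd: "smooth UNIV (\<lambda>x :: real \<times> (complex ^ 'a). snd x)"
      by (intro smooth_fst smooth_snd smooth_id open_UNIV)+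
    have c: "smooth UNIV (\<lambda>x :: real \<times> (complex ^ 'a). c (fst x))"
      by (rule smooth_compose[OF open_UNIV open_UNIV fst that(4)]) simp
    have c': "smooth UNIV (\<lambda>x :: real \<times> (complex ^ 'a). c' (fst x))"
      by (rule smooth_compose[OF open_UNIV open_UNIV fst that(5)]) simp
    have "(c (fst x), snd x) \<in> W" for x :: "real \<times> (complex ^ 'a)"
      using that(2) that(6)[of "fst x"] by blast
    then have "smooth UNIV (\<lambda>x :: real \<times> (complex ^ 'a). f (c (fst x), snd x))"
      by (rule smooth_compose[OF open_UNIV that(1) smooth_Pair[OF open_UNIV c snd] that(3)])
    then show ?thesis
      by (rule smooth_mult[OF open_UNIV c'])
  qed
  define \<Theta> where "\<Theta> = (\<lambda>t. \<Psi> (?b t) \<circ> \<Phi> (?a t))"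
  define Z where "Z = (\<lambda>t z. ?a' t *\<^sub>R X (?a t) z + ?b' t *\<^sub>R Y (?b t) z)"
  have "hamiltonian_isotopy \<Theta>"
    unfolding hamiltonian_isotopy_def
  proof (intro exI conjI ballI)
    have "smooth UNIV (\<lambda>x. ?a' (fst x) * g (?a (fst x), snd x) + ?b' (fst x) * k (?b (fst x), snd x))"
      by (intro smooth_add reparam[OF U] reparam[OF V] smooth_ramp smooth_ramp' ramp_range open_UNIV)
    then show "smooth_on ({0..1} \<times> UNIV) (\<lambda>(t, z). ?a' t * g (?a t, z) + ?b' t * k (?b t, z))"
      by (intro smooth_onI[of UNIV]) (auto simp: case_prod_beta')
  next
    fix t :: real assume t: "t \<in> {0..1}"
    show "hamiltonian_vector_field ((\<lambda>t z. ?a' t * g (?a t, z) + ?b' t * k (?b t, z)) t) (Z t)"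
      unfolding Z_def
      by (intro hamiltonian_vector_field_add hamiltonian_vector_field_scale X Y ramp_range)
    show "diffeomorphism (\<Theta> t)"
      unfolding \<Theta>_def by (intro diffeomorphism_compose diff1 diff2 ramp_range)
  next
    have chain: "((\<lambda>t. \<phi> (c t) w) has_vector_derivative c' *\<^sub>R W (c s) (\<phi> (c s) w)) (at s within S)"
      if "is_flow W \<phi>" "(c has_real_derivative c') (at s)" "\<And>t. c t \<in> {0..1}"
      for W and \<phi> :: "real \<Rightarrow> complex ^ 'a \<Rightarrow> complex ^ 'a" and c c' s S w
    proof -
      have "((\<lambda>t. \<phi> t w) has_vector_derivative W (c s) (\<phi> (c s) w)) (at (c s) within {0..1})"
        using that(1) that(3)[of s] by (auto simp: is_flow_def)
      then have "((\<lambda>t. \<phi> t w) has_vector_derivative W (c s) (\<phi> (c s) w)) (at (c s) within c ` S)"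
        by (rule has_vector_derivative_within_subset) (use that(3) in auto)
      moreover have "(c has_vector_derivative c') (at s within S)"
        using that(2) has_field_derivative_at_within has_real_derivative_iff_has_vector_derivative by blast
      ultimately show ?thesis
        using vector_diff_chain_within[of c c' s S "\<lambda>t. \<phi> t w"] by (simp add: o_def)
    qed
    show "is_flow Z \<Theta>"
      unfolding is_flow_def
    proof (intro allI conjI ballI)
      fix z show "\<Theta> 0 z = z" by (simp add: \<Theta>_def ramp_0 \<Phi> \<Psi>)
    next
      fix z s assume s: "s \<in> {0..1::real}"
      have left: "((\<lambda>t. \<Theta> t z) has_vector_derivative Z s (\<Theta> s z)) (at s within {0..1/2})" if "s \<le> 1/2"
      proof -
        have "((\<lambda>t. \<Phi> (?a t) z) has_vector_derivative ?a' s *\<^sub>R X (?a s) (\<Phi> (?a s) z)) (at s within {0..1/2})"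
          by (intro chain flow1 ramp_has_derivative ramp_range)
        moreover have eq: "\<Theta> t z = \<Phi> (?a t) z" if "t \<le> 1/2" for t
          using that by (simp add: \<Theta>_def ramp_0 \<Psi>)
        have "?b' s = 0" using that by (intro ramp'_0) auto
        then have "Z s (\<Theta> s z) = ?a' s *\<^sub>R X (?a s) (\<Phi> (?a s) z)"
          by (simp add: Z_def eq[OF that])
        ultimately have "((\<lambda>t. \<Phi> (?a t) z) has_vector_derivative Z s (\<Theta> s z)) (at s within {0..1/2})"
          by (simp only:)
        then show ?thesis
          by (rule has_vector_derivative_transform[rotated 2]) (use that s eq in auto)
      qed
      have right: "((\<lambda>t. \<Theta> t z) has_vector_derivative Z s (\<Theta> s z)) (at s within {1/2..1})" if "s \<ge> 1/2"
      proof -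
        have "((\<lambda>t. \<Psi> (?b t) (\<Phi> 1 z)) has_vector_derivative ?b' s *\<^sub>R Y (?b s) (\<Psi> (?b s) (\<Phi> 1 z))) (at s within {1/2..1})"
          by (intro chain flow2 ramp_has_derivative ramp_range)
        moreover have eq: "\<Theta> t z = \<Psi> (?b t) (\<Phi> 1 z)" if "t \<ge> 1/2" for t
          using that by (simp add: \<Theta>_def ramp_1)
        have "?a' s = 0" using that by (intro ramp'_0) auto
        then have "Z s (\<Theta> s z) = ?b' s *\<^sub>R Y (?b s) (\<Psi> (?b s) (\<Phi> 1 z))"
          by (simp add: Z_def eq[OF that])
        ultimately have "((\<lambda>t. \<Psi> (?b t) (\<Phi> 1 z)) has_vector_derivative Z s (\<Theta> s z)) (at s within {1/2..1})"
          by (simp only:)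
        then show ?thesis
          by (rule has_vector_derivative_transform[rotated 2]) (use that s eq in auto)
      qed
      show "((\<lambda>t. \<Theta> t z) has_vector_derivative Z s (\<Theta> s z)) (at s within {0..1})"
      proof -
        \<comment> \<open>At \<open>s = 1/2\<close> both time changes are stationary, so the one-sided derivatives agree.\<close>
        consider "s < 1/2" | "s = 1/2" | "s > 1/2" by linarith
        then show ?thesis
        proof cases
          case 1
          have "at s within {0..1} = at s within {0..1/2}"
            by (rule at_within_nhd[of s "{..<1/2}"]) (use 1 in auto)
          then show ?thesis using left 1 by simp
        next
          case 2
          have Un: "{0..1::real} = {0..1/2} \<union> {1/2..1}" by auto
          have l: "((\<lambda>t. \<Theta> t z) has_vector_derivative Z s (\<Theta> s z)) (at s within {0..1/2})"
            and r: "((\<lambda>t. \<Theta> t z) has_vector_derivative Z s (\<Theta> s z)) (at s within {1/2..1})"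
            by (rule left right; simp add: 2)+
          then show ?thesis
            using l r unfolding Un has_vector_derivative_def has_derivative_within
            unfolding at_within_union by (auto intro!: filterlim_sup)
        next
          case 3
          have "at s within {0..1} = at s within {1/2..1}"
            by (rule at_within_nhd[of s "{1/2<..}"]) (use 3 in auto)
          then show ?thesis using right 3 by simp
        qed
      qed
    qed
  qed
  moreover have "\<Theta> 0 = id" "\<Theta> 1 ` L = L''"
    using \<Phi> \<Psi> by (auto simp: \<Theta>_def ramp_0 ramp_1 image_comp[symmetric])
  moreover have "\<Theta> s ` L \<subseteq> ball2n b" for s
  proof (cases "s \<le> 1/2")
    case True
    then show ?thesis using \<Phi>(3)[OF ramp_range] by (simp add: \<Theta>_def ramp_0 \<Psi>)
  next
    case False
    then show ?thesis
      using \<Psi>(3)[OF ramp_range[of "1/2" 1 s]] by (auto simp: \<Theta>_def ramp_1 simp flip: \<Phi>(2))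
  qed
  ultimately show ?thesis
    unfolding hamiltonian_isotopic_in_ball_def by (intro exI[of _ \<Theta>]) auto
qed


section \<open>Two explicit Hamiltonian flows\<close>

lemma omega_eq: "omega u v = (\<Sum>m\<in>UNIV. Im (cnj (u $ m) * v $ m))"
  by (simp add: omega_def)

lemma has_vector_derivative_vec:
  fixes f :: "real \<Rightarrow> ('b::euclidean_space) ^ 'n"
  assumes "\<And>m. ((\<lambda>t. f t $ m) has_vector_derivative d $ m) (at s)"
  shows "(f has_vector_derivative d) (at s)"
proof -
  have rep: "(\<Sum>m\<in>UNIV. axis m (y $ m)) = y" for y :: "'b ^ 'n"
    by (auto simp: vec_eq_iff axis_def sum.delta' cong: if_cong)
  have "((\<lambda>t. \<Sum>m\<in>UNIV. axis m (f t $ m)) has_vector_derivative (\<Sum>m\<in>UNIV. axis m (d $ m))) (at s)"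
    by (intro has_vector_derivative_sum bounded_linear.has_vector_derivative[OF bounded_linear_axis] assms)
  then show ?thesis by (simp add: rep)
qed

lemma has_derivative_sgn_complex:
  assumes "c \<noteq> 0"
  shows "(sgn has_derivative (\<lambda>w::complex. (w - (sgn c \<bullet> w) *\<^sub>R sgn c) /\<^sub>R norm c)) (at c)"
proof -
  have "((\<lambda>c. inverse (norm c) *\<^sub>R c) has_derivative
      (\<lambda>w. inverse (norm c) *\<^sub>R w + (- (inverse (norm c) * (sgn c \<bullet> w) * inverse (norm c))) *\<^sub>R c)) (at c)"
    using assms
    by (auto intro!: derivative_eq_intros has_derivative_norm simp: inner_commute)
  moreover have "(\<lambda>w. inverse (norm c) *\<^sub>R w + (- (inverse (norm c) * (sgn c \<bullet> w) * inverse (norm c))) *\<^sub>R c)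
      = (\<lambda>w::complex. (w - (sgn c \<bullet> w) *\<^sub>R sgn c) /\<^sub>R norm c)"
    by (simp add: fun_eq_iff sgn_div_norm scaleR_diff_right)
  moreover have "(\<lambda>c::complex. inverse (norm c) *\<^sub>R c) = sgn"
    by (simp add: fun_eq_iff sgn_div_norm)
  ultimately show ?thesis by metis
qed

lemma rotating_has_vector_derivative:
  assumes "(g has_real_derivative d) (at s)"
  shows "((\<lambda>t. cis (- t * c) * (of_real (g t) * f)) has_vector_derivative
    d * (cis (- s * c) * f) - \<i> * c * (cis (- s * c) * (of_real (g s) * f))) (at s)"
  unfolding has_vector_derivative_def
  by (auto intro!: derivative_eq_intros assms[THEN has_field_derivative_imp_has_derivative]
      simp: fun_eq_iff scaleR_conv_of_real algebra_simps)

text \<open>The flow of \<open>cutoff (moment z) * energy z\<close>. The function \<open>energy\<close> is invariant under the circle action with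
  weights \<open>1\<close> on \<open>z i\<close> and \<open>-1\<close> on \<open>z k\<close>, which is generated by \<open>moment\<close> up to a factor. So both functions are conserved, and the
  flow is the flow of \<open>energy\<close>, run with the constant speed \<open>cutoff (moment z)\<close>, followed by a rotation of \<open>z i\<close> and
  \<open>z k\<close> with the constant angular velocity \<open>speed z\<close>. Where \<open>moment z > 0\<close> one has \<open>z k \<noteq> 0\<close>, so all
  formulas are smooth; where \<open>moment z \<le> p\<close> the cut-off vanishes and the flow is the identity. Both
  descriptions hold on open sets that cover the space. The value \<open>pi / 2\<close> of the cut-off
  above \<open>q\<close> makes the time \<open>1\<close> map a quarter turn.\<close>

locale shear_flow =
  fixes i j k :: "'n::finite" and p q :: real
  assumes distinct: "i \<noteq> j" "i \<noteq> k" "j \<noteq> k" and pq: "0 < p" "p < q"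
begin

definition moment :: "complex ^ 'n \<Rightarrow> real" where
  "moment z = z $ k \<bullet> z $ k - z $ i \<bullet> z $ i"

definition energy :: "complex ^ 'n \<Rightarrow> real" where
  "energy z = Im (z $ i * cnj (z $ j) * sgn (z $ k))"

definition cutoff :: "real \<Rightarrow> real" where "cutoff x = pi / 2 * ramp p q x"
definition cutoff' :: "real \<Rightarrow> real" where "cutoff' x = pi / 2 * ramp' p q x"

definition hamiltonian :: "complex ^ 'n \<Rightarrow> real" where
  "hamiltonian z = cutoff (moment z) * energy z"

definition speed :: "complex ^ 'n \<Rightarrow> real" where
  "speed z = 2 * cutoff' (moment z) * energy z"

definition field :: "complex ^ 'n \<Rightarrow> complex ^ 'n" where
  "field z = (\<chi> m.
     if m = i then \<i> * speed z * z $ i + cutoff (moment z) * (z $ j * cnj (sgn (z $ k)))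
     else if m = j then - (cutoff (moment z) * (z $ i * sgn (z $ k)))
     else if m = k then (cutoff (moment z) * Re (z $ i * cnj (z $ j) * sgn (z $ k)) / norm (z $ k)) * sgn (z $ k)
       - \<i> * speed z * z $ k
     else 0)"

definition flow_i :: "real \<Rightarrow> complex ^ 'n \<Rightarrow> complex" where
  "flow_i t z = cis (t * speed z) *
     (cos (t * cutoff (moment z)) * z $ i + sin (t * cutoff (moment z)) * (z $ j * cnj (sgn (z $ k))))"

definition flow_j :: "real \<Rightarrow> complex ^ 'n \<Rightarrow> complex" where
  "flow_j t z = cos (t * cutoff (moment z)) * z $ j - sin (t * cutoff (moment z)) * (z $ i * sgn (z $ k))"

definition flow_k :: "real \<Rightarrow> complex ^ 'n \<Rightarrow> complex" where
  "flow_k t z = cis (- t * speed z) * (sqrt (moment z + flow_i t z \<bullet> flow_i t z) * sgn (z $ k))"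

definition flow :: "real \<Rightarrow> complex ^ 'n \<Rightarrow> complex ^ 'n" where
  "flow t z = (\<chi> m. if m = i then flow_i t z else if m = j then flow_j t z
     else if m = k then flow_k t z else z $ m)"

lemma flow_nth:
  "flow t z $ i = flow_i t z" "flow t z $ j = flow_j t z" "flow t z $ k = flow_k t z"
  "m \<notin> {i, j, k} \<Longrightarrow> flow t z $ m = z $ m"
  using distinct by (auto simp: flow_def)

lemma cutoff_has_derivative: "(cutoff has_real_derivative cutoff' x) (at x)"
  unfolding cutoff_def[abs_def] cutoff'_def
  by (auto intro!: derivative_eq_intros ramp_has_derivative)

lemma cutoff_0: "x \<le> p \<Longrightarrow> cutoff x = 0" "x \<le> p \<Longrightarrow> cutoff' x = 0"
  using pq by (auto simp: cutoff_def cutoff'_def ramp_0 ramp'_0)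

lemma cutoff_1: "q \<le> x \<Longrightarrow> cutoff x = pi / 2" "q \<le> x \<Longrightarrow> cutoff' x = 0"
  using pq by (auto simp: cutoff_def cutoff'_def ramp_1 ramp'_0)

lemma moment_pos:
  assumes "0 < moment z"
  shows "z $ k \<noteq> 0"
proof
  assume "z $ k = 0"
  then have "moment z = - (z $ i \<bullet> z $ i)" by (simp add: moment_def)
  with assms inner_ge_zero[of "z $ i"] show False by linarith
qed

lemma speed_0: "moment z \<le> p \<Longrightarrow> speed z = 0"
  by (simp add: speed_def cutoff_0)

lemma flow_below:
  assumes "moment z \<le> p"
  shows "flow t z = z"
proof -
  have i: "flow_i t z = z $ i" "flow_j t z = z $ j"
    using assms by (simp_all add: flow_i_def flow_j_def cutoff_0 speed_0)
  moreover have "sqrt (z $ k \<bullet> z $ k) * sgn (z $ k) = z $ k"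
    by (simp add: norm_eq_sqrt_inner[symmetric] sgn_eq)
  then have "flow_k t z = z $ k"
    using assms by (simp add: flow_k_def speed_0 i moment_def)
  ultimately show ?thesis by (auto simp: flow_def vec_eq_iff)
qed

lemma smooth_norm: "open U \<Longrightarrow> (\<And>x. x \<in> U \<Longrightarrow> f x \<noteq> 0) \<Longrightarrow> smooth U f \<Longrightarrow> smooth U (\<lambda>x. norm (f x :: complex))"
  unfolding norm_eq_sqrt_inner
  by (intro smooth_sqrt smooth_bilinear[OF bounded_bilinear_inner]) auto

lemma smooth_moment: "smooth UNIV moment"
  unfolding moment_def[abs_def]
  by (intro smooth_diff smooth_bilinear[OF bounded_bilinear_inner] smooth_nth smooth_id open_UNIV)

abbreviation above :: "(complex ^ 'n) set" where "above \<equiv> {z. 0 < moment z}"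
abbreviation below :: "(complex ^ 'n) set" where "below \<equiv> {z. moment z < p}"

lemma continuous_moment: "continuous_on UNIV moment"
  using smooth_moment by (auto simp: smooth_def dest: spec[of _ 0])

lemma open_above_below: "open above" "open below" "above \<union> below = UNIV"
  using pq by (auto intro!: open_Collect_less continuous_moment continuous_on_const)

lemma smooth_phase: "smooth above (\<lambda>z. sgn (z $ k))"
proof -
  have "smooth above (\<lambda>z. inverse (norm (z $ k)) *\<^sub>R (z $ k))"
    using moment_pos
    by (intro smooth_scaleR smooth_inverse smooth_norm smooth_nth smooth_id open_above_below) auto
  then show ?thesis by (simp add: sgn_div_norm)
qed

lemma smooth_energy: "smooth above energy"
  unfolding energy_def[abs_def]
  by (intro smooth_Im smooth_mult smooth_cnj smooth_nth smooth_id smooth_phase open_above_below)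

lemma smooth_cutoff: "smooth UNIV (\<lambda>z. cutoff (moment z))" "smooth UNIV (\<lambda>z. cutoff' (moment z))"
  unfolding cutoff_def cutoff'_def
  by (intro smooth_mult smooth_const open_UNIV smooth_compose[OF _ _ smooth_moment smooth_ramp]
      smooth_compose[OF _ _ smooth_moment smooth_ramp'] UNIV_I)+

lemma smooth_hamiltonian: "smooth UNIV hamiltonian"
proof -
  have "smooth above hamiltonian"
    unfolding hamiltonian_def[abs_def]
    by (intro smooth_mult smooth_energy smooth_mono[OF smooth_cutoff(1)] open_above_below subset_UNIV)
  moreover have "smooth below hamiltonian"
    by (rule smooth_cong[OF _ _ smooth_const[of _ 0]]) (auto simp: hamiltonian_def cutoff_0 open_above_below)
  ultimately show ?thesis
    using smooth_Un[OF open_above_below(1,2)] by (simp add: open_above_below(3))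
qed

lemma moment_flow_i_pos:
  assumes "0 < moment z" shows "0 < moment z + flow_i t z \<bullet> flow_i t z"
  using assms inner_ge_zero[of "flow_i t z"] by linarith

lemma smooth_flow: "smooth UNIV (flow t)"
proof -
  note o = open_above_below(1)
  note c = smooth_mono[OF smooth_cutoff(1) subset_UNIV[of above]] smooth_mono[OF smooth_cutoff(2) subset_UNIV[of above]]
  have speed: "smooth above speed"
    unfolding speed_def[abs_def] by (intro smooth_mult smooth_const smooth_energy o c)
  have cis: "smooth above (\<lambda>z. cis (s * speed z))" for s
    unfolding cis_conv_exp exp_Euler[of "of_real _", unfolded cos_of_real sin_of_real]
    by (intro smooth_add smooth_mult smooth_const smooth_of_real smooth_cos smooth_sin speed o)
  have fi: "smooth above (flow_i t)"
    unfolding flow_i_def[abs_def]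
    by (intro smooth_add smooth_mult smooth_const smooth_of_real smooth_cos smooth_sin cis smooth_cnj
        smooth_phase smooth_nth smooth_id c o)
  have fj: "smooth above (flow_j t)"
    unfolding flow_j_def[abs_def]
    by (intro smooth_diff smooth_mult smooth_const smooth_of_real smooth_cos smooth_sin
        smooth_phase smooth_nth smooth_id c o)
  have fk: "smooth above (flow_k t)"
    unfolding flow_k_def[abs_def]
    by (intro smooth_mult cis smooth_of_real smooth_sqrt smooth_add smooth_bilinear[OF bounded_bilinear_inner]
        fi smooth_mono[OF smooth_moment] smooth_phase o subset_UNIV) (auto intro: moment_flow_i_pos)
  have nth: "smooth above (\<lambda>z. flow t z $ m)" for m
    using fi fj fk distinct
    by (cases "m = i"; cases "m = j"; cases "m = k") (auto simp: flow_def intro!: smooth_nth smooth_id o)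
  have "smooth above (flow t)"
    by (intro smooth_vec o nth)
  moreover have "smooth below (flow t)"
    by (rule smooth_cong[OF _ _ smooth_id]) (auto simp: flow_below open_above_below)
  ultimately show ?thesis
    using smooth_Un[OF open_above_below(1,2)] by (simp add: open_above_below(3))
qed



lemma sum_ijk:
  assumes "\<And>m. m \<notin> {i, j, k} \<Longrightarrow> g m = 0"
  shows "(\<Sum>m\<in>UNIV. g m) = g i + g j + (g k :: real)"
proof -
  have "(\<Sum>m\<in>UNIV. g m) = (\<Sum>m\<in>{i, j, k}. g m)"
    by (rule sum.mono_neutral_right) (use assms in auto)
  then show ?thesis using distinct by simp
qed

lemma field_nth:
  "field z $ i = \<i> * speed z * z $ i + cutoff (moment z) * (z $ j * cnj (sgn (z $ k)))"
  "field z $ j = - (cutoff (moment z) * (z $ i * sgn (z $ k)))"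
  "field z $ k = (cutoff (moment z) * Re (z $ i * cnj (z $ j) * sgn (z $ k)) / norm (z $ k)) * sgn (z $ k)
       - \<i> * speed z * z $ k"
  "m \<notin> {i, j, k} \<Longrightarrow> field z $ m = 0"
  using distinct by (auto simp: field_def)

lemma field_below: "moment z \<le> p \<Longrightarrow> field z = 0"
  by (simp add: field_def vec_eq_iff cutoff_0 speed_0)

lemma moment_has_derivative:
  "(moment has_derivative (\<lambda>v. 2 * (z $ k \<bullet> v $ k) - 2 * (z $ i \<bullet> v $ i))) (at z)"
  unfolding moment_def[abs_def]
  by (auto intro!: derivative_eq_intros bounded_linear.has_derivative[OF bounded_linear_vec_nth] simp: inner_commute)

lemma energy_has_derivative:
  assumes "z $ k \<noteq> 0"
  shows "(energy has_derivative (\<lambda>v. Im (v $ i * cnj (z $ j) * sgn (z $ k) + z $ i * cnj (v $ j) * sgn (z $ k)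
    + z $ i * cnj (z $ j) * ((v $ k - (sgn (z $ k) \<bullet> v $ k) *\<^sub>R sgn (z $ k)) /\<^sub>R norm (z $ k))))) (at z)"
proof -
  have nth: "((\<lambda>z. z $ m) has_derivative (\<lambda>v. v $ m)) (at z)" for m :: 'n
    by (rule bounded_linear.has_derivative[OF bounded_linear_vec_nth has_derivative_ident])
  have "((\<lambda>z. sgn (z $ k)) has_derivative
      (\<lambda>v. (v $ k - (sgn (z $ k) \<bullet> v $ k) *\<^sub>R sgn (z $ k)) /\<^sub>R norm (z $ k))) (at z)"
    using has_derivative_compose[OF nth[of k] has_derivative_sgn_complex[OF assms]] .
  note sgn = this
  have cnj: "((\<lambda>z. cnj (z $ j)) has_derivative (\<lambda>v. cnj (v $ j))) (at z)"
    by (rule bounded_linear.has_derivative[OF bounded_linear_cnj nth])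
  show ?thesis
    unfolding energy_def[abs_def]
    by (rule has_derivative_eq_rhs[OF bounded_linear.has_derivative[OF bounded_linear_Im
          has_derivative_mult[OF has_derivative_mult[OF nth cnj] sgn]]])
      (simp add: fun_eq_iff algebra_simps)
qed

text \<open>Only the component of \<open>w\<close> orthogonal to \<open>f\<close> changes a phase \<open>f\<close>, and \<open>Im (cnj f * w)\<close> measures it. This
  identity matches the derivative of \<open>energy\<close> in direction \<open>z k\<close> with the radial part of the vector field.\<close>

lemma phase_identity:
  fixes e f w :: complex
  assumes "norm f = 1"
  shows "Im (e * (w - (f \<bullet> w) *\<^sub>R f)) = Re (e * f) * Im (cnj f * w)"
proof -
  have "cnj f * f = 1" using assms by (metis complex_norm_square mult.commute of_real_1 power_one)
  then have "e * w = (e * f) * (cnj f * w)" by (simp add: algebra_simps)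
  then have "Im (e * w) = Re (e * f) * Im (cnj f * w) + Im (e * f) * Re (cnj f * w)"
    by (metis times_complex.sel(2))
  moreover have "Re (cnj f * w) = f \<bullet> w" by (simp add: inner_complex_def)
  moreover have "Im (e * (w - (f \<bullet> w) *\<^sub>R f)) = Im (e * w) - Im (e * f) * (f \<bullet> w)"
    by (simp add: algebra_simps)
  ultimately show ?thesis by (simp only: add_diff_cancel_right')
qed

lemma hamiltonian_field: "hamiltonian_vector_field hamiltonian field"
  unfolding hamiltonian_vector_field_def
proof
  fix z
  show "(hamiltonian has_derivative omega (field z)) (at z)"
  proof (cases "moment z < p")
    case True
    have "((\<lambda>_. 0) has_derivative omega (field z)) (at z)"
      using True by (simp add: field_below omega_def[abs_def])
    then show ?thesis
      by (rule has_derivative_transform_within_open[OF _ open_above_below(2)])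
        (use True in \<open>auto simp: hamiltonian_def cutoff_0\<close>)
  next
    case False
    then have "0 < moment z" using pq by linarith
    then have nz: "z $ k \<noteq> 0" by (rule moment_pos)
    define a b c f r where "a = z $ i" and "b = z $ j" and "c = z $ k" and "f = sgn (z $ k)" and "r = norm (z $ k)"
    have f: "norm f = 1" using nz by (simp add: f_def norm_sgn)
    have r: "r > 0" using nz by (simp add: r_def)
    have c: "c = r *\<^sub>R f" by (simp add: c_def r_def f_def sgn_div_norm nz)
    have "((\<lambda>z. cutoff (moment z)) has_derivative
        (\<lambda>v. cutoff' (moment z) * (2 * (c \<bullet> v $ k) - 2 * (a \<bullet> v $ i)))) (at z)"
      using has_derivative_compose[OF moment_has_derivative cutoff_has_derivative[unfolded has_field_derivative_def]]
      by (simp add: a_def c_def)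
    from has_derivative_mult[OF this energy_has_derivative[OF nz]]
    have "(hamiltonian has_derivative (\<lambda>v. cutoff (moment z) * Im (v $ i * cnj b * f + a * cnj (v $ j) * f
          + a * cnj b * ((v $ k - (f \<bullet> v $ k) *\<^sub>R f) /\<^sub>R r))
        + cutoff' (moment z) * (2 * (c \<bullet> v $ k) - 2 * (a \<bullet> v $ i)) * energy z)) (at z)"
      by (simp add: hamiltonian_def[abs_def] a_def b_def c_def f_def r_def)
    moreover have "omega (field z) v = cutoff (moment z) * Im (v $ i * cnj b * f + a * cnj (v $ j) * f
          + a * cnj b * ((v $ k - (f \<bullet> v $ k) *\<^sub>R f) /\<^sub>R r))
        + cutoff' (moment z) * (2 * (c \<bullet> v $ k) - 2 * (a \<bullet> v $ i)) * energy z" for v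
    proof -
      have "omega (field z) v = Im (cnj (field z $ i) * v $ i) + Im (cnj (field z $ j) * v $ j)
          + Im (cnj (field z $ k) * v $ k)"
        unfolding omega_eq by (rule sum_ijk) (simp add: field_nth)
      also have "Im (cnj (field z $ i) * v $ i)
          = cutoff (moment z) * Im (v $ i * cnj b * f) - speed z * (a \<bullet> v $ i)"
        by (simp add: field_nth a_def b_def f_def inner_complex_def algebra_simps)
      also have "Im (cnj (field z $ j) * v $ j) = cutoff (moment z) * Im (a * cnj (v $ j) * f)"
        by (simp add: field_nth a_def f_def algebra_simps)
      also have "Im (cnj (field z $ k) * v $ k)
          = cutoff (moment z) * (Re (a * cnj b * f) * Im (cnj f * v $ k) / r) + speed z * (c \<bullet> v $ k)"
        by (simp add: field_nth a_def b_def c_def f_def r_def inner_complex_def field_simps)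
      also have "Re (a * cnj b * f) * Im (cnj f * v $ k) / r
          = Im (a * cnj b * ((v $ k - (f \<bullet> v $ k) *\<^sub>R f) /\<^sub>R r))"
        unfolding phase_identity[OF f, symmetric] by (simp add: divide_inverse_commute algebra_simps)
      finally show ?thesis by (simp add: speed_def algebra_simps)
    qed
    ultimately show ?thesis by presburger
  qed
qed

text \<open>In the coordinates \<open>w = z i * sgn (z k)\<close> and \<open>z j\<close> the flow is a rotation, since the phases that \<open>z i\<close> and \<open>z k\<close> acquire cancel in \<open>w\<close>; the modulus
  of \<open>z k\<close> is chosen to keep \<open>moment\<close>.\<close>

lemma flow_invariants:
  assumes "0 < moment z"
  shows "sgn (flow t z $ k) = cis (- t * speed z) * sgn (z $ k)"
    "moment (flow t z) = moment z" "energy (flow t z) = energy z" "speed (flow t z) = speed z"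
    "norm (flow t z $ k) = sqrt (moment z + flow_i t z \<bullet> flow_i t z)"
proof -
  define R where "R = sqrt (moment z + flow_i t z \<bullet> flow_i t z)"
  have R: "R > 0" "R\<^sup>2 = moment z + flow_i t z \<bullet> flow_i t z"
    using moment_flow_i_pos[OF assms, of t] by (simp_all add: R_def)
  have nf: "norm (sgn (z $ k)) = 1" using moment_pos[OF assms] by (simp add: norm_sgn)
  have k: "flow t z $ k = R *\<^sub>R (cis (- t * speed z) * sgn (z $ k))"
    by (simp add: flow_nth flow_k_def R_def scaleR_conv_of_real)
  then show n: "norm (flow t z $ k) = sqrt (moment z + flow_i t z \<bullet> flow_i t z)"
    using R nf by (simp add: norm_mult R_def)
  show s: "sgn (flow t z $ k) = cis (- t * speed z) * sgn (z $ k)"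
    using R nf unfolding k by (simp add: sgn_scaleR sgn_mult)
  show m: "moment (flow t z) = moment z"
    using R n unfolding moment_def[of "flow t z"] by (simp add: power2_norm_eq_inner[symmetric] flow_nth R_def)
  show e: "energy (flow t z) = energy z"
  proof -
    define C S f w b where "C = cos (t * cutoff (moment z))" and "S = sin (t * cutoff (moment z))"
      and "f = sgn (z $ k)" and "w = z $ i * sgn (z $ k)" and "b = z $ j"
    have CS: "C\<^sup>2 + S\<^sup>2 = 1" by (simp add: C_def S_def)
    have ff: "cnj f * f = 1" using nf by (metis complex_norm_square mult.commute of_real_1 power_one f_def)
    have "flow_i t z * cnj (flow_j t z) * (cis (- t * speed z) * f)
        = (cis (t * speed z) * cis (- t * speed z)) * (C * w + S * b * (cnj f * f)) * cnj (C * b - S * w)"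
      unfolding flow_i_def flow_j_def by (simp add: C_def S_def f_def w_def b_def algebra_simps)
    then have "flow_i t z * cnj (flow_j t z) * (cis (- t * speed z) * f) = (C * w + S * b) * cnj (C * b - S * w)"
      by (simp add: ff cis_mult)
    then have "energy (flow t z) = Im ((C * w + S * b) * cnj (C * b - S * w))"
      unfolding energy_def s by (simp add: flow_nth f_def)
    also have "\<dots> = (C\<^sup>2 + S\<^sup>2) * Im (w * cnj b)"
      by (simp add: algebra_simps power2_eq_square)
    finally show ?thesis
      using CS by (simp add: energy_def w_def b_def algebra_simps)
  qed
  show "speed (flow t z) = speed z" by (simp add: speed_def m e)
qed

lemma flow_0: "flow 0 z = z"
proof (cases "0 < moment z")
  case True
  have "sqrt (z $ k \<bullet> z $ k) * sgn (z $ k) = z $ k"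
    by (simp add: norm_eq_sqrt_inner[symmetric] sgn_eq)
  then show ?thesis
    by (simp add: flow_def flow_i_def flow_j_def flow_k_def moment_def vec_eq_iff)
next
  case False
  then show ?thesis using pq by (simp add: flow_below)
qed

lemma flow_inverse: "flow (- t) (flow t z) = z"
proof (cases "0 < moment z")
  case True
  note inv = flow_invariants[OF True, of t]
  define C S f s a b where "C = complex_of_real (cos (t * cutoff (moment z)))"
    and "S = complex_of_real (sin (t * cutoff (moment z)))"
    and "f = sgn (z $ k)" and "s = cis (t * speed z)" and "a = z $ i" and "b = z $ j"
  have ff: "f * cnj f = 1" using moment_pos[OF True] by (simp add: f_def norm_sgn complex_norm_square[symmetric])
  have ss: "s * cnj s = 1" by (simp add: s_def complex_norm_square[symmetric])
  have CS: "C * C + S * S = 1"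
  proof -
    have "C * C + S * S = complex_of_real ((cos (t * cutoff (moment z)))\<^sup>2 + (sin (t * cutoff (moment z)))\<^sup>2)"
      by (simp only: C_def S_def of_real_mult of_real_add power2_eq_square)
    then show ?thesis by simp
  qed
  have cis: "cis (- t * speed z) = cnj s" "cis (t * speed z) = s" by (simp_all add: s_def cis_cnj)
  have i: "flow_i (- t) (flow t z) = a"
  proof -
    have "flow_i (- t) (flow t z)
        = cnj s * (C * (s * (C * a + S * (b * cnj f))) - S * ((C * b - S * (a * f)) * cnj (cnj s * f)))"
      unfolding flow_i_def[of "- t"] inv by (simp add: flow_nth flow_i_def flow_j_def cis flip: C_def S_def f_def a_def b_def s_def)
        (simp add: s_def cis_cnj)
    also have "\<dots> = (s * cnj s) * (C * C * a + S * S * a * (f * cnj f))"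
      by (simp add: algebra_simps)
    also have "\<dots> = (C * C + S * S) * a" by (simp only: ss ff) (simp add: algebra_simps)
    finally show ?thesis by (simp add: CS)
  qed
  have j: "flow_j (- t) (flow t z) = b"
  proof -
    have "flow_j (- t) (flow t z)
        = C * (C * b - S * (a * f)) + S * (s * (C * a + S * (b * cnj f)) * (cnj s * f))"
      unfolding flow_j_def[of "- t"] inv by (simp add: flow_nth flow_i_def flow_j_def cis flip: C_def S_def f_def a_def b_def s_def)
        (simp add: s_def cis_cnj)
    also have "\<dots> = C * (C * b - S * (a * f)) + S * ((s * cnj s) * (C * a * f + S * b * (f * cnj f)))"
      by (simp add: algebra_simps)
    also have "\<dots> = (C * C + S * S) * b" by (simp only: ss ff) (simp add: algebra_simps)
    finally show ?thesis by (simp add: CS)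
  qed
  have k: "flow_k (- t) (flow t z) = z $ k"
  proof -
    have "flow_k (- t) (flow t z) = (s * cnj s) * (sqrt (moment z + a \<bullet> a) * f)"
      unfolding flow_k_def[of "- t"] inv i by (simp add: s_def f_def cis_cnj mult_ac)
    also have "\<dots> = z $ k"
      unfolding ss by (simp add: moment_def a_def f_def norm_eq_sqrt_inner[symmetric] sgn_eq)
    finally show ?thesis .
  qed
  have o: "flow t z $ m = z $ m" if "m \<notin> {i, j, k}" for m using that by (simp add: flow_nth)
  show ?thesis
    by (simp add: flow_def[of "- t"] vec_eq_iff i j k a_def b_def o)
next
  case False
  then show ?thesis using pq by (simp add: flow_below)
qed

lemma flow_has_vector_derivative: "((\<lambda>t. flow t z) has_vector_derivative field (flow s z)) (at s)"
proof (cases "0 < moment z")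
  case True
  note inv = flow_invariants[OF True, of s]
  define ph where "ph = cis (- s * speed z) * sgn (z $ k)"
  have cnj_ph: "cnj ph = cis (s * speed z) * cnj (sgn (z $ k))" by (simp add: ph_def cis_cnj)
  have ff: "sgn (z $ k) * cnj (sgn (z $ k)) = 1"
    using moment_pos[OF True] by (simp add: norm_sgn complex_norm_square[symmetric])
  have cc: "cis x * (cis (- x) * y) = y" for x y by (simp add: cis_mult flip: mult.assoc)
  have ff': "sgn (z $ k) * (cnj (sgn (z $ k)) * y) = y" for y by (simp add: ff flip: mult.assoc)
  have di: "((\<lambda>t. flow_i t z) has_vector_derivative
      \<i> * speed z * flow_i s z + cutoff (moment z) * (flow_j s z * cnj ph)) (at s)"
    unfolding flow_i_def flow_j_def cnj_ph has_vector_derivative_def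
    by (auto intro!: derivative_eq_intros simp: fun_eq_iff scaleR_conv_of_real algebra_simps ff)
  have dj: "((\<lambda>t. flow_j t z) has_vector_derivative - (cutoff (moment z) * (flow_i s z * ph))) (at s)"
    unfolding flow_i_def flow_j_def ph_def has_vector_derivative_def
    by (auto intro!: derivative_eq_intros simp: fun_eq_iff scaleR_conv_of_real algebra_simps ff' cc)
  define R where "R = sqrt (moment z + flow_i s z \<bullet> flow_i s z)"
  have R: "R > 0" using moment_flow_i_pos[OF True, of s] by (simp add: R_def)
  have dot: "flow_i s z \<bullet> (\<i> * speed z * flow_i s z + cutoff (moment z) * (flow_j s z * cnj ph))
      = cutoff (moment z) * Re (flow_i s z * cnj (flow_j s z) * ph)"
    by (simp add: inner_complex_def algebra_simps)
  have dR: "((\<lambda>t. sqrt (moment z + flow_i t z \<bullet> flow_i t z)) has_real_derivative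
      cutoff (moment z) * Re (flow_i s z * cnj (flow_j s z) * ph) / R) (at s)"
  proof -
    have "((\<lambda>t. moment z + flow_i t z \<bullet> flow_i t z) has_real_derivative
        2 * (cutoff (moment z) * Re (flow_i s z * cnj (flow_j s z) * ph))) (at s)"
      unfolding has_field_derivative_def
      by (auto intro!: derivative_eq_intros di[unfolded has_vector_derivative_def]
          simp: fun_eq_iff inner_commute[of _ "flow_i s z"] dot)
    from DERIV_chain2[OF DERIV_real_sqrt[OF moment_flow_i_pos[OF True]] this] show ?thesis
      by (rule DERIV_cong) (simp only: R_def divide_inverse inverse_mult_distrib, algebra)
  qed
  have dk: "((\<lambda>t. flow_k t z) has_vector_derivative
      (cutoff (moment z) * Re (flow_i s z * cnj (flow_j s z) * ph) / R) * ph - \<i> * speed z * flow_k s z) (at s)"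
    unfolding flow_k_def using rotating_has_vector_derivative[OF dR, of "speed z" "sgn (z $ k)"]
    by (simp add: ph_def R_def algebra_simps)
  have ph: "sgn (flow s z $ k) = ph" by (simp add: inv ph_def)
  have nk: "norm (flow s z $ k) = R" by (simp only: inv R_def)
  show ?thesis
  proof (rule has_vector_derivative_vec)
    fix m
    consider "m = i" | "m = j" | "m = k" | "m \<notin> {i, j, k}" by blast
    then show "((\<lambda>t. flow t z $ m) has_vector_derivative field (flow s z) $ m) (at s)"
    proof cases
      case 1
      then show ?thesis using di by (simp add: field_nth ph inv(2,4)) (simp add: flow_nth)
    next
      case 2
      then show ?thesis using dj by (simp add: field_nth ph inv(2,4)) (simp add: flow_nth)
    next
      case 3
      then show ?thesis using dk by (simp add: field_nth ph nk inv(2,4)) (simp add: flow_nth)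
    next
      case 4
      then show ?thesis by (simp add: field_nth flow_nth)
    qed
  qed
next
  case False
  then show ?thesis using pq by (simp add: flow_below field_below)
qed

lemma hamiltonian_isotopy_shear: "hamiltonian_isotopy flow"
  by (rule hamiltonian_isotopy_of_flow[OF smooth_hamiltonian hamiltonian_field flow_0
        flow_has_vector_derivative flow_inverse smooth_flow])

end


section \<open>Isotopies of product tori\<close>

abbreviation (input) isotopic_tori :: "real \<Rightarrow> real ^ 'n \<Rightarrow> real ^ 'n \<Rightarrow> bool" where
  "isotopic_tori b a a' \<equiv> hamiltonian_isotopic_in_ball b (product_torus a) (product_torus a')"

lemma product_torus_iff:
  assumes "\<And>m. 0 < a $ m"
  shows "z \<in> product_torus a \<longleftrightarrow> (\<forall>m. z $ m \<bullet> z $ m = a $ m / pi)"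
proof -
  have "w \<in> circle_of_area (a $ m) \<longleftrightarrow> w \<bullet> w = a $ m / pi" for w m
  proof -
    have "w \<in> circle_of_area (a $ m) \<longleftrightarrow> sqrt (w \<bullet> w) = sqrt (a $ m / pi)"
      by (simp add: circle_of_area_def norm_eq_sqrt_inner)
    then show ?thesis by simp
  qed
  then show ?thesis by (simp add: product_torus_def)
qed

lemma ball2n_iff: "z \<in> ball2n b \<longleftrightarrow> (\<Sum>m\<in>UNIV. z $ m \<bullet> z $ m) \<le> b / pi"
  unfolding ball2n_def mem_cball dist_0_norm norm_eq_sqrt_inner by (simp add: inner_vec_def)

lemma product_torus_sum:
  assumes "\<And>m. 0 < a $ m" "z \<in> product_torus a"
  shows "(\<Sum>m\<in>UNIV. z $ m \<bullet> z $ m) = total_area a / pi"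
  using assms by (simp add: product_torus_iff total_area_def sum_divide_distrib)

lemma product_torus_subset_ball:
  assumes "\<And>m. 0 < a $ m" "total_area a \<le> b"
  shows "product_torus a \<subseteq> ball2n b"
  using product_torus_sum[OF assms(1)] assms(2) by (auto simp: ball2n_iff divide_right_mono)

lemma rotation_norm:
  fixes a b :: complex
  assumes "C\<^sup>2 + S\<^sup>2 = 1"
  shows "(of_real C * a + of_real S * b) \<bullet> (of_real C * a + of_real S * b) + (of_real C * b - of_real S * a) \<bullet> (of_real C * b - of_real S * a)
    = a \<bullet> a + b \<bullet> b"
proof -
  have "(of_real C * a + of_real S * b) \<bullet> (of_real C * a + of_real S * b) + (of_real C * b - of_real S * a) \<bullet> (of_real C * b - of_real S * a)
    = (C\<^sup>2 + S\<^sup>2) * (a \<bullet> a + b \<bullet> b)"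
    by (simp add: inner_complex_def power2_eq_square algebra_simps)
  then show ?thesis using assms by simp
qed

lemma inner_mult_unit:
  fixes u w :: complex
  assumes "norm u = 1"
  shows "(u * w) \<bullet> (u * w) = w \<bullet> w" "(w * u) \<bullet> (w * u) = w \<bullet> w"
  using assms by (simp_all add: norm_mult flip: power2_norm_eq_inner)

lemma image_eqI_right_inverse:
  assumes "\<And>z. z \<in> A \<Longrightarrow> f z \<in> B" "\<And>z. z \<in> B \<Longrightarrow> g z \<in> A" "\<And>z. f (g z) = z"
  shows "f ` A = B"
proof
  show "B \<subseteq> f ` A" using assms(2,3) by (metis image_eqI subsetI)
qed (use assms(1) in blast)

context shear_flow
begin

lemma flow_norm_ij:
  assumes "0 < moment z"
  shows "flow_i t z \<bullet> flow_i t z + flow_j t z \<bullet> flow_j t z = z $ i \<bullet> z $ i + z $ j \<bullet> z $ j"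
proof -
  define f where "f = sgn (z $ k)"
  have f: "norm f = 1" "cnj f * f = 1"
    using moment_pos[OF assms] by (auto simp: f_def norm_sgn complex_norm_square[symmetric] mult.commute)
  let ?C = "cos (t * cutoff (moment z))" and ?S = "sin (t * cutoff (moment z))"
  have "flow_i t z \<bullet> flow_i t z = (?C * z $ i + ?S * (z $ j * cnj f)) \<bullet> (?C * z $ i + ?S * (z $ j * cnj f))"
    unfolding flow_i_def f_def[symmetric] by (rule inner_mult_unit) simp
  also have "\<dots> = ((?C * z $ i + ?S * (z $ j * cnj f)) * f) \<bullet> ((?C * z $ i + ?S * (z $ j * cnj f)) * f)"
    by (rule inner_mult_unit(2)[OF f(1), symmetric])
  also have "(?C * z $ i + ?S * (z $ j * cnj f)) * f = ?C * (z $ i * f) + ?S * z $ j"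
    using f(2) by (simp add: distrib_right mult.assoc)
  finally show ?thesis
    using rotation_norm[of ?C ?S "z $ i * f" "z $ j"] inner_mult_unit(2)[OF f(1), of "z $ i"]
    by (simp add: flow_j_def f_def[symmetric])
qed

lemma flow_norm_k:
  assumes "0 < moment z"
  shows "flow_k t z \<bullet> flow_k t z = moment z + flow_i t z \<bullet> flow_i t z"
  using flow_invariants(5)[OF assms, of t] moment_flow_i_pos[OF assms, of t]
  by (simp add: flow_nth flip: power2_norm_eq_inner)

text \<open>The sum of \<open>|z i|^2\<close> and \<open>|z j|^2\<close> is conserved, and \<open>|z k|^2\<close> grows as much as \<open>|z i|^2\<close> does, hence by at most
  \<open>|z j|^2\<close>.\<close>

lemma flow_norm_bound:
  assumes "0 < moment z"
  shows "(\<Sum>m\<in>UNIV. flow t z $ m \<bullet> flow t z $ m) \<le> (\<Sum>m\<in>UNIV. z $ m \<bullet> z $ m) + z $ j \<bullet> z $ j"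
proof -
  have "(\<Sum>m\<in>UNIV. flow t z $ m \<bullet> flow t z $ m) - (\<Sum>m\<in>UNIV. z $ m \<bullet> z $ m)
      = (\<Sum>m\<in>UNIV. flow t z $ m \<bullet> flow t z $ m - z $ m \<bullet> z $ m)"
    by (simp add: sum_subtractf)
  also have "\<dots> = (flow_i t z \<bullet> flow_i t z - z $ i \<bullet> z $ i) + (flow_j t z \<bullet> flow_j t z - z $ j \<bullet> z $ j)
      + (flow_k t z \<bullet> flow_k t z - z $ k \<bullet> z $ k)"
    by (subst sum_ijk) (auto simp: flow_nth)
  also have "\<dots> \<le> z $ j \<bullet> z $ j"
    using flow_norm_ij[OF assms, of t] flow_norm_k[OF assms, of t] inner_ge_zero[of "flow_j t z"]
    unfolding moment_def by linarith
  finally show ?thesis by linarith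
qed

lemma flow_quarter_turn:
  assumes "q \<le> moment z" "t = 1 \<or> t = - 1"
  shows "flow_i t z \<bullet> flow_i t z = z $ j \<bullet> z $ j" "flow_j t z \<bullet> flow_j t z = z $ i \<bullet> z $ i"
    "flow_k t z \<bullet> flow_k t z = moment z + z $ j \<bullet> z $ j"
proof -
  have pos: "0 < moment z" using assms pq by linarith
  have c: "cos (t * cutoff (moment z)) = 0" using assms by (auto simp: cutoff_1)
  have s: "(sin (t * cutoff (moment z)))\<^sup>2 = 1" using assms by (auto simp: cutoff_1)
  have f: "norm (sgn (z $ k)) = 1" using moment_pos[OF pos] by (simp add: norm_sgn)
  show "flow_j t z \<bullet> flow_j t z = z $ i \<bullet> z $ i"
    using s f unfolding flow_j_def c
    by (simp add: norm_mult power_mult_distrib flip: power2_norm_eq_inner)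
  with flow_norm_ij[OF pos, of t] show "flow_i t z \<bullet> flow_i t z = z $ j \<bullet> z $ j"
    by linarith
  then show "flow_k t z \<bullet> flow_k t z = moment z + z $ j \<bullet> z $ j"
    by (simp add: flow_norm_k[OF pos])
qed

end

text \<open>On both tori \<open>moment\<close> has the constant value \<open>(a k - a i) / pi\<close>, which is taken as the upper end \<open>q\<close> of the
  transition of the cut-off: there the angular velocity vanishes and a full quarter turn takes place.\<close>

lemma shear_tori:
  fixes a :: "real ^ 'n"
  assumes distinct: "i \<noteq> j" "i \<noteq> k" "j \<noteq> k" and pos: "\<And>m. 0 < a $ m" and "a $ i < a $ k"
  defines "a' \<equiv> (\<chi> m. if m = i then a $ j else if m = j then a $ i
    else if m = k then a $ k - a $ i + a $ j else a $ m)"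
  shows "isotopic_tori (total_area a + a $ j) a a'"
proof -
  define q where "q = (a $ k - a $ i) / pi"
  have q: "0 < q" using assms(5) by (simp add: q_def)
  interpret shear_flow i j k "q / 2" q
    by unfold_locales (use distinct q in auto)
  have pos': "0 < a' $ m" for m
    using pos[of m] pos[of i] pos[of j] assms(5) by (auto simp: a'_def)
  have moment: "moment z = q" if "z \<in> product_torus a \<or> z \<in> product_torus a'" for z
    using that distinct pos pos' by (auto simp: moment_def product_torus_iff q_def a'_def diff_divide_distrib add_divide_distrib)
  have norm: "flow t z $ m \<bullet> flow t z $ m = (if m = i then z $ j \<bullet> z $ j else if m = j then z $ i \<bullet> z $ i
      else if m = k then q + z $ j \<bullet> z $ j else z $ m \<bullet> z $ m)" if "moment z = q" "t = 1 \<or> t = - 1" for t z m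
    using flow_quarter_turn[of z t] that by (simp add: flow_def)
  have "flow 1 z \<in> product_torus a'" if "z \<in> product_torus a" for z
    using that norm[OF moment] distinct pos pos' by (simp add: product_torus_iff q_def a'_def diff_divide_distrib add_divide_distrib)
  moreover have "flow (- 1) z \<in> product_torus a" if "z \<in> product_torus a'" for z
    using that norm[OF moment] distinct pos pos' by (simp add: product_torus_iff q_def a'_def diff_divide_distrib add_divide_distrib)
  moreover have "flow 1 (flow (- 1) z) = z" for z using flow_inverse[of "- 1"] by simp
  ultimately have "flow 1 ` product_torus a = product_torus a'"
    by (rule image_eqI_right_inverse)
  moreover have "flow t ` product_torus a \<subseteq> ball2n (total_area a + a $ j)" for t
  proof
    fix w assume "w \<in> flow t ` product_torus a"
    then obtain z where z: "z \<in> product_torus a" "w = flow t z" by blast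
    then have "0 < moment z" using moment[of z] q by simp
    from flow_norm_bound[OF this, of t] show "w \<in> ball2n (total_area a + a $ j)"
      unfolding ball2n_iff z(2) using product_torus_sum[OF pos z(1)] z(1)
      by (simp add: product_torus_iff[OF pos] add_divide_distrib)
  qed
  moreover have "flow 0 = id" by (simp add: fun_eq_iff flow_0)
  ultimately show ?thesis
    unfolding hamiltonian_isotopic_in_ball_def using hamiltonian_isotopy_shear by blast
qed

text \<open>The unitary rotation of two coordinates, with the quarter turn at time \<open>1\<close>.\<close>

locale swap_flow =
  fixes i j :: "'n::finite"
  assumes distinct: "i \<noteq> j"
begin

definition hamiltonian :: "complex ^ 'n \<Rightarrow> real" where
  "hamiltonian z = pi / 2 * Im (z $ i * cnj (z $ j))"

definition field :: "complex ^ 'n \<Rightarrow> complex ^ 'n" where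
  "field z = (\<chi> m. if m = i then (pi / 2) * z $ j else if m = j then - ((pi / 2) * z $ i) else 0)"

definition flow :: "real \<Rightarrow> complex ^ 'n \<Rightarrow> complex ^ 'n" where
  "flow t z = (\<chi> m. if m = i then cos (t * (pi / 2)) * z $ i + sin (t * (pi / 2)) * z $ j
     else if m = j then cos (t * (pi / 2)) * z $ j - sin (t * (pi / 2)) * z $ i else z $ m)"

lemma sum_ij:
  assumes "\<And>m. m \<notin> {i, j} \<Longrightarrow> g m = 0"
  shows "(\<Sum>m\<in>UNIV. g m) = g i + (g j :: real)"
proof -
  have "(\<Sum>m\<in>UNIV. g m) = (\<Sum>m\<in>{i, j}. g m)"
    by (rule sum.mono_neutral_right) (use assms in auto)
  then show ?thesis using distinct by simp
qed

lemma hamiltonian_field: "hamiltonian_vector_field hamiltonian field"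
  unfolding hamiltonian_vector_field_def
proof
  fix z :: "complex ^ 'n"
  have nth: "((\<lambda>z. z $ m) has_derivative (\<lambda>v. v $ m)) (at z)" for m :: 'n
    by (rule bounded_linear.has_derivative[OF bounded_linear_vec_nth has_derivative_ident])
  have cnj: "((\<lambda>z. cnj (z $ j)) has_derivative (\<lambda>v. cnj (v $ j))) (at z)"
    by (rule bounded_linear.has_derivative[OF bounded_linear_cnj nth])
  have "omega (field z) v = pi / 2 * Im (z $ i * cnj (v $ j) + v $ i * cnj (z $ j))" for v
    unfolding omega_eq using distinct by (subst sum_ij) (auto simp: field_def field_simps)
  then have om: "omega (field z) = (\<lambda>v. pi / 2 * Im (z $ i * cnj (v $ j) + v $ i * cnj (z $ j)))"
    by (rule ext)
  show "(hamiltonian has_derivative omega (field z)) (at z)"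
    unfolding hamiltonian_def[abs_def] om
    by (rule has_derivative_mult_right[OF bounded_linear.has_derivative[OF bounded_linear_Im
            has_derivative_mult[OF nth cnj]]])
qed

lemma hamiltonian_isotopy_swap: "hamiltonian_isotopy flow"
proof (rule hamiltonian_isotopy_of_flow[OF _ hamiltonian_field])
  show "smooth UNIV hamiltonian"
    unfolding hamiltonian_def[abs_def]
    by (intro smooth_mult smooth_const smooth_Im smooth_cnj smooth_nth smooth_id open_UNIV)
  show "flow 0 z = z" for z by (simp add: flow_def vec_eq_iff)
  show "flow (- t) (flow t z) = z" for t z
  proof -
    let ?C = "complex_of_real (cos (pi * t / 2))" and ?S = "complex_of_real (sin (pi * t / 2))"
    have "?C * ?C + ?S * ?S = complex_of_real ((cos (pi * t / 2))\<^sup>2 + (sin (pi * t / 2))\<^sup>2)"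
      by (simp only: of_real_mult of_real_add power2_eq_square)
    then have "?C * ?C + ?S * ?S = 1" by simp
    then have "w * (?C * ?C) + w * (?S * ?S) = w" for w
      by (simp flip: distrib_left)
    then show ?thesis
      using distinct by (simp add: flow_def vec_eq_iff algebra_simps)
  qed
  show "smooth UNIV (flow t)" for t
  proof (rule smooth_vec[OF open_UNIV])
    fix m
    show "smooth UNIV (\<lambda>z. flow t z $ m)"
      using distinct by (cases "m = i"; cases "m = j")
        (auto simp: flow_def intro!: smooth_add smooth_diff smooth_mult smooth_const smooth_nth smooth_id)
  qed
  show "((\<lambda>t. flow t z) has_vector_derivative field (flow s z)) (at s)" for s z
  proof (rule has_vector_derivative_vec)
    fix m
    show "((\<lambda>t. flow t z $ m) has_vector_derivative field (flow s z) $ m) (at s)"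
      using distinct unfolding has_vector_derivative_def
      by (cases "m = i"; cases "m = j")
        (auto simp: flow_def field_def fun_eq_iff scaleR_conv_of_real algebra_simps intro!: derivative_eq_intros)
  qed
qed

lemma flow_norm: "(\<Sum>m\<in>UNIV. flow t z $ m \<bullet> flow t z $ m) = (\<Sum>m\<in>UNIV. z $ m \<bullet> z $ m)"
proof -
  have "(\<Sum>m\<in>UNIV. flow t z $ m \<bullet> flow t z $ m) - (\<Sum>m\<in>UNIV. z $ m \<bullet> z $ m)
      = (\<Sum>m\<in>UNIV. flow t z $ m \<bullet> flow t z $ m - z $ m \<bullet> z $ m)"
    by (simp add: sum_subtractf)
  also have "\<dots> = (flow t z $ i \<bullet> flow t z $ i - z $ i \<bullet> z $ i) + (flow t z $ j \<bullet> flow t z $ j - z $ j \<bullet> z $ j)"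
    by (rule sum_ij) (auto simp: flow_def)
  also have "\<dots> = 0"
    using rotation_norm[of "cos (t * (pi / 2))" "sin (t * (pi / 2))" "z $ i" "z $ j"] distinct
    by (simp add: flow_def)
  finally show ?thesis by simp
qed

end

lemma swap_tori:
  fixes a :: "real ^ 'n"
  assumes "i \<noteq> j" and pos: "\<And>m. 0 < a $ m"
  shows "isotopic_tori (total_area a) a (\<chi> m. a $ Transposition.transpose i j m)"
proof -
  interpret swap_flow i j by unfold_locales (rule assms(1))
  define a' where "a' = (\<chi> m. a $ Transposition.transpose i j m)"
  have pos': "0 < a' $ m" for m using pos by (simp add: a'_def)
  have norm: "flow t z $ m \<bullet> flow t z $ m = z $ Transposition.transpose i j m \<bullet> z $ Transposition.transpose i j m"
    if "t = 1 \<or> t = - 1" for t z m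
    using that distinct by (auto simp: flow_def Transposition.transpose_def)
  have "flow 1 z \<in> product_torus a'" if "z \<in> product_torus a" for z
    using that norm[of 1] pos pos' by (simp add: product_torus_iff a'_def)
  moreover have "flow (- 1) z \<in> product_torus a" if "z \<in> product_torus a'" for z
    using that norm[of "- 1"] pos pos' by (simp add: product_torus_iff a'_def)
  moreover have "flow 1 (flow (- 1) z) = z" for z
    using distinct by (simp add: flow_def vec_eq_iff)
  ultimately have "flow 1 ` product_torus a = product_torus a'"
    by (rule image_eqI_right_inverse)
  moreover have "flow t ` product_torus a \<subseteq> ball2n (total_area a)" for t
    using product_torus_sum[OF pos] by (auto simp: ball2n_iff flow_norm)
  moreover have "flow 0 = id" by (simp add: fun_eq_iff flow_def vec_eq_iff)
  ultimately show ?thesis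
    unfolding hamiltonian_isotopic_in_ball_def a'_def using hamiltonian_isotopy_swap by blast
qed

lemma permuted_tori:
  fixes a :: "real ^ 'n"
  assumes "p permutes UNIV" "\<And>m. 0 < a $ m"
  shows "isotopic_tori (total_area a) a (\<chi> m. a $ p m)"
  using finite[of "UNIV :: 'n set"] assms(1)
proof (induction p rule: permutes_rev_induct)
  case id
  then show ?case
    by (simp add: hamiltonian_isotopic_refl product_torus_subset_ball assms(2))
next
  case (swap b c p)
  have t: "total_area (\<chi> m. a $ p m) = total_area a"
    using sum.permute[OF \<open>p permutes UNIV\<close>, of "($) a"] by (simp add: total_area_def o_def)
  show ?case
  proof (cases "b = c")
    case True
    with swap show ?thesis by simp
  next
    case False
    have "isotopic_tori (total_area (\<chi> m. a $ p m)) (\<chi> m. a $ p m) (\<chi> m. (\<chi> m. a $ p m) $ Transposition.transpose b c m)"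
      by (rule swap_tori[OF False]) (simp add: assms(2))
    then show ?thesis
      using swap.IH unfolding t
      by (simp add: o_def) (metis hamiltonian_isotopic_trans)
  qed
qed


section \<open>Integer combinations of a finite family of reals\<close>

definition zspan :: "('i \<Rightarrow> real) \<Rightarrow> 'i set \<Rightarrow> real set" where
  "zspan d A = {(\<Sum>i\<in>A. of_int (c i) * d i) | c :: 'i \<Rightarrow> int. True}"

lemma zspanI: "(\<Sum>i\<in>A. of_int (c i) * d i) \<in> zspan d A"
  unfolding zspan_def by blast

lemma zspan_base:
  assumes "finite A" "i \<in> A"
  shows "d i \<in> zspan d A"
proof -
  have "(\<Sum>j\<in>A. of_int (if j = i then 1 else 0) * d j) = d i"
    using assms by (simp add: if_distrib[of "\<lambda>c. of_int c * _"] sum.delta' cong: if_cong)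
  then show ?thesis using zspanI[where A=A and d=d and c="\<lambda>j. if j = i then 1 else 0"] by simp
qed

lemma zspan_add: "x \<in> zspan d A \<Longrightarrow> y \<in> zspan d A \<Longrightarrow> x + y \<in> zspan d A"
proof -
  assume "x \<in> zspan d A" "y \<in> zspan d A"
  then obtain a b where "x = (\<Sum>i\<in>A. of_int (a i) * d i)" "y = (\<Sum>i\<in>A. of_int (b i) * d i)"
    unfolding zspan_def by blast
  then have "x + y = (\<Sum>i\<in>A. of_int (a i + b i) * d i)"
    by (simp add: sum.distrib distrib_right)
  then show ?thesis using zspanI by metis
qed

lemma zspan_mult: "x \<in> zspan d A \<Longrightarrow> of_int n * x \<in> zspan d A"
proof -
  assume "x \<in> zspan d A"
  then obtain a where "x = (\<Sum>i\<in>A. of_int (a i) * d i)"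
    unfolding zspan_def by blast
  then have "of_int n * x = (\<Sum>i\<in>A. of_int (n * a i) * d i)"
    by (simp add: sum_distrib_left mult.assoc)
  then show ?thesis using zspanI by metis
qed

lemma zspan_minus: "x \<in> zspan d A \<Longrightarrow> - x \<in> zspan d A"
  using zspan_mult[of x d A "- 1"] by simp

lemma zspan_diff: "x \<in> zspan d A \<Longrightarrow> y \<in> zspan d A \<Longrightarrow> x - y \<in> zspan d A"
  using zspan_add[of x d A "- y"] zspan_minus[of y d A] by simp

lemma zspan_0: "0 \<in> zspan d A"
  using zspanI[where c="\<lambda>_. 0" and d=d and A=A] by simp

lemma zspan_sum: "finite B \<Longrightarrow> (\<And>b. b \<in> B \<Longrightarrow> f b \<in> zspan d A) \<Longrightarrow> (\<Sum>b\<in>B. f b) \<in> zspan d A"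
  by (induction B rule: finite_induct) (auto intro: zspan_0 zspan_add)

lemma zspan_least:
  assumes "finite A" "\<And>i. i \<in> A \<Longrightarrow> d i \<in> zspan e B"
  shows "zspan d A \<subseteq> zspan e B"
  using assms unfolding zspan_def[of d A] by (auto intro!: zspan_sum zspan_mult)

lemma zspan_upd:
  assumes "finite A" "k \<in> A" "x \<in> zspan d (A - {k})"
  shows "zspan (d(k := d k + x)) A = zspan d A"
proof -
  let ?d = "d(k := d k + x)"
  have sub: "zspan f (A - {k}) \<subseteq> zspan f A" for f :: "'a \<Rightarrow> real"
    using assms(1) by (intro zspan_least) (auto intro: zspan_base)
  have "zspan ?d (A - {k}) = zspan d (A - {k})" by (simp add: zspan_def)
  then have x: "x \<in> zspan d A" "x \<in> zspan ?d A" using sub[of d] sub[of ?d] assms(3) by auto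
  have base: "d i \<in> zspan d A" "?d i \<in> zspan ?d A" if "i \<in> A" for i
    by (rule zspan_base[OF assms(1) that])+
  have "?d i \<in> zspan d A" if "i \<in> A" for i
    using base(1)[OF that] zspan_add[OF base(1)[OF assms(2)] x(1)] by simp
  moreover have "d i \<in> zspan ?d A" if "i \<in> A" for i
    using base(2)[OF that] zspan_diff[OF base(2)[OF assms(2)] x(2)] by (cases "i = k") auto
  ultimately show ?thesis using zspan_least[OF assms(1)] by (metis (no_types, lifting) subset_antisym)
qed

definition zindep :: "('i \<Rightarrow> real) \<Rightarrow> 'i set \<Rightarrow> bool" where
  "zindep e C \<longleftrightarrow> (\<forall>c :: 'i \<Rightarrow> int. (\<Sum>i\<in>C. of_int (c i) * e i) = 0 \<longrightarrow> (\<forall>i\<in>C. c i = 0))"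

definition zrank :: "real set \<Rightarrow> nat" where
  "zrank \<Gamma> = (LEAST n. \<exists>B. finite B \<and> card B = n \<and> zspan (\<lambda>x. x) B = \<Gamma>)"

lemma zspan_image: 
  assumes "finite A"
  shows "zspan (\<lambda>x. x) (e ` A) = zspan e A"
proof
  show "zspan (\<lambda>x. x) (e ` A) \<subseteq> zspan e A"
    using assms zspan_base[OF assms] by (intro zspan_least) auto
  show "zspan e A \<subseteq> zspan (\<lambda>x. x) (e ` A)"
    using assms zspan_base[of "e ` A" _ "\<lambda>x. x"] by (intro zspan_least) auto
qed

lemma zrank_le:
  assumes "finite A" "zspan e A = \<Gamma>"
  shows "zrank \<Gamma> \<le> card A"
proof -
  have "zrank \<Gamma> \<le> card (e ` A)"
    unfolding zrank_def by (rule Least_le) (use assms zspan_image in blast)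
  then show ?thesis using card_image_le[OF assms(1), of e] by linarith
qed

lemma zrank_attained:
  assumes "finite A" "zspan e A = \<Gamma>"
  obtains B where "finite B" "card B = zrank \<Gamma>" "zspan (\<lambda>x. x) B = \<Gamma>"
proof -
  have "\<exists>B. finite B \<and> card B = zrank \<Gamma> \<and> zspan (\<lambda>x. x) B = \<Gamma>"
    unfolding zrank_def by (rule LeastI_ex) (use assms zspan_image in blast)
  then show thesis using that by blast
qed

lemma sum_split_pair:
  fixes f :: "'i \<Rightarrow> 'a::comm_monoid_add"
  assumes "finite J" "a \<in> J" "b \<in> J" "a \<noteq> b"
  shows "sum f J = f a + f b + sum f (J - {a, b})"
  using assms by (simp add: sum.remove[of J a] sum.remove[of "J - {a}" b] Diff_insert2[symmetric] insert_commute add.assoc)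

lemma euclidean_step_decreases:
  fixes c :: "'i \<Rightarrow> int"
  assumes "finite J" "a \<in> J" "b \<in> J" "c a \<noteq> 0" "c b \<noteq> 0" "\<bar>c a\<bar> \<le> \<bar>c b\<bar>"
  defines "c' \<equiv> c(b := c b - sgn (c a) * sgn (c b) * c a)"
  shows "nat (\<Sum>j\<in>J. \<bar>c' j\<bar>) < nat (\<Sum>j\<in>J. \<bar>c j\<bar>)"
proof -
  have "\<bar>c b - sgn (c a) * sgn (c b) * c a\<bar> < \<bar>c b\<bar>" using assms(4-6) by (auto simp: sgn_if split: if_splits)
  then have "(\<Sum>j\<in>J. \<bar>c' j\<bar>) < (\<Sum>j\<in>J. \<bar>c j\<bar>)"
    using assms(3) by (intro sum_strict_mono_ex1[OF assms(1)]) (auto simp: c'_def)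
  then show ?thesis using sum_nonneg[of J "\<lambda>j. \<bar>c' j\<bar>"] by linarith
qed

text \<open>The Euclidean algorithm on the coefficients of a relation turns it into a multiple of a
  single generator, which therefore vanishes and can be dropped.\<close>

lemma zindep_of_minimal:
  assumes "finite C" "zspan e C = \<Gamma>" "card C = zrank \<Gamma>"
  shows "zindep e C"
proof -
  have False if "zspan e C = \<Gamma>" "(\<Sum>i\<in>C. of_int (c i) * e i) = 0" "\<exists>i\<in>C. c i \<noteq> 0"
    "nat (\<Sum>i\<in>C. \<bar>c i\<bar>) = N" for e and c :: "'a \<Rightarrow> int" and N
    using that
  proof (induction N arbitrary: e c rule: less_induct)
    case (less N)
    obtain i where i: "i \<in> C" "c i \<noteq> 0" using less.prems(3) by blast
    show False
    proof (cases "\<exists>j\<in>C. j \<noteq> i \<and> c j \<noteq> 0")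
      case False
      then have "(\<Sum>j\<in>C. of_int (c j) * e j) = of_int (c i) * e i"
        using i assms(1) by (subst sum.remove[of _ i]) (auto intro!: sum.neutral)
      then have "e i = 0" using less.prems(2) i by simp
      have "zspan e (C - {i}) = \<Gamma>"
        unfolding less.prems(1)[symmetric]
      proof
        show "zspan e (C - {i}) \<subseteq> zspan e C" using assms(1) zspan_base by (intro zspan_least) auto
        have "e j \<in> zspan e (C - {i})" if "j \<in> C" for j
          using that assms(1) \<open>e i = 0\<close> zspan_0 zspan_base[of "C - {i}" j e] by (cases "j = i") auto
        then show "zspan e C \<subseteq> zspan e (C - {i})" using assms(1) by (intro zspan_least) auto
      qed
      then have "zrank \<Gamma> \<le> card (C - {i})" by (intro zrank_le[of _ e] finite_Diff assms(1))
      then show False using card_Diff1_less[OF assms(1) i(1)] assms(3) by linarith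
    next
      case True
      then obtain a b where ab: "a \<in> C" "b \<in> C" "a \<noteq> b" "c a \<noteq> 0" "c b \<noteq> 0" "\<bar>c a\<bar> \<le> \<bar>c b\<bar>"
        using i by (metis linorder_linear)
      define s where "s = sgn (c a) * sgn (c b)"
      define e' where "e' = e(a := e a + of_int s * e b)"
      define c' where "c' = c(b := c b - s * c a)"
      have "zspan e' C = zspan e C"
        unfolding e'_def using ab assms(1) by (intro zspan_upd zspan_mult zspan_base) auto
      moreover have "(\<Sum>i\<in>C. of_int (c' i) * e' i) = (\<Sum>i\<in>C. of_int (c i) * e i)"
      proof -
        show ?thesis
          using ab(3) unfolding sum_split_pair[OF assms(1) ab(1-3)] by (simp add: e'_def c'_def algebra_simps)
      qed
      moreover have "nat (\<Sum>i\<in>C. \<bar>c' i\<bar>) < N"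
        using euclidean_step_decreases[OF assms(1) ab(1,2,4-6)] less.prems(4) by (simp add: c'_def s_def)
      moreover have "\<exists>i\<in>C. c' i \<noteq> 0" using ab by (auto simp: c'_def intro!: bexI[of _ a])
      ultimately show False using less.IH[of _ e' c'] less.prems by simp
    qed
  qed
  then show ?thesis unfolding zindep_def using assms(2) by blast
qed

section \<open>Elementary moves on positive families\<close>

text \<open>The bound \<open>S\<close> on the sum is the bound on the ball in which the corresponding isotopies of tori take
  place; \<open>conn\<close> is the equivalence relation in which no intermediate family exceeds it.\<close>

definition move :: "'i set \<Rightarrow> real \<Rightarrow> ('i \<Rightarrow> real) \<Rightarrow> ('i \<Rightarrow> real) \<Rightarrow> bool" where
  "move A S d d' \<longleftrightarrow> (\<forall>i\<in>A. 0 < d i) \<and> sum d' A \<le> S \<and> (\<exists>j\<in>A. \<exists>k\<in>A. j \<noteq> k \<and>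
     (d' = d(k := d k + d j) \<or> d' = d(j := d k, k := d j)))"

abbreviation conn :: "'i set \<Rightarrow> real \<Rightarrow> ('i \<Rightarrow> real) \<Rightarrow> ('i \<Rightarrow> real) \<Rightarrow> bool" where
  "conn A S \<equiv> equivclp (move A S)"

lemma sum_upd:
  assumes "finite A" "k \<in> A"
  shows "sum (d(k := x)) A = sum d A - d k + (x :: real)"
  using assms by (simp add: sum.remove[of A k])

lemma sum_swap:
  assumes "finite A" "j \<in> A" "k \<in> A"
  shows "sum (d(j := d k, k := d j)) A = (sum d A :: real)"
  using sum_upd[OF assms(1,3), of "d(j := d k)" "d j"] sum_upd[OF assms(1,2), of d "d k"]
  by (cases "j = k") auto

lemma zspan_swap:
  assumes "finite A" "j \<in> A" "k \<in> A"
  shows "zspan (d(j := d k, k := d j)) A = zspan d A"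
proof -
  have "(d(j := d k, k := d j)) ` A = d ` A"
    using assms by (auto simp: image_iff)
  then show ?thesis using zspan_image[OF assms(1)] by metis
qed

lemma move_invariants:
  assumes "finite A" "move A S d d'"
  shows "\<forall>i\<in>A. 0 < d i" "\<forall>i\<in>A. 0 < d' i" "zspan d' A = zspan d A" "\<forall>i. i \<notin> A \<longrightarrow> d' i = d i"
    "sum d A \<le> S" "sum d' A \<le> S"
proof -
  obtain j k where jk: "j \<in> A" "k \<in> A" "j \<noteq> k" "d' = d(k := d k + d j) \<or> d' = d(j := d k, k := d j)"
    and pos: "\<forall>i\<in>A. 0 < d i" and S: "sum d' A \<le> S"
    using assms(2) unfolding move_def by blast
  show "\<forall>i\<in>A. 0 < d i" "sum d' A \<le> S" by fact+
  show "\<forall>i\<in>A. 0 < d' i" "\<forall>i. i \<notin> A \<longrightarrow> d' i = d i" using pos jk by (auto simp: add_pos_pos)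
  show "zspan d' A = zspan d A"
    using jk(4)
  proof
    assume "d' = d(j := d k, k := d j)"
    then show ?thesis using zspan_swap[OF assms(1) jk(1,2)] by metis
  next
    assume d': "d' = d(k := d k + d j)"
    show ?thesis
      unfolding d' using jk assms(1) by (intro zspan_upd zspan_base) auto
  qed
  show "sum d A \<le> S"
    using jk(4)
  proof
    assume "d' = d(j := d k, k := d j)"
    then show ?thesis using sum_swap[OF assms(1) jk(1,2)] S by metis
  next
    assume d': "d' = d(k := d k + d j)"
    have "sum d A \<le> sum d' A"
      using pos jk by (intro sum_mono) (auto simp: d' less_imp_le)
    then show ?thesis using S by linarith
  qed
qed

lemma conn_invariants:
  assumes "finite A" "conn A S d d'" "\<forall>i\<in>A. 0 < d i" "sum d A \<le> S"
  shows "\<forall>i\<in>A. 0 < d' i" "zspan d' A = zspan d A" "\<forall>i. i \<notin> A \<longrightarrow> d' i = d i" "sum d' A \<le> S"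
proof -
  have "(\<forall>i\<in>A. 0 < d' i) \<and> zspan d' A = zspan d A \<and> (\<forall>i. i \<notin> A \<longrightarrow> d' i = d i) \<and> sum d' A \<le> S"
    using assms(2)
  proof (induction rule: equivclp_induct)
    case base
    then show ?case using assms by simp
  next
    case (step y z)
    from step(2) show ?case
      using move_invariants[OF assms(1)] step.IH by metis
  qed
  then show "\<forall>i\<in>A. 0 < d' i" "zspan d' A = zspan d A" "\<forall>i. i \<notin> A \<longrightarrow> d' i = d i" "sum d' A \<le> S"
    by blast+
qed

lemma conn_refl: "conn A S d d"
  by (simp add: equivclp_refl)

lemma conn_trans: "conn A S d d' \<Longrightarrow> conn A S d' d'' \<Longrightarrow> conn A S d d''"
  by (rule equivclp_trans)

lemma conn_move: "move A S d d' \<Longrightarrow> conn A S d d'" "move A S d' d \<Longrightarrow> conn A S d d'"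
  by (auto intro: r_into_equivclp equivclp_sym)

lemma conn_add:
  assumes "finite A" "\<forall>i\<in>A. 0 < d i" "j \<in> A" "k \<in> A" "j \<noteq> k" "sum d A + d j \<le> S"
  shows "conn A S d (d(k := d k + d j))"
  by (rule conn_move(1)) (use assms sum_upd[OF assms(1,4), of d "d k + d j"] in \<open>auto simp: move_def\<close>)

lemma conn_sub:
  assumes "finite A" "\<forall>i\<in>A. 0 < d i" "j \<in> A" "k \<in> A" "j \<noteq> k" "d j < d k" "sum d A \<le> S"
  shows "conn A S d (d(k := d k - d j))"
proof (rule conn_move(2))
  let ?d = "d(k := d k - d j)"
  have "d = ?d(k := ?d k + ?d j)" using assms(5) by simp
  then have "\<exists>j\<in>A. \<exists>k\<in>A. j \<noteq> k \<and> (d = ?d(k := ?d k + ?d j) \<or> d = ?d(j := ?d k, k := ?d j))"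
    using assms(3-5) by blast
  moreover have "\<forall>i\<in>A. 0 < ?d i" using assms by simp
  ultimately show "move A S ?d d"
    unfolding move_def using assms(7) by blast
qed

lemma conn_swap:
  assumes "finite A" "\<forall>i\<in>A. 0 < d i" "j \<in> A" "k \<in> A" "sum d A \<le> S"
  shows "conn A S d (d(j := d k, k := d j))"
proof (cases "j = k")
  case True
  then show ?thesis by (simp add: conn_refl)
next
  case False
  show ?thesis
    by (rule conn_move(1)) (use assms False sum_swap[OF assms(1,3,4), of d] in \<open>auto simp: move_def\<close>)
qed

lemma conn_add_mult:
  assumes "finite A" "\<forall>i\<in>A. 0 < d i" "j \<in> A" "k \<in> A" "j \<noteq> k" "sum d A + real n * d j \<le> S"
  shows "conn A S d (d(k := d k + real n * d j))"
  using assms(6)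
proof (induction n)
  case 0
  then show ?case by (simp add: conn_refl)
next
  case (Suc n)
  let ?d = "d(k := d k + real n * d j)"
  have dj: "0 < d j" using assms by auto
  then have "sum d A + real n * d j \<le> S" using Suc.prems by (simp add: algebra_simps)
  then have "conn A S d ?d" by (rule Suc.IH)
  moreover have "conn A S ?d (?d(k := ?d k + ?d j))"
    using assms dj less_imp_le[OF dj] Suc.prems sum_upd[OF assms(1,4), of d "d k + real n * d j"]
    by (intro conn_add) (auto simp: algebra_simps intro: add_pos_nonneg)
  moreover have "?d(k := ?d k + ?d j) = d(k := d k + real (Suc n) * d j)"
    using assms(5) by (simp add: fun_eq_iff algebra_simps)
  ultimately show ?case by (metis conn_trans)
qed

lemma conn_sub_mult:
  assumes "finite A" "\<forall>i\<in>A. 0 < d i" "j \<in> A" "k \<in> A" "j \<noteq> k" "sum d A \<le> S" "real n * d j < d k"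
  shows "conn A S d (d(k := d k - real n * d j))"
proof -
  let ?d = "d(k := d k - real n * d j)"
  have "conn A S ?d (?d(k := ?d k + real n * ?d j))"
    using assms sum_upd[OF assms(1,4), of d "d k - real n * d j"]
    by (intro conn_add_mult) auto
  moreover have "?d(k := ?d k + real n * ?d j) = d"
    using assms(5) by (simp add: fun_eq_iff)
  ultimately show ?thesis by (metis equivclp_sym)
qed


section \<open>Families reduced modulo one of their members\<close>

text \<open>The representative of \<open>x\<close> modulo \<open>v\<close> in the half-open interval \<open>(0, v]\<close>: members of a family have to stay
  positive, so the class of \<open>0\<close> is represented by \<open>v\<close>.\<close>

definition residue :: "real \<Rightarrow> real \<Rightarrow> real" where
  "residue v x = x - of_int (\<lceil>x / v\<rceil> - 1) * v"

lemma residue_range: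
  assumes "0 < v"
  shows "0 < residue v x" "residue v x \<le> v"
proof -
  have "x \<le> of_int \<lceil>x / v\<rceil> * v" "(of_int \<lceil>x / v\<rceil> - 1) * v < x"
    using le_of_int_ceiling[of "x / v"] ceiling_correct[of "x / v"] assms
    by (simp_all only: pos_divide_le_eq pos_less_divide_eq)
  then show "0 < residue v x" "residue v x \<le> v"
    by (simp_all add: residue_def algebra_simps)
qed

lemma residue_eqI:
  assumes "0 < v" "0 < y" "y \<le> v" "x = y + of_int m * v"
  shows "residue v x = y"
proof -
  have "x / v = y / v + of_int m" using assms by (simp add: field_simps)
  moreover have "0 < y / v" "y / v \<le> 1" using assms by auto
  ultimately have "\<lceil>x / v\<rceil> = m + 1" by (intro ceiling_unique) auto
  then show ?thesis using assms(4) by (simp add: residue_def)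
qed

lemma residue_decomp: "x = residue v x + of_int (\<lceil>x / v\<rceil> - 1) * v"
  by (simp add: residue_def)

lemma residue_cong:
  assumes "0 < v" "x = y + of_int m * v"
  shows "residue v x = residue v y"
  by (rule residue_eqI[OF assms(1) residue_range[OF assms(1)], of _ _ "m + (\<lceil>y / v\<rceil> - 1)"])
    (use assms(2) residue_decomp[of y v] in \<open>simp add: algebra_simps\<close>)

lemma residue_same: "0 < x \<Longrightarrow> x \<le> v \<Longrightarrow> residue v x = x"
  by (rule residue_eqI[of _ _ _ 0]) auto

lemma residue_0: "0 < v \<Longrightarrow> residue v 0 = v"
  by (rule residue_eqI[of _ _ _ "- 1"]) auto

lemma residue_residue: 
  assumes "0 < v"
  shows "residue v (residue v x + y) = residue v (x + y)"
  by (rule residue_cong[OF assms, of _ _ "- (\<lceil>x / v\<rceil> - 1)"]) (simp add: residue_def algebra_simps)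

lemma residue_residue':
  "0 < v \<Longrightarrow> residue v (y + residue v x) = residue v (y + x)"
  using residue_residue[of v x y] by (simp add: add.commute)

lemma residue_minus_residue: 
  assumes "0 < v"
  shows "residue v (y - residue v x) = residue v (y - x)"
  by (rule residue_cong[OF assms, of _ _ "\<lceil>x / v\<rceil> - 1"]) (simp add: residue_def algebra_simps)

lemma conn_residue:
  assumes "finite A" "\<forall>i\<in>A. 0 < d i" "j \<in> A" "k \<in> A" "j \<noteq> k" "sum d A \<le> S"
  shows "conn A S d (d(k := residue (d j) (d k)))"
proof -
  have pos: "0 < d j" "0 < d k" using assms by auto
  then have "0 < d k / d j" by simp
  then have "0 \<le> \<lceil>d k / d j\<rceil> - 1" by linarith
  then have n: "of_int (\<lceil>d k / d j\<rceil> - 1) = real (nat (\<lceil>d k / d j\<rceil> - 1))" by simp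
  have "residue (d j) (d k) = d k - real (nat (\<lceil>d k / d j\<rceil> - 1)) * d j"
    unfolding residue_def n ..
  then show ?thesis
    using conn_sub_mult[OF assms, of "nat (\<lceil>d k / d j\<rceil> - 1)"] residue_range(1)[OF pos(1), of "d k"] by simp
qed

text \<open>The last inequality leaves room for one further summand \<open>d p\<close>: in such a family any member can be
  added to another one before reducing it modulo \<open>d p\<close> again.\<close>

definition mod_reduced :: "'i set \<Rightarrow> real \<Rightarrow> 'i \<Rightarrow> ('i \<Rightarrow> real) \<Rightarrow> bool" where
  "mod_reduced A S p d \<longleftrightarrow> finite A \<and> p \<in> A \<and> (\<forall>i\<in>A. 0 < d i \<and> d i \<le> d p) \<and> (real (card A) + 1) * d p \<le> S"

lemma mod_reducedD:
  assumes "mod_reduced A S p d"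
  shows "finite A" "p \<in> A" "\<forall>i\<in>A. 0 < d i" "\<And>i. i \<in> A \<Longrightarrow> d i \<le> d p" "0 < d p"
    "sum d A + d p \<le> S" "sum d A \<le> S"
proof -
  show A: "finite A" "p \<in> A" "\<forall>i\<in>A. 0 < d i" and le: "\<And>i. i \<in> A \<Longrightarrow> d i \<le> d p" and p: "0 < d p"
    using assms by (auto simp: mod_reduced_def)
  have "sum d A \<le> real (card A) * d p" using sum_bounded_above[of A d "d p"] le by simp
  moreover have "(real (card A) + 1) * d p \<le> S" using assms by (simp add: mod_reduced_def)
  ultimately show "sum d A + d p \<le> S" by (simp add: algebra_simps)
  with p show "sum d A \<le> S" by linarith
qed

lemma reduced_upd:
  assumes "mod_reduced A S p d" "i \<noteq> p" "0 < x" "x \<le> d p"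
  shows "mod_reduced A S p (d(i := x))"
  using assms by (auto simp: mod_reduced_def)

lemma reduced_residue:
  assumes "mod_reduced A S p d" "i \<noteq> p"
  shows "mod_reduced A S p (d(i := residue (d p) x))"
  using reduced_upd[OF assms residue_range] mod_reducedD(5)[OF assms(1)] by blast

lemma reduced_add:
  assumes "mod_reduced A S p d" "i \<in> A" "i \<noteq> p" "j \<in> A" "j \<noteq> i"
  shows "conn A S d (d(i := residue (d p) (d i + d j)))"
proof -
  note r = mod_reducedD[OF assms(1)]
  let ?d = "d(i := d i + d j)"
  have "conn A S d ?d"
    using assms r(4)[OF assms(4)] r(6) by (intro conn_add r) auto
  moreover have "conn A S ?d (?d(i := residue (?d p) (?d i)))"
  proof (rule conn_residue[OF r(1) _ r(2) assms(2)])
    show "\<forall>l\<in>A. 0 < ?d l" using r(3) assms(2,4) by (auto simp: add_pos_pos)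
    show "sum ?d A \<le> S"
      using sum_upd[OF r(1) assms(2), of d "d i + d j"] r(4)[OF assms(4)] r(6) by linarith
  qed (use assms in auto)
  moreover have "?d(i := residue (?d p) (?d i)) = d(i := residue (d p) (d i + d j))"
    using assms(3) by simp
  ultimately show ?thesis by (metis conn_trans)
qed

text \<open>With \<open>v = d p\<close> and \<open>x = d i < v\<close>, the pair \<open>(v, x)\<close> goes to \<open>(v - x, x)\<close>, then to \<open>(v - x, v)\<close>, and
  a swap finishes.\<close>

lemma reduced_minus:
  assumes "mod_reduced A S p d" "i \<in> A" "i \<noteq> p"
  shows "conn A S d (d(i := residue (d p) (- d i)))"
proof (cases "d i = d p")
  case True
  have "residue (d p) (- d i) = d i"
    using mod_reducedD(5)[OF assms(1)] True by (intro residue_eqI[of _ _ _ "- 2"]) auto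
  then show ?thesis by (simp add: conn_refl)
next
  case False
  note r = mod_reducedD[OF assms(1)]
  have lt: "d i < d p" using r(4)[OF assms(2)] False by simp
  have di: "0 < d i" using r(3) assms(2) by blast
  have res: "residue (d p) (- d i) = d p - d i"
    using r(5) lt di by (intro residue_eqI[of _ _ _ "- 1"]) auto
  define e where "e = d(p := d p - d i)"
  define f where "f = e(i := e i + e p)"
  have "conn A S d e" unfolding e_def using lt assms by (intro conn_sub r) auto
  moreover have e: "\<forall>l\<in>A. 0 < e l" using r(3) lt by (auto simp: e_def)
  have sume: "sum e A = sum d A - d i" unfolding e_def by (simp only: sum_upd[OF r(1,2)])
  have "conn A S e f"
    unfolding f_def using e assms sume r(5-7) lt by (intro conn_add r) (auto simp: e_def)
  moreover have "conn A S f (f(p := f i, i := f p))"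
  proof (rule conn_swap[OF r(1) _ r(2) assms(2)])
    show "\<forall>l\<in>A. 0 < f l" using e assms(2) r(2) by (auto simp: f_def add_pos_pos)
    have "sum f A = sum e A + e p" unfolding f_def by (simp only: sum_upd[OF r(1) assms(2)])
    then show "sum f A \<le> S" using sume r(5-7) di by (simp add: e_def)
  qed
  moreover have "f(p := f i, i := f p) = d(i := residue (d p) (- d i))"
    using assms(3) by (auto simp: f_def e_def res fun_eq_iff)
  ultimately show ?thesis by (metis conn_trans)
qed

lemma reduced_diff:
  assumes "mod_reduced A S p d" "i \<in> A" "i \<noteq> p" "j \<in> A" "j \<noteq> i"
  shows "conn A S d (d(i := residue (d p) (d i - d j)))"
proof -
  define v where "v = d p"
  have v: "0 < v" using mod_reducedD(5)[OF assms(1)] by (simp add: v_def)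
  define e where "e = d(i := residue v (- d i))"
  define f where "f = e(i := residue v (e i + e j))"
  have e: "conn A S d e" "mod_reduced A S p e"
    unfolding e_def v_def using reduced_minus[OF assms(1-3)] reduced_residue[OF assms(1,3)] by auto
  have ep: "e p = v" using assms(3) by (simp add: e_def v_def)
  have f: "conn A S e f" "mod_reduced A S p f"
    unfolding f_def using reduced_add[OF e(2) assms(2-5)] reduced_residue[OF e(2) assms(3)] by (auto simp: ep)
  have fp: "f p = v" using assms(3) ep by (simp add: f_def)
  have "conn A S f (f(i := residue (f p) (- f i)))"
    by (rule reduced_minus[OF f(2) assms(2,3)])
  moreover have "f(i := residue (f p) (- f i)) = d(i := residue (d p) (d i - d j))"
  proof -
    have "residue v (- f i) = residue v (0 - residue v (residue v (- d i) + d j))"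
      using assms(5) by (simp add: f_def e_def)
    also have "\<dots> = residue v (d i - d j)"
      using residue_minus_residue[OF v, of 0 "d j - d i"] by (simp add: residue_residue[OF v])
    finally have "f(i := residue (f p) (- f i)) = f(i := residue v (d i - d j))" by (simp only: fp)
    then show ?thesis by (simp add: f_def e_def v_def)
  qed
  ultimately show ?thesis using e f by (metis conn_trans)
qed

lemma reduced_int_mult:
  assumes "mod_reduced A S p d" "i \<in> A" "i \<noteq> p" "j \<in> A" "j \<noteq> i"
  shows "conn A S d (d(i := residue (d p) (d i + of_int n * d j)))"
proof -
  define v where "v = d p"
  have v: "0 < v" using mod_reducedD(5)[OF assms(1)] by (simp add: v_def)
  have di: "residue v (d i) = d i"
    using mod_reducedD(3,4)[OF assms(1)] assms(2) by (intro residue_same) (auto simp: v_def)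
  have step: "conn A S (d(i := residue v x)) (d(i := residue v (x + d j)))"
     "conn A S (d(i := residue v x)) (d(i := residue v (x - d j)))" for x
  proof -
    have r: "mod_reduced A S p (d(i := residue v x))" using reduced_residue[OF assms(1,3)] by (simp add: v_def)
    show "conn A S (d(i := residue v x)) (d(i := residue v (x + d j)))"
      using reduced_add[OF r assms(2-5)] assms(3,5) by (simp add: v_def[symmetric] residue_residue[OF v])
    show "conn A S (d(i := residue v x)) (d(i := residue v (x - d j)))"
      using reduced_diff[OF r assms(2-5)] assms(3,5) residue_residue[OF v, of x "- d j"]
      by (simp add: v_def[symmetric])
  qed
  have "conn A S d (d(i := residue v (d i + of_int n * d j)))"
  proof (induction n rule: int_induct[of _ 0])
    case base
    show ?case by (simp add: di conn_refl)
  next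
    case (step1 n)
    from conn_trans[OF step1(2) step(1)] show ?case by (simp add: algebra_simps fun_upd_def)
  next
    case (step2 n)
    from conn_trans[OF step2(2) step(2)] show ?case by (simp add: algebra_simps fun_upd_def)
  qed
  then show ?thesis by (simp add: v_def)
qed

lemma reduced_combination:
  assumes "mod_reduced A S p d" "i \<in> A" "i \<noteq> p" "K \<subseteq> A - {i}"
  shows "conn A S d (d(i := residue (d p) (d i + (\<Sum>j\<in>K. of_int (c j) * d j))))"
proof -
  define v where "v = d p"
  have v: "0 < v" using mod_reducedD(5)[OF assms(1)] by (simp add: v_def)
  have di: "residue v (d i) = d i"
    using mod_reducedD(3,4)[OF assms(1)] assms(2) by (intro residue_same) (auto simp: v_def)
  have "finite K" using assms(4) mod_reducedD(1)[OF assms(1)] by (meson finite_Diff finite_subset)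
  then have "conn A S d (d(i := residue v (d i + (\<Sum>j\<in>K. of_int (c j) * d j))))"
    using assms(4)
  proof (induction K rule: finite_induct)
    case empty
    show ?case by (simp add: di conn_refl)
  next
    case (insert j K)
    let ?d = "d(i := residue v (d i + (\<Sum>j\<in>K. of_int (c j) * d j)))"
    have r: "mod_reduced A S p ?d" using reduced_residue[OF assms(1,3)] by (simp add: v_def)
    have "conn A S ?d (?d(i := residue (?d p) (?d i + of_int (c j) * ?d j)))"
      using insert.prems by (intro reduced_int_mult[OF r assms(2,3)]) auto
    moreover have "?d(i := residue (?d p) (?d i + of_int (c j) * ?d j))
        = d(i := residue v (d i + (\<Sum>j\<in>insert j K. of_int (c j) * d j)))"
      using insert.prems insert.hyps assms(3) by (auto simp: v_def[symmetric] residue_residue[OF v] residue_residue'[OF v] add_ac)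
    moreover have "conn A S d ?d" using insert.IH insert.prems by blast
    ultimately show ?case by (metis conn_trans)
  qed
  then show ?thesis by (simp add: v_def)
qed

text \<open>Replacing \<open>d a\<close> by \<open>d a \<plusminus> d b\<close> modulo \<open>d p\<close> changes the coefficient of \<open>d b\<close> by the one of \<open>d a\<close>. So the
  Euclidean algorithm on the coefficients collects a combination in a single member; for what
  follows it matters that \<open>g\<close> divides all coefficients.\<close>

lemma reduced_euclid:
  assumes "mod_reduced A S p d" "J \<subseteq> A - {p}" "J \<noteq> {}"
  shows "\<exists>d' i g m. i \<in> J \<and> conn A S d d' \<and> mod_reduced A S p d' \<and> (\<forall>l. l \<notin> J \<longrightarrow> d' l = d l) \<and>
    0 \<le> g \<and> (\<forall>j\<in>J. g dvd c j) \<and> (\<Sum>j\<in>J. of_int (c j) * d j) = of_int g * d' i + of_int (m::int) * d p"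
  using assms(1)
proof (induction "nat (\<Sum>j\<in>J. \<bar>c j\<bar>)" arbitrary: d c rule: less_induct)
  case less
  note r = mod_reducedD[OF less.prems]
  have fJ: "finite J" using assms(2) r(1) by (meson finite_Diff finite_subset)
  define v where "v = d p"
  have v: "0 < v" using r(5) by (simp add: v_def)
  show ?case
  proof (cases "\<exists>a\<in>J. \<exists>b\<in>J. a \<noteq> b \<and> c a \<noteq> 0 \<and> c b \<noteq> 0")
    case True
    then obtain a b where ab: "a \<in> J" "b \<in> J" "a \<noteq> b" "c a \<noteq> 0" "c b \<noteq> 0" "\<bar>c a\<bar> \<le> \<bar>c b\<bar>"
      by (metis linorder_linear)
    have abA: "a \<in> A" "a \<noteq> p" "b \<in> A" "b \<noteq> p" using ab assms(2) by auto
    define s where "s = sgn (c a) * sgn (c b)"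
    define e where "e = d(a := residue v (d a + of_int s * d b))"
    define c' where "c' = c(b := c b - s * c a)"
    define k where "k = \<lceil>(d a + of_int s * d b) / v\<rceil> - 1"
    have ea: "d a + of_int s * d b = e a + of_int k * v"
      using residue_decomp[of "d a + of_int s * d b" v] by (simp add: e_def k_def)
    have e: "conn A S d e" "mod_reduced A S p e"
      unfolding e_def v_def using reduced_int_mult[OF less.prems abA(1,2,3) ab(3)[symmetric]] reduced_residue[OF less.prems abA(2)] by auto
    have split: "sum f J = f a + f b + sum f (J - {a, b})" for f :: "'a \<Rightarrow> real"
      by (rule sum_split_pair[OF fJ ab(1-3)])
    have "nat (\<Sum>j\<in>J. \<bar>c' j\<bar>) < nat (\<Sum>j\<in>J. \<bar>c j\<bar>)"
      using euclidean_step_decreases[OF fJ ab(1,2,4-6)] by (simp add: c'_def s_def)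
    from less.hyps[OF this e(2)] obtain d' i g m where IH: "i \<in> J" "conn A S e d'" "mod_reduced A S p d'"
      "\<forall>l. l \<notin> J \<longrightarrow> d' l = e l" "0 \<le> g" "\<forall>j\<in>J. g dvd c' j"
      "(\<Sum>j\<in>J. of_int (c' j) * e j) = of_int g * d' i + of_int m * e p" by blast
    have "g dvd c j" if "j \<in> J" for j
    proof (cases "j = b")
      case True
      have "g dvd c a" "g dvd c b - s * c a" using IH(6) ab by (auto simp: c'_def split: if_splits)
      then have "g dvd (c b - s * c a) + s * c a" by (intro dvd_add dvd_mult)
      then show ?thesis using True by simp
    next
      case False
      then show ?thesis using IH(6) that by (auto simp: c'_def)
    qed
    moreover have "(\<Sum>j\<in>J. of_int (c j) * d j) = of_int g * d' i + of_int (m + c a * k) * d p"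
    proof -
      have rest: "(\<Sum>j\<in>J - {a, b}. of_int (c' j) * e j) = (\<Sum>j\<in>J - {a, b}. of_int (c j) * d j)"
        by (rule sum.cong) (auto simp: c'_def e_def)
      have "(\<Sum>j\<in>J. of_int (c j) * d j)
        = of_int (c a) * (d a + of_int s * d b) + of_int (c b - s * c a) * d b + (\<Sum>j\<in>J - {a, b}. of_int (c j) * d j)"
        unfolding split by (simp add: algebra_simps)
      also have "\<dots> = (\<Sum>j\<in>J. of_int (c' j) * e j) + of_int (c a * k) * v"
        unfolding split rest ea using ab(3) by (simp add: c'_def e_def algebra_simps)
      also have "\<dots> = of_int g * d' i + of_int (m + c a * k) * v"
        unfolding IH(7) using abA by (simp add: e_def v_def algebra_simps)
      finally show ?thesis by (simp add: v_def)
    qed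
    moreover have "conn A S d d'" using e(1) IH(2) by (rule conn_trans)
    moreover have "\<forall>l. l \<notin> J \<longrightarrow> d' l = d l" using IH(4) ab by (auto simp: e_def)
    ultimately show ?thesis using IH(1,3,5) by blast
  next
    case False
    obtain i where i: "i \<in> J" "\<forall>j\<in>J. j \<noteq> i \<longrightarrow> c j = 0"
      using False assms(3) by (cases "\<exists>i\<in>J. c i \<noteq> 0") blast+
    then have iA: "i \<in> A" "i \<noteq> p" using assms(2) by auto
    have sum: "(\<Sum>j\<in>J. of_int (c j) * d j) = of_int (c i) * d i"
      using i fJ by (subst sum.remove[of _ i]) (auto intro!: sum.neutral)
    have dvd: "\<forall>j\<in>J. \<bar>c i\<bar> dvd c j" using i by auto
    show ?thesis
    proof (cases "0 \<le> c i")
      case True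
      then show ?thesis
        using i dvd sum less.prems conn_refl
        by (intro exI[of _ d] exI[of _ i] exI[of _ "c i"] exI[of _ 0]) auto
    next
      case False
      define e where "e = d(i := residue v (- d i))"
      define k where "k = \<lceil>(- d i) / v\<rceil> - 1"
      have k: "- d i = e i + of_int k * v" using residue_decomp[of "- d i" v] by (simp add: e_def k_def)
      have e: "conn A S d e" "mod_reduced A S p e"
        unfolding e_def v_def using reduced_minus[OF less.prems iA] reduced_residue[OF less.prems iA(2)] by auto
      have "of_int (c i) * d i = of_int (- c i) * (- d i)" by simp
      also have "\<dots> = of_int (- c i) * e i + of_int (- c i * k) * d p"
        unfolding k by (simp add: algebra_simps v_def)
      finally show ?thesis
        using i dvd sum e False
        by (intro exI[of _ e] exI[of _ i] exI[of _ "- c i"] exI[of _ "- c i * k"]) (auto simp: e_def)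
    qed
  qed
qed

lemma conn_reduced:
  assumes "finite A" "\<forall>i\<in>A. 0 < d i" "p \<in> A" "sum d A \<le> S" "(real (card A) + 1) * d p \<le> S"
  obtains d' where "conn A S d d'" "mod_reduced A S p d'" "d' p = d p"
    "\<And>i. i \<in> A \<Longrightarrow> \<exists>m::int. d i = d' i + of_int m * d p"
proof -
  define v where "v = d p"
  have v: "0 < v" using assms(2,3) by (simp add: v_def)
  have *: "conn A S d (\<lambda>i. if i \<in> K then residue v (d i) else d i)" if "finite K" "K \<subseteq> A - {p}" for K
    using that
  proof (induction K rule: finite_induct)
    case empty
    show ?case by (simp add: conn_refl)
  next
    case (insert k K)
    let ?d = "\<lambda>i. if i \<in> K then residue v (d i) else d i"
    have c: "conn A S d ?d" using insert by auto
    note inv = conn_invariants[OF assms(1) c assms(2,4)]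
    have "conn A S ?d (?d(k := residue (?d p) (?d k)))"
      using insert.prems by (intro conn_residue[OF assms(1) inv(1) assms(3) _ _ inv(4)]) auto
    moreover have "?d(k := residue (?d p) (?d k)) = (\<lambda>i. if i \<in> insert k K then residue v (d i) else d i)"
      using insert.prems insert.hyps by (auto simp: fun_eq_iff v_def)
    ultimately show ?case using c by (metis conn_trans)
  qed
  show thesis
  proof (rule that)
    show "conn A S d (\<lambda>i. if i \<in> A - {p} then residue v (d i) else d i)"
      using assms(1) by (intro *) auto
    show "mod_reduced A S p (\<lambda>i. if i \<in> A - {p} then residue v (d i) else d i)"
      using assms residue_range[OF v] by (auto simp: mod_reduced_def v_def)
    show "\<exists>m::int. d i = (if i \<in> A - {p} then residue v (d i) else d i) + of_int m * d p" if "i \<in> A" for i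
      using residue_decomp[of "d i" v] by (cases "i = p") (auto simp: v_def that intro: exI[of _ 0] exI[of _ "\<lceil>d i / v\<rceil> - 1"])
  qed auto
qed


section \<open>Normal forms\<close>

text \<open>As long as two members differ and none is below \<open>\<delta>\<close>, subtracting the smaller from the larger one lowers the
  sum by at least \<open>\<delta>\<close>.\<close>

lemma conn_small_or_equal:
  assumes "finite A" "0 < \<delta>" "\<forall>i\<in>A. 0 < d i" "sum d A \<le> S"
  shows "\<exists>d'. conn A S d d' \<and> ((\<exists>i\<in>A. d' i < \<delta>) \<or> (\<forall>i\<in>A. \<forall>j\<in>A. d' i = d' j))"
  using assms(3,4)
proof (induction "nat \<lfloor>sum d A / \<delta>\<rfloor>" arbitrary: d rule: less_induct)
  case less
  show ?case
  proof (cases "(\<exists>i\<in>A. d i < \<delta>) \<or> (\<forall>i\<in>A. \<forall>j\<in>A. d i = d j)")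
    case True
    then show ?thesis using conn_refl by blast
  next
    case False
    then obtain i j where ij: "i \<in> A" "j \<in> A" "d i < d j" by (metis linorder_neqE_linordered_idom)
    have ge: "\<delta> \<le> d i" using False ij by force
    define e where "e = d(j := d j - d i)"
    have c: "conn A S d e" unfolding e_def using ij less.prems by (intro conn_sub assms(1)) auto
    note inv = conn_invariants[OF assms(1) c less.prems]
    have "sum e A = sum d A - d i" unfolding e_def by (simp only: sum_upd[OF assms(1) ij(2)])
    then have "sum e A / \<delta> \<le> (sum d A - \<delta>) / \<delta>" using ge assms(2) by (intro divide_right_mono) auto
    also have "\<dots> = sum d A / \<delta> - 1" using assms(2) by (simp add: field_simps)
    finally have "\<lfloor>sum e A / \<delta>\<rfloor> \<le> \<lfloor>sum d A / \<delta>\<rfloor> - 1" by (simp add: le_floor_iff) linarith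
    moreover have "0 \<le> \<lfloor>sum e A / \<delta>\<rfloor>"
      using sum_nonneg[of A e] inv(1) assms(2) by (auto simp: less_imp_le)
    ultimately have "nat \<lfloor>sum e A / \<delta>\<rfloor> < nat \<lfloor>sum d A / \<delta>\<rfloor>" by linarith
    from less.hyps[OF this inv(1,4)] show ?thesis using c conn_trans by metis
  qed
qed

definition cyclic_reals :: "real set \<Rightarrow> bool" where
  "cyclic_reals \<Gamma> \<longleftrightarrow> (\<exists>x. \<Gamma> = range (\<lambda>m::int. of_int m * x))"

lemma zspan_const:
  assumes "finite A" "a \<in> A" "\<And>i. i \<in> A \<Longrightarrow> d i = y"
  shows "zspan d A = range (\<lambda>m::int. of_int m * y)"
proof
  show "zspan d A \<subseteq> range (\<lambda>m::int. of_int m * y)"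
  proof
    fix x assume "x \<in> zspan d A"
    then obtain c where "x = (\<Sum>i\<in>A. of_int (c i) * d i)" unfolding zspan_def by blast
    also have "\<dots> = of_int (\<Sum>i\<in>A. c i) * y" using assms(3) by (simp add: sum_distrib_right)
    finally show "x \<in> range (\<lambda>m::int. of_int m * y)" by blast
  qed
  show "range (\<lambda>m::int. of_int m * y) \<subseteq> zspan d A"
    using zspan_mult[OF zspan_base[OF assms(1,2), of d]] assms(3)[OF assms(2)] by auto
qed

text \<open>All members are positive multiples of \<open>x\<close>, so none of them ever is below \<open>x\<close>.\<close>

lemma conn_cyclic:
  assumes "finite A" "\<forall>i\<in>A. 0 < d i" "sum d A \<le> S" "zspan d A = range (\<lambda>m::int. of_int m * x)" "0 < x"
  obtains d' where "conn A S d d'" "\<And>i. i \<in> A \<Longrightarrow> d' i = x"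
proof -
  obtain d' where d': "conn A S d d'" "(\<exists>i\<in>A. d' i < x) \<or> (\<forall>i\<in>A. \<forall>j\<in>A. d' i = d' j)"
    using conn_small_or_equal[OF assms(1,5,2,3)] by blast
  note inv = conn_invariants[OF assms(1) d'(1) assms(2,3)]
  have span: "zspan d' A = range (\<lambda>m::int. of_int m * x)" using inv(2) assms(4) by simp
  have ge: "x \<le> y" if "y = of_int m * x" "0 < y" for y and m :: int
  proof -
    have "0 < m" using that assms(5) by (simp add: zero_less_mult_iff)
    then have "1 * x \<le> of_int m * x" using assms(5) by (intro mult_right_mono) auto
    then show ?thesis using that by simp
  qed
  have "d' i = x" if "i \<in> A" for i
  proof -
    have le: "x \<le> d' j" if "j \<in> A" for j
      using zspan_base[OF assms(1) that, of d'] inv(1) that ge unfolding span by auto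
    have "\<not> (\<exists>i\<in>A. d' i < x)" using le by (meson not_le)
    then have "\<forall>j\<in>A. d' j = d' i" using d'(2) that by blast
    then have "zspan d' A = range (\<lambda>m::int. of_int m * d' i)" using zspan_const[OF assms(1) that, of d' "d' i"] by blast
    moreover have "x \<in> zspan d' A" unfolding span using rangeI[of "\<lambda>m::int. of_int m * x" 1] by simp
    ultimately obtain m :: int where m: "x = of_int m * d' i" by blast
    have "0 < d' i" using inv(1) that by blast
    then have "0 < m" using m assms(5) by (simp add: zero_less_mult_iff)
    then have "1 * d' i \<le> of_int m * d' i" using \<open>0 < d' i\<close> by (intro mult_right_mono) auto
    then have "d' i \<le> x" using m by simp
    then show ?thesis using le[OF that] by simp
  qed
  then show thesis using that d'(1) by blast
qed

lemma conn_low: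
  assumes "finite A" "A \<noteq> {}" "\<forall>i\<in>A. 0 < d i" "sum d A \<le> S" "\<not> cyclic_reals (zspan d A)"
    "0 < \<delta>" "(real (card A) + 1) * \<delta> \<le> S"
  obtains d' p where "conn A S d d'" "mod_reduced A S p d'" "d' p < \<delta>"
proof -
  obtain d1 where d1: "conn A S d d1" "(\<exists>i\<in>A. d1 i < \<delta>) \<or> (\<forall>i\<in>A. \<forall>j\<in>A. d1 i = d1 j)"
    using conn_small_or_equal[OF assms(1,6,3,4)] by blast
  note inv = conn_invariants[OF assms(1) d1(1) assms(3,4)]
  obtain a where a: "a \<in> A" using assms(2) by blast
  have "\<not> (\<forall>i\<in>A. \<forall>j\<in>A. d1 i = d1 j)"
  proof
    assume "\<forall>i\<in>A. \<forall>j\<in>A. d1 i = d1 j"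
    then have "zspan d1 A = range (\<lambda>m::int. of_int m * d1 a)" using zspan_const[OF assms(1) a, of d1 "d1 a"] a by blast
    then show False using assms(5) inv(2) unfolding cyclic_reals_def by metis
  qed
  then obtain p where p: "p \<in> A" "d1 p < \<delta>" using d1(2) by blast
  have "(real (card A) + 1) * d1 p \<le> (real (card A) + 1) * \<delta>" using p by (intro mult_left_mono) auto
  then have "(real (card A) + 1) * d1 p \<le> S" using assms(7) by linarith
  from conn_reduced[OF assms(1) inv(1) p(1) inv(4) this] obtain d2 where
    "conn A S d1 d2" "mod_reduced A S p d2" "d2 p = d1 p" by metis
  then show thesis using that d1(1) p(2) conn_trans by metis
qed

text \<open>A member \<open>e k\<close> of a basis is not divisible in the group, even modulo other members. This is why
  the greatest common divisors \<open>h\<close> that come out of the Euclidean algorithm are \<open>1\<close>.\<close>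

lemma zindep_primitive:
  assumes "finite C" "zindep e C" "k \<in> C" "M \<subseteq> C - {k}" "x \<in> zspan e C"
    "e k = of_int h * x + (\<Sum>m\<in>M. of_int (c m) * e m)"
  shows "h dvd 1"
proof -
  obtain n where n: "x = (\<Sum>i\<in>C. of_int (n i) * e i)" using assms(5) unfolding zspan_def by blast
  let ?c = "\<lambda>i. h * n i + (if i \<in> M then c i else 0) - (if i = k then 1 else 0)"
  have M: "(\<Sum>i\<in>C. of_int (if i \<in> M then c i else 0) * e i) = (\<Sum>m\<in>M. of_int (c m) * e m)"
    using assms(1,4) by (intro sum.mono_neutral_cong_right) auto
  have K: "(\<Sum>i\<in>C. of_int (if i = k then 1 else 0) * e i) = e k"
    using assms(1,3) by (simp add: if_distrib[of "\<lambda>c. of_int c * _"] sum.delta' cong: if_cong)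
  have "(\<Sum>i\<in>C. of_int (?c i) * e i) = of_int h * x + (\<Sum>m\<in>M. of_int (c m) * e m) - e k"
    unfolding n M[symmetric] K[symmetric] sum_distrib_left sum.distrib[symmetric] sum_subtractf[symmetric]
    by (rule sum.cong) (simp_all add: algebra_simps)
  then have "(\<Sum>i\<in>C. of_int (?c i) * e i) = 0" using assms(6) by simp
  then have "?c k = 0" using assms(2)[unfolded zindep_def, THEN spec[of _ ?c]] assms(3) by blast
  moreover have "k \<notin> M" using assms(4) by blast
  ultimately have "h * n k = 1" by simp
  then show ?thesis by (metis dvd_triv_left)
qed

text \<open>With a member \<open>p\<close> as modulus, the Euclidean algorithm collects the combination \<open>v\<close> in one member, with
  coefficient \<open>g\<close>, but it does not control the coefficient of \<open>p\<close> itself. So it is run again, on these two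
  coefficients, which are coprime because \<open>v\<close> is primitive; a third member serves as modulus, whence the
  condition on \<open>card A\<close>.\<close>

lemma conn_insert_primitive:
  assumes "finite A" "3 \<le> card A" "\<forall>i\<in>A. 0 < d i" "sum d A \<le> S" "\<not> cyclic_reals (zspan d A)"
    "v \<in> zspan d A" "0 < v" "v < \<delta>" "(real (card A) + 1) * \<delta> \<le> S"
    and prim: "\<And>h x. x \<in> zspan d A \<Longrightarrow> v = of_int h * x \<Longrightarrow> h dvd 1"
  obtains d' p where "conn A S d d'" "mod_reduced A S p d'" "d' p = v"
proof -
  have ne: "A \<noteq> {}" "0 < \<delta>" using assms(2,7,8) by auto
  obtain d1 p where d1: "conn A S d d1" "mod_reduced A S p d1" "d1 p < \<delta>"
    using conn_low[OF assms(1) ne(1) assms(3-5) ne(2) assms(9)] by metis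
  note inv1 = conn_invariants[OF assms(1) d1(1) assms(3,4)] and r1 = mod_reducedD[OF d1(2)]
  obtain c where c: "v = (\<Sum>j\<in>A. of_int (c j) * d1 j)"
    using assms(6)[folded inv1(2)] unfolding zspan_def by blast
  have "card (A - {p}) \<ge> 2" using assms(2) r1(2) by (simp add: assms(1) card_Diff_singleton)
  then have "A - {p} \<noteq> {}" by (metis card.empty not_numeral_le_zero)
  from reduced_euclid[OF d1(2) subset_refl this, of c] obtain d2 i g m where
    i: "i \<in> A - {p}" and d2: "conn A S d1 d2" "mod_reduced A S p d2" "\<forall>l. l \<notin> A - {p} \<longrightarrow> d2 l = d1 l"
    and g: "0 \<le> g" "(\<Sum>j\<in>A - {p}. of_int (c j) * d1 j) = of_int g * d2 i + of_int m * d1 p" by blast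
  note inv2 = conn_invariants[OF assms(1) d2(1) r1(3,7)] and r2 = mod_reducedD[OF d2(2)]
  define n where "n = m + c p"
  have d2p: "d2 p = d1 p" using d2(3) by simp
  have v2: "v = of_int g * d2 i + of_int n * d2 p"
    unfolding c using g(2) r1(1,2) by (simp add: sum.remove[of A p] n_def d2p algebra_simps)
  have cop: "gcd g n dvd 1"
  proof -
    obtain a b where ab: "g = gcd g n * a" "n = gcd g n * b" by (meson dvdE gcd_dvd1 gcd_dvd2)
    have "of_int a * d2 i + of_int b * d2 p \<in> zspan d A"
      unfolding inv1(2)[symmetric] inv2(2)[symmetric] using i r2(1,2) by (intro zspan_add zspan_mult zspan_base) auto
    moreover have "v = of_int (gcd g n) * (of_int a * d2 i + of_int b * d2 p)"
      unfolding v2 by (subst ab(1), subst (2) ab(2)) (simp add: algebra_simps)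
    ultimately show ?thesis by (rule prim)
  qed
  have "card (A - {p} - {i}) \<ge> 1" using \<open>card (A - {p}) \<ge> 2\<close> i assms(1) by (simp add: card_Diff_singleton)
  then have "A - {p} - {i} \<noteq> {}" by (metis card.empty not_one_le_zero)
  then obtain u where u: "u \<in> A" "u \<noteq> p" "u \<noteq> i" by blast
  have "(real (card A) + 1) * d2 u \<le> (real (card A) + 1) * d2 p" using r2(4)[OF u(1)] by (intro mult_left_mono) auto
  also have "\<dots> \<le> S" using d2(2) by (simp add: mod_reduced_def)
  finally have "(real (card A) + 1) * d2 u \<le> S" .
  from conn_reduced[OF assms(1) r2(3) u(1) r2(7) this] obtain d3 where
    d3: "conn A S d2 d3" "mod_reduced A S u d3" "d3 u = d2 u" "\<And>i. i \<in> A \<Longrightarrow> \<exists>m::int. d2 i = d3 i + of_int m * d2 u"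
    by metis
  obtain mi mp :: int where mm: "d2 i = d3 i + of_int mi * d2 u" "d2 p = d3 p + of_int mp * d2 u"
    using d3(4) i r2(2) by blast
  note r3 = mod_reducedD[OF d3(2)]
  define c3 where "c3 = (\<lambda>x. if x = i then g else n)"
  have sub: "{i, p} \<subseteq> A - {u}" using i r2(2) u by auto
  obtain d4 i' g' m' where d4: "i' \<in> {i, p}" "conn A S d3 d4" "mod_reduced A S u d4" "\<forall>l. l \<notin> {i, p} \<longrightarrow> d4 l = d3 l"
    "0 \<le> g'" "\<forall>j\<in>{i, p}. g' dvd c3 j"
    "(\<Sum>j\<in>{i, p}. of_int (c3 j) * d3 j) = of_int g' * d4 i' + of_int m' * d3 u"
    using reduced_euclid[OF d3(2) sub, of c3] by blast
  note r4 = mod_reducedD[OF d4(3)]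
  have ip: "i \<noteq> p" using i by auto
  have "g' dvd g" "g' dvd n" using d4(6) ip by (auto simp: c3_def)
  then have "g' dvd 1" using cop by (meson gcd_greatest dvd_trans)
  then have g': "g' = 1" using d4(5) by simp
  have d4u: "d4 u = d2 u" using d4(4) u d3(3) by auto
  define k where "k = g * mi + n * mp + m'"
  have "of_int g * d3 i + of_int n * d3 p = d4 i' + of_int m' * d4 u"
    using d4(7) ip g' d3(3) d4u by (simp add: c3_def)
  then have v4: "v = d4 i' + of_int k * d4 u"
    unfolding v2 mm k_def d4u by (simp add: algebra_simps)
  have i': "i' \<in> A" "i' \<noteq> u" using d4(1) sub by auto
  \<comment> \<open>Since \<open>d4 i'\<close> is at most \<open>d4 u\<close>, a negative \<open>k\<close> would make \<open>v\<close> nonpositive.\<close>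
  have "0 \<le> k"
  proof (rule ccontr)
    assume "\<not> 0 \<le> k"
    then have "of_int k * d4 u \<le> (- 1) * d4 u" using r4(5) by (intro mult_right_mono) auto
    then show False using v4 r4(4)[OF i'(1)] assms(7) by linarith
  qed
  then have k: "of_int k = real (nat k)" by simp
  have eq: "d4 i' + real (nat k) * d4 u = v" unfolding k[symmetric] using v4 by linarith
  have "d4 i' + real (nat k) * d4 u < \<delta>" unfolding eq by (rule assms(8))
  moreover have "0 < d4 i'" using r4(3) i'(1) by blast
  moreover have "sum d4 A \<le> real (card A) * \<delta>"
  proof -
    have "d4 x \<le> \<delta>" if "x \<in> A" for x
      using r4(4)[OF that] d4u r2(4)[OF u(1)] d2p d1(3) by linarith
    then show ?thesis using sum_bounded_above[of A d4 \<delta>] by simp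
  qed
  ultimately have "sum d4 A + real (nat k) * d4 u \<le> S" using assms(9) by (simp add: algebra_simps)
  from conn_add_mult[OF assms(1) r4(3) u(1) i'(1) _ this]
  have c5: "conn A S d4 (d4(i' := v))" using i'(2) unfolding eq by simp
  note inv5 = conn_invariants[OF assms(1) c5 r4(3,7)]
  have "(real (card A) + 1) * v \<le> (real (card A) + 1) * \<delta>" using assms(8) by (intro mult_left_mono) auto
  then have "(real (card A) + 1) * (d4(i' := v)) i' \<le> S" unfolding fun_upd_same using assms(9) by linarith
  from conn_reduced[OF assms(1) inv5(1) i'(1) inv5(4) this] obtain d6 where
    d6: "conn A S (d4(i' := v)) d6" "mod_reduced A S i' d6" "d6 i' = (d4(i' := v)) i'" by metis
  have "conn A S d d6" using d1(1) d2(1) d3(1) d4(2) c5 d6(1) by (meson conn_trans)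
  then show thesis using that d6 by simp
qed

text \<open>The basis is inserted one member at a time. Those that are already present, at the places \<open>\<sigma> ` M\<close>, are
  left alone; the coefficients of \<open>e k\<close> at the other places are coprime modulo them, so
  the Euclidean algorithm produces \<open>e k\<close> up to a combination of present members and of the modulus.\<close>

lemma conn_match_basis:
  assumes "mod_reduced A S q d" "finite C" "p \<in> C" "\<And>x. x \<in> C \<Longrightarrow> 0 < e x \<and> e x \<le> e p" "zindep e C"
    "zspan e C = zspan d A" "d q = e p" "finite M" "M \<subseteq> C"
  shows "\<exists>\<sigma> d'. conn A S d d' \<and> inj_on \<sigma> (insert p M) \<and> \<sigma> ` insert p M \<subseteq> A \<and> mod_reduced A S (\<sigma> p) d' \<and>
    (\<forall>x\<in>insert p M. d' (\<sigma> x) = e x)"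
  using assms(8,9)
proof (induction M rule: finite_induct)
  case empty
  show ?case
    by (rule exI[of _ "\<lambda>_. q"], rule exI[of _ d]) (use assms mod_reducedD[OF assms(1)] conn_refl in auto)
next
  case (insert k M')
  define M where "M = insert p M'"
  have MC: "M \<subseteq> C" "finite M" "k \<in> C" "p \<in> M" using insert assms(2,3) by (auto simp: M_def)
  obtain \<sigma> d' where IH: "conn A S d d'" "inj_on \<sigma> M" "\<sigma> ` M \<subseteq> A" "mod_reduced A S (\<sigma> p) d'" "\<forall>x\<in>M. d' (\<sigma> x) = e x"
    using insert.IH insert.prems unfolding M_def by auto
  show ?case
  proof (cases "k \<in> M")
    case True
    then have "insert p (insert k M') = M" by (auto simp: M_def)
    then show ?thesis using IH by auto
  next
    case False
    note r0 = mod_reducedD[OF assms(1)] and r = mod_reducedD[OF IH(4)]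
    note inv = conn_invariants[OF r(1) IH(1) r0(3,7)]
    have span: "zspan d' A = zspan e C" using inv(2) assms(6) by simp
    define v where "v = e p"
    have v: "d' (\<sigma> p) = v" using IH(5) MC(4) by (simp add: v_def)
    have "e k \<in> zspan d' A" unfolding span using zspan_base[OF assms(2) MC(3)] .
    then obtain c where c: "e k = (\<Sum>i\<in>A. of_int (c i) * d' i)" unfolding zspan_def by blast
    define J where "J = A - \<sigma> ` M"
    have sumM: "(\<Sum>i\<in>\<sigma> ` M. of_int (c i) * d' i) = (\<Sum>x\<in>M. of_int (c (\<sigma> x)) * e x)"
      using IH(2,5) by (simp add: sum.reindex)
    have ek: "e k = (\<Sum>i\<in>J. of_int (c i) * d' i) + (\<Sum>x\<in>M. of_int (c (\<sigma> x)) * e x)"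
      unfolding c J_def sumM[symmetric] using sum.subset_diff[OF IH(3) r(1), of "\<lambda>i. of_int (c i) * d' i"] by simp
    have prim: "h dvd 1" if "x \<in> zspan d' A" "e k = of_int h * x + (\<Sum>x\<in>M. of_int (b x) * e x)" for h x b
      by (rule zindep_primitive[OF assms(2,5) MC(3) _ _ that(2)]) (use MC False that(1) span in auto)
    \<comment> \<open>If all places were taken, \<open>e k\<close> would depend on the other members of the basis.\<close>
    have "J \<noteq> {}"
    proof
      assume "J = {}"
      then have "e k = of_int 0 * 0 + (\<Sum>x\<in>M. of_int (c (\<sigma> x)) * e x)" using ek by simp
      from prim[OF zspan_0 this] show False by simp
    qed
    moreover have "J \<subseteq> A - {\<sigma> p}" using MC(4) by (auto simp: J_def)
    ultimately obtain d2 i g m where i: "i \<in> J" and d2: "conn A S d' d2" "mod_reduced A S (\<sigma> p) d2" "\<forall>l. l \<notin> J \<longrightarrow> d2 l = d' l"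
      and g: "0 \<le> g" "(\<Sum>j\<in>J. of_int (c j) * d' j) = of_int g * d2 i + of_int m * d' (\<sigma> p)"
      using reduced_euclid[OF IH(4), of J c] by blast
    note r2 = mod_reducedD[OF d2(2)] and inv2 = conn_invariants[OF r(1) d2(1) r(3,7)]
    have iA: "i \<in> A" "i \<noteq> \<sigma> p" "i \<notin> \<sigma> ` M" using i MC(4) by (auto simp: J_def)
    have d2M: "d2 (\<sigma> x) = e x" if "x \<in> M" for x using that d2(3) IH(5) by (auto simp: J_def)
    define b where "b = (\<lambda>x. c (\<sigma> x) + (if x = p then m else 0))"
    have bsum: "(\<Sum>x\<in>M. of_int (b x) * e x) = (\<Sum>x\<in>M. of_int (c (\<sigma> x)) * e x) + of_int m * v"
    proof -
      have "(\<Sum>x\<in>M. of_int (if x = p then m else 0) * e x) = of_int m * v"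
        using MC by (simp add: v_def if_distrib[of "\<lambda>c. of_int c * _"] sum.delta' cong: if_cong)
      then show ?thesis by (simp add: b_def distrib_right sum.distrib)
    qed
    have "e k = of_int g * d2 i + (\<Sum>x\<in>M. of_int (b x) * e x)" unfolding bsum using ek g(2) v by simp
    moreover have "d2 i \<in> zspan d' A" unfolding inv2(2)[symmetric] by (rule zspan_base[OF r2(1) iA(1)])
    ultimately have "g dvd 1" using prim by blast
    then have "g = 1" using g(1) by simp
    then have d2i: "e k = d2 i + (\<Sum>x\<in>M. of_int (c (\<sigma> x)) * e x) + of_int m * v"
      using ek g(2) v by simp
    define d3 where "d3 = d2(i := residue (d2 (\<sigma> p)) (d2 i + (\<Sum>j\<in>\<sigma> ` M. of_int (c j) * d2 j)))"
    have d3: "conn A S d2 d3" "mod_reduced A S (\<sigma> p) d3"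
      unfolding d3_def using reduced_combination[OF d2(2) iA(1,2)] reduced_residue[OF d2(2) iA(2)] IH(3) iA(3) by auto
    have "(\<Sum>j\<in>\<sigma> ` M. of_int (c j) * d2 j) = (\<Sum>x\<in>M. of_int (c (\<sigma> x)) * e x)"
      using IH(2) d2M by (simp add: sum.reindex)
    then have "d2 i + (\<Sum>j\<in>\<sigma> ` M. of_int (c j) * d2 j) = e k + of_int (- m) * v" using d2i by simp
    then have "residue v (d2 i + (\<Sum>j\<in>\<sigma> ` M. of_int (c j) * d2 j)) = e k"
      using assms(4)[OF MC(3)] assms(4)[OF assms(3)] by (intro residue_eqI[of _ _ _ "- m"]) (auto simp: v_def)
    then have d3i: "d3 i = e k" using d2M[OF MC(4)] by (simp add: d3_def v_def)
    define \<tau> where "\<tau> = \<sigma>(k := i)"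
    have eq: "insert p (insert k M') = insert k M" by (auto simp: M_def)
    have \<tau>M: "\<tau> x = \<sigma> x" if "x \<in> M" for x using that False by (auto simp: \<tau>_def)
    have img: "\<tau> ` M = \<sigma> ` M" using \<tau>M by (rule image_cong[OF refl])
    have \<tau>k: "\<tau> k = i" by (simp add: \<tau>_def)
    have "inj_on \<tau> (insert k M)"
    proof -
      have "inj_on \<tau> M" using IH(2) \<tau>M by (metis inj_on_cong)
      moreover have "\<tau> k \<notin> \<tau> ` M" unfolding img \<tau>k by (rule iA(3))
      ultimately show ?thesis using False by simp
    qed
    moreover have "\<tau> ` insert k M \<subseteq> A" unfolding image_insert img \<tau>k using IH(3) iA(1) by simp
    moreover have "\<forall>x\<in>insert k M. d3 (\<tau> x) = e x"
    proof
      fix x assume x: "x \<in> insert k M"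
      show "d3 (\<tau> x) = e x"
      proof (cases "x = k")
        case True
        then show ?thesis using d3i by (simp add: \<tau>_def)
      next
        case False
        then have "x \<in> M" using x by simp
        then have "\<sigma> x \<noteq> i" using iA(3) by blast
        then show ?thesis using \<tau>M[OF \<open>x \<in> M\<close>] d2M[OF \<open>x \<in> M\<close>] by (simp add: d3_def)
      qed
    qed
    moreover have "conn A S d d3" using IH(1) d2(1) d3(1) by (meson conn_trans)
    ultimately show ?thesis unfolding eq using d3(2) \<tau>M[OF MC(4)] by metis
  qed
qed

text \<open>The result depends on the group, the number of members and the chosen basis only. The places not
  used by the basis are filled with \<open>e p\<close>, the representative of \<open>0\<close> modulo \<open>e p\<close>.\<close>

lemma conn_canonical:
  assumes "finite A" "3 \<le> card A" "\<forall>i\<in>A. 0 < d i" "sum d A \<le> S" "\<not> cyclic_reals (zspan d A)"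
    "finite C" "p \<in> C" "\<And>x. x \<in> C \<Longrightarrow> 0 < e x \<and> e x \<le> e p" "zindep e C" "zspan e C = zspan d A"
    "e p < \<delta>" "(real (card A) + 1) * \<delta> \<le> S"
  obtains d' where "conn A S d d'"
    "image_mset d' (mset_set A) = image_mset e (mset_set C) + replicate_mset (card A - card C) (e p)"
proof -
  have "h dvd 1" if "x \<in> zspan d A" "e p = of_int h * x" for h x
    by (rule zindep_primitive[OF assms(6,9,7), of "{}"]) (use that assms(10) in auto)
  moreover have "e p \<in> zspan d A" unfolding assms(10)[symmetric] by (rule zspan_base[OF assms(6,7)])
  moreover have "0 < e p" using assms(7,8) by blast
  ultimately obtain d1 q where d1: "conn A S d d1" "mod_reduced A S q d1" "d1 q = e p"
    using conn_insert_primitive[OF assms(1-5) _ _ assms(11,12)] by metis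
  note inv1 = conn_invariants[OF assms(1) d1(1) assms(3,4)]
  have "zspan e C = zspan d1 A" using assms(10) inv1(2) by simp
  from conn_match_basis[OF d1(2) assms(6-9) this d1(3) assms(6) subset_refl] obtain \<sigma> d2 where
    "conn A S d1 d2" "inj_on \<sigma> C" "\<sigma> ` C \<subseteq> A" "mod_reduced A S (\<sigma> p) d2" "\<forall>x\<in>C. d2 (\<sigma> x) = e x"
    unfolding insert_absorb[OF assms(7)] by blast
  note d2 = this
  note r1 = mod_reducedD[OF d1(2)] and r2 = mod_reducedD[OF d2(4)]
  note inv2 = conn_invariants[OF assms(1) d2(1) r1(3,7)]
  define v where "v = e p"
  have v: "d2 (\<sigma> p) = v" "0 < v" using d2(5) assms(7) r2(5) by (auto simp: v_def)
  have fill: "conn A S d2 (\<lambda>i. if i \<in> K then v else d2 i)" if "finite K" "K \<subseteq> A - \<sigma> ` C" for K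
    using that
  proof (induction K rule: finite_induct)
    case empty
    show ?case by (simp add: conn_refl)
  next
    case (insert k K)
    let ?d = "\<lambda>i. if i \<in> K then v else d2 i"
    have kA: "k \<in> A" "k \<notin> \<sigma> ` C" "\<sigma> p \<notin> K" "k \<noteq> \<sigma> p" using insert.prems assms(7) by auto
    have red: "mod_reduced A S (\<sigma> p) ?d"
      using d2(4) v kA(3) by (auto simp: mod_reduced_def)
    have "d2 k \<in> zspan e C"
      using zspan_base[OF assms(1) kA(1), of d2] inv2(2) inv1(2) assms(10) by simp
    then obtain c where c: "d2 k = (\<Sum>x\<in>C. of_int (c x) * e x)" unfolding zspan_def by blast
    define b where "b = (\<lambda>i. - c (inv_into C \<sigma> i))"
    have "(\<Sum>j\<in>\<sigma> ` C. of_int (b j) * ?d j) = (\<Sum>x\<in>C. of_int (b (\<sigma> x)) * ?d (\<sigma> x))"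
      using d2(2) by (simp add: sum.reindex)
    also have "\<dots> = (\<Sum>x\<in>C. - (of_int (c x) * e x))"
      using d2(2,5) insert.prems by (intro sum.cong) (auto simp: b_def)
    also have "\<dots> = - d2 k" by (simp add: c sum_negf)
    finally have "?d k + (\<Sum>j\<in>\<sigma> ` C. of_int (b j) * ?d j) = 0" using insert.hyps by simp
    moreover have "conn A S ?d (?d(k := residue (?d (\<sigma> p)) (?d k + (\<Sum>j\<in>\<sigma> ` C. of_int (b j) * ?d j))))"
      using d2(3) kA by (intro reduced_combination[OF red]) auto
    ultimately have "conn A S ?d (?d(k := v))" using residue_0[OF v(2)] kA(3) v(1) by simp
    moreover have "?d(k := v) = (\<lambda>i. if i \<in> insert k K then v else d2 i)" by (auto simp: fun_eq_iff)
    moreover have "conn A S d2 ?d" using insert.IH insert.prems by blast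
    ultimately show ?case by (metis conn_trans)
  qed
  define J where "J = A - \<sigma> ` C"
  define d3 where "d3 = (\<lambda>i. if i \<in> J then v else d2 i)"
  have c3: "conn A S d2 d3" unfolding d3_def J_def using assms(1) by (intro fill) auto
  have "mset_set A = mset_set (\<sigma> ` C) + mset_set J"
    using mset_set_Union[of "\<sigma> ` C" J] assms(1,6) d2(3) by (simp add: J_def Un_absorb1)
  then have "image_mset d3 (mset_set A) = image_mset d3 (mset_set (\<sigma> ` C)) + image_mset d3 (mset_set J)" by simp
  also have "image_mset d3 (mset_set (\<sigma> ` C)) = image_mset (\<lambda>x. d3 (\<sigma> x)) (mset_set C)"
    by (simp add: image_mset_mset_set[OF d2(2), symmetric] multiset.map_comp o_def)
  also have "\<dots> = image_mset e (mset_set C)"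
    using d2(5) assms(6) by (intro image_mset_cong) (auto simp: d3_def J_def)
  also have "image_mset d3 (mset_set J) = image_mset (\<lambda>_. v) (mset_set J)"
    using assms(1) by (intro image_mset_cong) (auto simp: d3_def J_def)
  also have "\<dots> = replicate_mset (card J) v" by (simp add: image_mset_const_eq)
  also have "card J = card A - card C"
    using card_Diff_subset[OF _ d2(3)] card_image[OF d2(2)] assms(6) by (simp add: J_def)
  finally have "image_mset d3 (mset_set A) = image_mset e (mset_set C) + replicate_mset (card A - card C) (e p)"
    by (simp add: v_def)
  moreover have "conn A S d d3" using d1(1) d2(1) c3 by (meson conn_trans)
  ultimately show thesis using that by blast
qed


section \<open>Families with two members\<close>

definition pair_cone :: "real \<Rightarrow> real \<Rightarrow> real set" where
  "pair_cone x y = {of_int p * x + of_int q * y | p q :: int. 0 \<le> p \<and> 0 \<le> q}"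

lemma pair_coneI: "0 \<le> p \<Longrightarrow> 0 \<le> q \<Longrightarrow> of_int p * x + of_int q * y \<in> pair_cone x y"
  unfolding pair_cone_def by blast

lemma pair_cone_diff: "pair_cone x y \<subseteq> pair_cone (x - y) y" "pair_cone x y \<subseteq> pair_cone x (y - x)"
proof -
  show "pair_cone x y \<subseteq> pair_cone (x - y) y"
  proof
    fix w assume "w \<in> pair_cone x y"
    then obtain p q :: int where "w = of_int p * x + of_int q * y" "0 \<le> p" "0 \<le> q" unfolding pair_cone_def by blast
    then show "w \<in> pair_cone (x - y) y" using pair_coneI[of p "p + q" "x - y" y] by (simp add: algebra_simps)
  qed
  show "pair_cone x y \<subseteq> pair_cone x (y - x)"
  proof
    fix w assume "w \<in> pair_cone x y"
    then obtain p q :: int where "w = of_int p * x + of_int q * y" "0 \<le> p" "0 \<le> q" unfolding pair_cone_def by blast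
    then show "w \<in> pair_cone x (y - x)" using pair_coneI[of "p + q" q x "y - x"] by (simp add: algebra_simps)
  qed
qed

lemma noncyclic_pair_neq:
  assumes "\<not> cyclic_reals (zspan d {i, j})"
  shows "d i \<noteq> d j"
proof
  assume "d i = d j"
  then have "zspan d {i, j} = range (\<lambda>m::int. of_int m * d j)" by (intro zspan_const[of _ i]) auto
  then show False using assms unfolding cyclic_reals_def by blast
qed

text \<open>If \<open>d j < d i\<close>, passing to \<open>d i - d j\<close> turns the coefficients \<open>(p, q)\<close> of a positive combination into \<open>(p, p + q)\<close>. Since the
  combination is positive, this lowers the sum of the absolute values unless both coefficients
  become nonnegative.\<close>

lemma mixed_sign_decrease:
  fixes p q :: int and x y :: real
  assumes "0 < x" "0 < y" "0 < of_int p * x + of_int (p + q) * y" "\<not> (0 \<le> p \<and> 0 \<le> q)"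
  shows "nat (if 0 \<le> p \<and> 0 \<le> p + q then 0 else \<bar>p\<bar> + \<bar>p + q\<bar>) < nat (\<bar>p\<bar> + \<bar>q\<bar>)"
proof (cases "0 < p")
  case True
  then show ?thesis using assms(4) by auto
next
  case False
  then have "of_int p * x \<le> 0" using assms(1) by (simp add: mult_nonpos_nonneg)
  then have "0 < of_int (p + q) * y" using assms(3) by linarith
  then have "0 < p + q" using assms(2) by (simp only: zero_less_mult_iff of_int_0_less_iff of_int_less_0_iff) auto
  then show ?thesis using False assms(4) by auto
qed

text \<open>The Euclidean algorithm enlarges the cone of nonnegative combinations until it contains a
  given positive integer combination.\<close>

lemma conn_pair_cone:
  assumes "i \<noteq> j" "\<forall>l\<in>{i, j}. 0 < d l" "sum d {i, j} \<le> S" "\<not> cyclic_reals (zspan d {i, j})"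
    "0 < of_int p * d i + of_int q * d j"
  shows "\<exists>d'. conn {i, j} S d d' \<and> pair_cone (d i) (d j) \<subseteq> pair_cone (d' i) (d' j) \<and>
    of_int p * d i + of_int q * d j \<in> pair_cone (d' i) (d' j)"
  using assms(2-5)
proof (induction "nat (if 0 \<le> p \<and> 0 \<le> q then 0 else \<bar>p\<bar> + \<bar>q\<bar>)" arbitrary: d p q rule: less_induct)
  case less
  have fin: "finite {i, j}" by simp
  show ?case
  proof (cases "0 \<le> p \<and> 0 \<le> q")
    case True
    then show ?thesis using pair_coneI conn_refl by blast
  next
    case False
    have pos: "0 < d i" "0 < d j" using less.prems(1) by auto
    consider "d j < d i" | "d i < d j" using noncyclic_pair_neq[OF less.prems(3)] by linarith
    then show ?thesis
    proof cases
      case 1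
      define e where "e = d(i := d i - d j)"
      have e: "e i = d i - d j" "e j = d j" using assms(1) by (auto simp: e_def)
      have c: "conn {i, j} S d e" unfolding e_def using 1 less.prems assms(1) by (intro conn_sub fin) auto
      note inv = conn_invariants[OF fin c less.prems(1,2)]
      have w: "of_int p * d i + of_int q * d j = of_int p * e i + of_int (p + q) * e j"
        unfolding e by (simp add: algebra_simps)
      have "nat (if 0 \<le> p \<and> 0 \<le> p + q then 0 else \<bar>p\<bar> + \<bar>p + q\<bar>) < nat (\<bar>p\<bar> + \<bar>q\<bar>)"
        using less.prems(4) False 1 pos unfolding w by (intro mixed_sign_decrease[of "e i" "e j"]) (auto simp: e)
      also have "\<dots> = nat (if 0 \<le> p \<and> 0 \<le> q then 0 else \<bar>p\<bar> + \<bar>q\<bar>)" using False by auto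
      finally obtain d' where "conn {i, j} S e d'" "pair_cone (e i) (e j) \<subseteq> pair_cone (d' i) (d' j)"
        "of_int p * e i + of_int (p + q) * e j \<in> pair_cone (d' i) (d' j)"
        using less.hyps[of p "p + q" e] inv less.prems(3,4) w by auto
      then show ?thesis
        using c pair_cone_diff(1)[of "d i" "d j"] unfolding w e by (meson conn_trans order_trans)
    next
      case 2
      define e where "e = d(j := d j - d i)"
      have e: "e i = d i" "e j = d j - d i" using assms(1) by (auto simp: e_def)
      have c: "conn {i, j} S d e" unfolding e_def using 2 less.prems assms(1) by (intro conn_sub fin) auto
      note inv = conn_invariants[OF fin c less.prems(1,2)]
      have w: "of_int p * d i + of_int q * d j = of_int (p + q) * e i + of_int q * e j"
        unfolding e by (simp add: algebra_simps)
      have "nat (if 0 \<le> q \<and> 0 \<le> q + p then 0 else \<bar>q\<bar> + \<bar>q + p\<bar>) < nat (\<bar>q\<bar> + \<bar>p\<bar>)"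
        using less.prems(4) False 2 pos unfolding w
        by (intro mixed_sign_decrease[of "e j" "e i"]) (auto simp: e add.commute)
      then have "nat (if 0 \<le> p + q \<and> 0 \<le> q then 0 else \<bar>p + q\<bar> + \<bar>q\<bar>) < nat (\<bar>p\<bar> + \<bar>q\<bar>)"
        unfolding add.commute[of q p] add.commute[of "\<bar>q\<bar>"] conj_commute[of "0 \<le> q"] .
      also have "\<dots> = nat (if 0 \<le> p \<and> 0 \<le> q then 0 else \<bar>p\<bar> + \<bar>q\<bar>)" using False by auto
      finally obtain d' where "conn {i, j} S e d'" "pair_cone (e i) (e j) \<subseteq> pair_cone (d' i) (d' j)"
        "of_int (p + q) * e i + of_int q * e j \<in> pair_cone (d' i) (d' j)"
        using less.hyps[of "p + q" q e] inv less.prems(3,4) w by auto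
      then show ?thesis
        using c pair_cone_diff(2)[of "d i" "d j"] unfolding w e by (meson conn_trans order_trans)
    qed
  qed
qed

lemma crossing_rows:
  fixes p q r s :: int
  assumes "0 \<le> q" "0 \<le> r" "r < p" "q < s" "\<bar>p * s - q * r\<bar> = 1"
  shows "p = 1" "q = 0" "r = 0" "s = 1"
proof -
  have "(r + 1) * (q + 1) \<le> p * s" using assms by (intro mult_mono) auto
  then have "r + q + 1 \<le> p * s - q * r" by (simp add: algebra_simps)
  then have "r + q + 1 \<le> 1" using assms(5) by linarith
  then show "q = 0" "r = 0" using assms by auto
  then have "\<bar>p * s\<bar> = 1" "0 < p * s" using assms by auto
  then have "p * s = 1" by linarith
  then show "p = 1" "s = 1" using assms by (auto simp: zmult_eq_1_iff)
qed

lemma subtract_dominated_row: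
  assumes "k \<noteq> l" "\<forall>i\<in>{k, l}. 0 < d i" "sum d {k, l} \<le> S" "0 < x" "0 < y"
    "r \<le> p" "s \<le> q" "0 \<le> r" "0 \<le> s" "\<bar>p * s - q * r\<bar> = 1"
    "d k = of_int p * x + of_int q * y" "d l = of_int r * x + of_int s * y"
  obtains e where "conn {k, l} S d e" "\<forall>i\<in>{k, l}. 0 < e i" "sum e {k, l} \<le> S"
    "e k = of_int (p - r) * x + of_int (q - s) * y" "e l = d l" "r \<noteq> 0 \<or> s \<noteq> 0"
proof -
  define e where "e = d(k := d k - d l)"
  have e: "e k = of_int (p - r) * x + of_int (q - s) * y" "e l = d l"
    using assms(1,11,12) by (auto simp: e_def algebra_simps)
  have "p - r \<noteq> 0 \<or> q - s \<noteq> 0" using assms(10) by auto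
  then have "of_int (p - r) * x \<noteq> 0 \<or> of_int (q - s) * y \<noteq> 0" using assms(4,5) by auto
  moreover have "0 \<le> of_int (p - r) * x" "0 \<le> of_int (q - s) * y" using assms(4-7) by auto
  ultimately have "0 < e k" unfolding e by linarith
  then have c: "conn {k, l} S d e"
    unfolding e_def using assms(1-3) by (intro conn_sub) (auto simp: e_def)
  have "0 < d l" using assms(2) by simp
  then have "r \<noteq> 0 \<or> s \<noteq> 0" using assms(12) by auto
  then show thesis using that[OF c _ _ e] conn_invariants(1,4)[OF _ c assms(2,3)] by simp
qed

text \<open>For a nonnegative matrix of determinant \<open>1\<close> or \<open>-1\<close>, one of the rows dominates the other one, and
  may be reduced, unless the matrix is a permutation matrix.\<close>

lemma conn_pair_unimodular:
  assumes "k \<noteq> l" "\<forall>i\<in>{k, l}. 0 < d i" "sum d {k, l} \<le> S" "0 < x" "0 < y"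
    "0 \<le> p" "0 \<le> q" "0 \<le> r" "0 \<le> s" "\<bar>p * s - q * r\<bar> = 1"
    "d k = of_int p * x + of_int q * y" "d l = of_int r * x + of_int s * y"
  shows "\<exists>d'. conn {k, l} S d d' \<and> (d' k = x \<and> d' l = y \<or> d' k = y \<and> d' l = x)"
  using assms(2,3,6-)
proof (induction "nat (p + q + r + s)" arbitrary: d p q r s rule: less_induct)
  case less
  consider "r \<le> p \<and> s \<le> q" | "p \<le> r \<and> q \<le> s" | "r < p \<and> q < s" | "p < r \<and> s < q" by linarith
  then show ?case
  proof cases
    case 1
    then obtain e where e: "conn {k, l} S d e" "\<forall>i\<in>{k, l}. 0 < e i" "sum e {k, l} \<le> S"
        "e k = of_int (p - r) * x + of_int (q - s) * y" "e l = d l" "r \<noteq> 0 \<or> s \<noteq> 0"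
      using subtract_dominated_row[OF assms(1) less.prems(1,2) assms(4,5)] less.prems by metis
    have "nat (p - r + (q - s) + r + s) < nat (p + q + r + s)" using less.prems e(6) by linarith
    moreover have "\<bar>(p - r) * s - (q - s) * r\<bar> = 1" using less.prems(7) by (simp add: algebra_simps)
    ultimately obtain d' where "conn {k, l} S e d'" "d' k = x \<and> d' l = y \<or> d' k = y \<and> d' l = x"
      using less.hyps[of "p - r" "q - s" r s e] e 1 less.prems by auto
    then show ?thesis using conn_trans[OF e(1)] by (intro exI[of _ d']) blast
  next
    case 2
    have "\<bar>r * q - s * p\<bar> = 1" using less.prems(7) by (simp add: abs_minus_commute mult.commute)
    then obtain e where e: "conn {k, l} S d e" "\<forall>i\<in>{k, l}. 0 < e i" "sum e {k, l} \<le> S"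
        "e l = of_int (r - p) * x + of_int (s - q) * y" "e k = d k" "p \<noteq> 0 \<or> q \<noteq> 0"
      using 2 subtract_dominated_row[OF assms(1)[symmetric], of d S x y p r q s] less.prems assms(4,5)
      unfolding insert_commute[of l k] by metis
    have "nat (p + q + (r - p) + (s - q)) < nat (p + q + r + s)" using less.prems e(6) by linarith
    moreover have "\<bar>p * (s - q) - q * (r - p)\<bar> = 1" using less.prems(7) by (simp add: algebra_simps)
    ultimately obtain d' where "conn {k, l} S e d'" "d' k = x \<and> d' l = y \<or> d' k = y \<and> d' l = x"
      using less.hyps[of p q "r - p" "s - q" e] e 2 less.prems by auto
    then show ?thesis using conn_trans[OF e(1)] by (intro exI[of _ d']) blast
  next
    case 3
    then have "p = 1" "q = 0" "r = 0" "s = 1" using crossing_rows[of q r p s] less.prems by auto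
    then show ?thesis using less.prems conn_refl by (intro exI[of _ d]) auto
  next
    case 4
    have "\<bar>q * r - p * s\<bar> = 1" using less.prems(7) by linarith
    then have "q = 1" "p = 0" "s = 0" "r = 1" using 4 crossing_rows[of p s q r] less.prems by auto
    then show ?thesis using less.prems conn_refl by (intro exI[of _ d]) auto
  qed
qed

lemma zrank_noncyclic:
  assumes "finite A" "\<not> cyclic_reals (zspan d A)"
  shows "2 \<le> zrank (zspan d A)"
proof (rule ccontr)
  assume "\<not> 2 \<le> zrank (zspan d A)"
  obtain B where B: "finite B" "card B = zrank (zspan d A)" "zspan (\<lambda>x. x) B = zspan d A"
    using zrank_attained[OF assms(1) refl] by metis
  then have "card B = 0 \<or> card B = 1" using \<open>\<not> 2 \<le> zrank (zspan d A)\<close> by linarith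
  then have "B = {} \<or> (\<exists>x. B = {x})" using B(1) by (auto simp: card_1_singleton_iff)
  then have "cyclic_reals (zspan (\<lambda>x. x) B)"
  proof
    assume "B = {}"
    then have "zspan (\<lambda>x. x) B = range (\<lambda>m::int. of_int m * 0)" by (auto simp: zspan_def)
    then show ?thesis unfolding cyclic_reals_def by blast
  next
    assume "\<exists>x. B = {x}"
    then obtain x where "B = {x}" by blast
    then have "zspan (\<lambda>x. x) B = range (\<lambda>m::int. of_int m * x)" by (intro zspan_const[of _ x]) auto
    then show ?thesis unfolding cyclic_reals_def by blast
  qed
  then show False using B(3) assms(2) by simp
qed

lemma zspan_pair:
  assumes "i \<noteq> j" "x \<in> zspan d {i, j}"
  obtains p q :: int where "x = of_int p * d i + of_int q * d j"
  using assms by (auto simp: zspan_def)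

lemma zindep_pair_eq:
  assumes "i \<noteq> j" "zindep d {i, j}" "of_int p * d i + of_int q * d j = of_int r * d i + of_int s * d j"
  shows "p = r" "q = s"
proof -
  let ?c = "\<lambda>l. if l = i then p - r else q - s"
  have "(\<Sum>l\<in>{i, j}. of_int (?c l) * d l) = 0" using assms(1,3) by (simp add: algebra_simps)
  then have "\<forall>l\<in>{i, j}. ?c l = 0" using assms(2)[unfolded zindep_def, THEN spec[of _ ?c]] by blast
  then show "p = r" "q = s" using assms(1) by auto
qed

text \<open>Since \<open>d\<close> can be shrunk until \<open>f k\<close> and \<open>f l\<close> are nonnegative combinations of its members, the matrix that
  expresses \<open>f\<close> in terms of \<open>d\<close> becomes nonnegative; it is invertible because both pairs
  are bases of the same group.\<close>

lemma conn_pair: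
  assumes "i \<noteq> j" "k \<noteq> l" "\<forall>m\<in>{i, j}. 0 < d m" "\<forall>m\<in>{k, l}. 0 < f m" "sum d {i, j} \<le> S" "sum f {k, l} \<le> S"
    "zspan d {i, j} = zspan f {k, l}" "\<not> cyclic_reals (zspan d {i, j})"
  shows "\<exists>d' f'. conn {i, j} S d d' \<and> conn {k, l} S f f' \<and>
    image_mset d' (mset_set {i, j}) = image_mset f' (mset_set {k, l})"
proof -
  have fin: "finite {i, j}" "finite {k, l}" by auto
  have "f k \<in> zspan d {i, j}" unfolding assms(7) by (rule zspan_base) auto
  then obtain p q :: int where pq: "f k = of_int p * d i + of_int q * d j" using zspan_pair[OF assms(1)] by metis
  obtain d1 where d1: "conn {i, j} S d d1" "f k \<in> pair_cone (d1 i) (d1 j)"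
    using conn_pair_cone[OF assms(1,3,5,8), of p q] assms(4) unfolding pq[symmetric] by auto
  note inv1 = conn_invariants[OF fin(1) d1(1) assms(3,5)]
  have "f l \<in> zspan d1 {i, j}" unfolding inv1(2) assms(7) by (rule zspan_base) auto
  then obtain r s :: int where rs: "f l = of_int r * d1 i + of_int s * d1 j" using zspan_pair[OF assms(1)] by metis
  have nc: "\<not> cyclic_reals (zspan d1 {i, j})" using assms(8) inv1(2) by simp
  obtain d2 where d2: "conn {i, j} S d1 d2" "pair_cone (d1 i) (d1 j) \<subseteq> pair_cone (d2 i) (d2 j)" "f l \<in> pair_cone (d2 i) (d2 j)"
    using conn_pair_cone[OF assms(1) inv1(1,4) nc, of r s] assms(4) unfolding rs[symmetric] by auto
  note inv2 = conn_invariants[OF fin(1) d2(1) inv1(1,4)]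
  have span: "zspan d2 {i, j} = zspan f {k, l}" using inv1(2) inv2(2) assms(7) by simp
  have "zrank (zspan d2 {i, j}) \<le> 2" using zrank_le[OF fin(1) refl, of d2] assms(1) by simp
  moreover have "2 \<le> zrank (zspan d2 {i, j})" using zrank_noncyclic[OF fin(1)] nc inv2(2) by metis
  ultimately have ind: "zindep d2 {i, j}" using assms(1) by (intro zindep_of_minimal[OF fin(1) refl]) auto
  obtain p q :: int where fk: "f k = of_int p * d2 i + of_int q * d2 j" "0 \<le> p" "0 \<le> q"
    using d1(2) d2(2) unfolding pair_cone_def by blast
  obtain r s :: int where fl: "f l = of_int r * d2 i + of_int s * d2 j" "0 \<le> r" "0 \<le> s"
    using d2(3) unfolding pair_cone_def by blast
  have "d2 i \<in> zspan f {k, l}" "d2 j \<in> zspan f {k, l}" unfolding span[symmetric] by (auto intro: zspan_base)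
  then obtain a b a' b' :: int where ab: "d2 i = of_int a * f k + of_int b * f l" "d2 j = of_int a' * f k + of_int b' * f l"
    using zspan_pair[OF assms(2)] by metis
  have "of_int 1 * d2 i + of_int 0 * d2 j = of_int (a * p + b * r) * d2 i + of_int (a * q + b * s) * d2 j"
    using ab(1) fk(1) fl(1) by (simp add: algebra_simps)
  from zindep_pair_eq[OF assms(1) ind this] have e1: "1 = a * p + b * r" "0 = a * q + b * s" .
  have "of_int 0 * d2 i + of_int 1 * d2 j = of_int (a' * p + b' * r) * d2 i + of_int (a' * q + b' * s) * d2 j"
    using ab(2) fk(1) fl(1) by (simp add: algebra_simps)
  from zindep_pair_eq[OF assms(1) ind this] have e2: "0 = a' * p + b' * r" "1 = a' * q + b' * s" .
  have "(a * b' - b * a') * (p * s - q * r) = (a * p + b * r) * (a' * q + b' * s) - (a * q + b * s) * (a' * p + b' * r)"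
    by (simp add: algebra_simps)
  then have "(a * b' - b * a') * (p * s - q * r) = 1" by (simp flip: e1 e2)
  then have "\<bar>p * s - q * r\<bar> = 1" by (auto simp: zmult_eq_1_iff)
  from conn_pair_unimodular[OF assms(2,4,6) _ _ fk(2,3) fl(2,3) this fk(1) fl(1)] inv2(1)
  obtain f' where f': "conn {k, l} S f f'" "f' k = d2 i \<and> f' l = d2 j \<or> f' k = d2 j \<and> f' l = d2 i" by auto
  have "image_mset d2 (mset_set {i, j}) = image_mset f' (mset_set {k, l})"
    using f'(2) assms(1,2) by auto
  then show ?thesis using f'(1) conn_trans[OF d1(1) d2(1)] by blast
qed

section \<open>Families generating the same group\<close>

text \<open>A generating set of minimal size is a basis, and it remains one under moves. Applied to the absolute values of its
  members, the Euclidean algorithm makes them small. The sum is not restricted here, as the basis is auxiliary.\<close>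

lemma low_basis:
  assumes "finite A" "\<not> cyclic_reals (zspan d A)" "0 < \<delta>"
  obtains C :: "real set" and e p where "finite C" "p \<in> C" "\<And>x. x \<in> C \<Longrightarrow> 0 < e x \<and> e x \<le> e p"
    "zindep e C" "zspan e C = zspan d A" "e p < \<delta>"
proof -
  obtain C where C: "finite C" "card C = zrank (zspan d A)" "zspan (\<lambda>x. x) C = zspan d A"
    using zrank_attained[OF assms(1) refl] by metis
  have ind: "zindep (\<lambda>x. x) C" by (rule zindep_of_minimal[OF C(1,3,2)])
  have nz: "x \<noteq> 0" if "x \<in> C" for x
  proof
    assume "x = 0"
    let ?c = "\<lambda>y::real. if y = 0 then 1 else 0 :: int"
    have "(\<Sum>y\<in>C. of_int (?c y) * y) = 0" by (intro sum.neutral) auto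
    then have "\<forall>y\<in>C. ?c y = 0" using ind[unfolded zindep_def, THEN spec[of _ ?c]] by blast
    then show False using that \<open>x = 0\<close> by auto
  qed
  have abs: "zspan abs C = zspan d A"
    unfolding C(3)[symmetric]
  proof
    have "\<bar>x\<bar> \<in> zspan (\<lambda>x. x) C" "x \<in> zspan abs C" if "x \<in> C" for x
      using zspan_base[OF C(1) that, of "\<lambda>x. x"] zspan_base[OF C(1) that, of abs]
        zspan_minus[of x "\<lambda>x. x" C] zspan_minus[of "\<bar>x\<bar>" abs C] by (auto simp: abs_if split: if_splits)
    then show "zspan abs C \<subseteq> zspan (\<lambda>x. x) C" "zspan (\<lambda>x. x) C \<subseteq> zspan abs C"
      by (auto intro!: zspan_least[OF C(1)])
  qed
  define S where "S = max (sum abs C) ((real (card C) + 1) * \<delta>)"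
  have "C \<noteq> {}" using zrank_noncyclic[OF assms(1,2)] C(2) by auto
  moreover have pos: "\<forall>x\<in>C. 0 < \<bar>x\<bar>" using nz by auto
  moreover have "sum abs C \<le> S" "(real (card C) + 1) * \<delta> \<le> S" by (auto simp: S_def)
  ultimately obtain e p where e: "conn C S abs e" "mod_reduced C S p e" "e p < \<delta>"
    using conn_low[OF C(1), of abs S \<delta>] assms(2,3) abs by metis
  note inv = conn_invariants[OF C(1) e(1) pos \<open>sum abs C \<le> S\<close>]
  have span: "zspan e C = zspan d A" using inv(2) abs by simp
  show thesis
    by (rule that[OF C(1) mod_reducedD(2)[OF e(2)] _ zindep_of_minimal[OF C(1) span C(2)] span e(3)])
      (use mod_reducedD(3,4)[OF e(2)] in auto)
qed

text \<open>For \<open>l = card A \<ge> 3\<close>, both families reach the same normal form, since it depends on the group and on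
  \<open>l\<close> only. The threshold \<open>\<delta> = S / (l + 1)\<close> makes families with members below \<open>\<delta>\<close> satisfy the size
  condition of \<^const>\<open>mod_reduced\<close>.\<close>

theorem conn_common_form:
  assumes "finite A" "finite B" "card A = card B" "\<forall>i\<in>A. 0 < d i" "\<forall>i\<in>B. 0 < f i"
    "zspan d A = zspan f B" "sum d A \<le> S" "sum f B \<le> S"
  shows "\<exists>d' f'. conn A S d d' \<and> conn B S f f' \<and> image_mset d' (mset_set A) = image_mset f' (mset_set B)"
proof (cases "A = {}")
  case True
  then have "B = {}" using assms(1-3) by auto
  then show ?thesis using True conn_refl by (intro exI[of _ d] exI[of _ f]) auto
next
  case ne: False
  then obtain a where a: "a \<in> A" by blast
  show ?thesis
  proof (cases "cyclic_reals (zspan d A)")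
    case True
    then obtain y where y: "zspan d A = range (\<lambda>m::int. of_int m * y)" unfolding cyclic_reals_def by blast
    define x where "x = \<bar>y\<bar>"
    have "y \<noteq> 0" using zspan_base[OF assms(1) a, of d] assms(4) a unfolding y by force
    then have x: "0 < x" by (simp add: x_def)
    have "range (\<lambda>m::int. of_int m * y) = range (\<lambda>m::int. of_int m * x)"
    proof -
      have sub: "range (\<lambda>m::int. of_int m * z) \<subseteq> range (\<lambda>m::int. of_int m * (- z))" for z :: real
      proof
        fix w assume "w \<in> range (\<lambda>m::int. of_int m * z)"
        then obtain m :: int where "w = of_int m * z" by blast
        then show "w \<in> range (\<lambda>m::int. of_int m * (- z))" by (intro range_eqI[of _ _ "- m"]) simp
      qed
      have "range (\<lambda>m::int. of_int m * y) = range (\<lambda>m::int. of_int m * (- y))"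
        using sub[of y] sub[of "- y"] unfolding minus_minus by (rule equalityI)
      then show ?thesis unfolding x_def abs_if by (cases "y < 0") simp_all
    qed
    then have y: "zspan d A = range (\<lambda>m::int. of_int m * x)" "zspan f B = range (\<lambda>m::int. of_int m * x)"
      using y assms(6) by auto
    obtain d' where d': "conn A S d d'" "\<And>i. i \<in> A \<Longrightarrow> d' i = x"
      using conn_cyclic[OF assms(1,4,7) y(1) x] by metis
    obtain f' where f': "conn B S f f'" "\<And>i. i \<in> B \<Longrightarrow> f' i = x"
      using conn_cyclic[OF assms(2,5,8) y(2) x] by metis
    have "image_mset d' (mset_set A) = image_mset (\<lambda>_. x) (mset_set A)"
      using d'(2) assms(1) by (intro image_mset_cong) auto
    moreover have "image_mset f' (mset_set B) = image_mset (\<lambda>_. x) (mset_set B)"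
      using f'(2) assms(2) by (intro image_mset_cong) auto
    ultimately have "image_mset d' (mset_set A) = image_mset f' (mset_set B)"
      by (simp add: image_mset_const_eq assms(3))
    then show ?thesis using d'(1) f'(1) by blast
  next
    case False
    have "2 \<le> card A" using zrank_noncyclic[OF assms(1) False] zrank_le[OF assms(1) refl, of d] by linarith
    then consider "card A = 2" | "3 \<le> card A" by linarith
    then show ?thesis
    proof cases
      case 1
      then obtain i j where "A = {i, j}" "i \<noteq> j" by (meson card_2_iff)
      moreover obtain k l where "B = {k, l}" "k \<noteq> l" using 1 assms(3) by (metis card_2_iff)
      ultimately show ?thesis using conn_pair[of i j k l d f S] assms False by blast
    next
      case 2
      define \<delta> where "\<delta> = S / (real (card A) + 1)"
      have "0 < sum d A" using assms(1,4) ne by (intro sum_pos) auto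
      then have "0 < \<delta>" using assms(7) by (simp add: \<delta>_def add_nonneg_pos)
      moreover have S: "(real (card A) + 1) * \<delta> \<le> S" by (simp add: \<delta>_def)
      ultimately obtain C :: "real set" and e p where e: "finite C" "p \<in> C" "\<And>x. x \<in> C \<Longrightarrow> 0 < e x \<and> e x \<le> e p"
          "zindep e C" "zspan e C = zspan d A" "e p < \<delta>"
        using low_basis[OF assms(1) False] by metis
      obtain d' where d': "conn A S d d'"
        "image_mset d' (mset_set A) = image_mset e (mset_set C) + replicate_mset (card A - card C) (e p)"
        using conn_canonical[OF assms(1) 2 assms(4,7) False e(1,2,3,4,5,6) S] by metis
      obtain f' where f': "conn B S f f'"
        "image_mset f' (mset_set B) = image_mset e (mset_set C) + replicate_mset (card B - card C) (e p)"
        using conn_canonical[OF assms(2) _ assms(5,8) _ e(1,2,3,4) _ e(6)] 2 False e(5) S assms(3,6) by metis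
      show ?thesis using d' f' assms(3) by (intro exI[of _ d'] exI[of _ f']) auto
    qed
  qed
qed


section \<open>From moves to tori\<close>

definition shifted :: "real \<Rightarrow> ('n \<Rightarrow> real) \<Rightarrow> real ^ 'n" where
  "shifted \<mu> d = (\<chi> i. \<mu> + d i)"

lemma total_area_shifted:
  fixes d :: "'n::finite \<Rightarrow> real"
  assumes "\<And>i. i \<notin> A \<Longrightarrow> d i = 0"
  shows "total_area (shifted \<mu> d) = real CARD('n) * \<mu> + sum d A"
proof -
  have "sum d UNIV = sum d A" by (rule sum.mono_neutral_right) (use assms in auto)
  then show ?thesis by (simp add: total_area_def shifted_def sum.distrib)
qed

text \<open>The index \<open>i\<close> has the minimal area \<open>\<mu>\<close>. The shear exchanges \<open>i\<close> and \<open>j\<close> and replaces \<open>d k\<close> by \<open>d k + d j\<close>; then a rotation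
  exchanges \<open>i\<close> and \<open>j\<close> back.\<close>

lemma add_tori:
  fixes d :: "'n::finite \<Rightarrow> real"
  assumes "0 < \<mu>" "\<And>i. 0 \<le> d i" "d i = 0" "0 < d j" "0 < d k" "j \<noteq> k"
  shows "isotopic_tori (total_area (shifted \<mu> d) + d j + \<mu>) (shifted \<mu> d) (shifted \<mu> (d(k := d k + d j)))"
proof -
  let ?a = "shifted \<mu> d" and ?a' = "shifted \<mu> (d(k := d k + d j))"
  have distinct: "i \<noteq> j" "i \<noteq> k" using assms by auto
  have pos: "0 < ?a $ m" for m using assms(1) assms(2)[of m] by (simp add: shifted_def)
  define a1 where "a1 = (\<chi> m. if m = i then ?a $ j else if m = j then ?a $ i
    else if m = k then ?a $ k - ?a $ i + ?a $ j else ?a $ m)"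
  have a1: "a1 = (\<chi> m. ?a' $ Transposition.transpose i j m)" "?a' = (\<chi> m. a1 $ Transposition.transpose i j m)"
    using assms(3,6) distinct by (auto simp: a1_def shifted_def vec_eq_iff Transposition.transpose_def)
  have pos1: "0 < a1 $ m" for m
    using pos assms(1-5) by (auto simp: a1_def shifted_def add_pos_pos add_pos_nonneg)
  have "isotopic_tori (total_area ?a + ?a $ j) ?a a1"
    unfolding a1_def by (rule shear_tori) (use distinct assms pos in \<open>auto simp: shifted_def\<close>)
  moreover have "total_area ?a + ?a $ j = total_area ?a + d j + \<mu>" by (simp add: shifted_def)
  ultimately have shear: "isotopic_tori (total_area ?a + d j + \<mu>) ?a a1"
    by (simp only:)
  have swap: "isotopic_tori (total_area a1) a1 ?a'"
    using swap_tori[OF distinct(1) pos1] unfolding a1(2)[symmetric] .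
  have "total_area a1 = total_area ?a + d j"
  proof -
    have "total_area a1 = total_area ?a'"
      using sum.permute[OF permutes_swap_id[of i UNIV j], of "($) ?a'"]
      by (simp add: total_area_def a1(1) o_def)
    also have "\<dots> = total_area ?a + d j"
      using sum_upd[of UNIV k d "d k + d j"] by (simp add: total_area_def shifted_def sum.distrib del: fun_upd_apply)
    finally show ?thesis .
  qed
  then have "total_area a1 \<le> total_area ?a + d j + \<mu>" using assms(1) by linarith
  from hamiltonian_isotopic_trans[OF shear hamiltonian_isotopic_mono[OF swap this]] show ?thesis .
qed

lemma shifted_pos:
  assumes "0 < \<mu>" "\<forall>i\<in>A. 0 < d i" "\<And>i. i \<notin> A \<Longrightarrow> d i = 0"
  shows "0 < shifted \<mu> d $ m"
  using assms by (cases "m \<in> A") (auto simp: shifted_def add_pos_pos)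

lemma move_tori:
  fixes d :: "'n::finite \<Rightarrow> real"
  assumes "0 < \<mu>" "move A S d d'" "\<And>i. i \<notin> A \<Longrightarrow> d i = 0" "A \<noteq> UNIV"
  shows "isotopic_tori (real CARD('n) * \<mu> + S + \<mu>) (shifted \<mu> d) (shifted \<mu> d')"
proof -
  have fin: "finite A" by simp
  note m = move_invariants[OF fin assms(2)]
  obtain j k where jk: "j \<in> A" "k \<in> A" "j \<noteq> k" "d' = d(k := d k + d j) \<or> d' = d(j := d k, k := d j)"
    using assms(2) unfolding move_def by blast
  obtain i where i: "i \<notin> A" using assms(4) by blast
  from jk(4) show ?thesis
  proof
    assume d': "d' = d(k := d k + d j)"
    have nonneg: "0 \<le> d m" for m using m(1) assms(3)[of m] by (cases "m \<in> A") (auto simp: less_imp_le)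
    have "isotopic_tori (total_area (shifted \<mu> d) + d j + \<mu>) (shifted \<mu> d) (shifted \<mu> d')"
      unfolding d' by (rule add_tori[of \<mu> d i j k]) (use nonneg assms(1,3) i m(1) jk in auto)
    moreover have "sum d' A = sum d A + d j" unfolding d' by (simp only: sum_upd[OF fin jk(2)])
    then have "total_area (shifted \<mu> d) + d j + \<mu> \<le> real CARD('n) * \<mu> + S + \<mu>"
      using total_area_shifted[of A d \<mu>, OF assms(3)] m(6) by simp
    ultimately show ?thesis by (rule hamiltonian_isotopic_mono)
  next
    assume d': "d' = d(j := d k, k := d j)"
    have "shifted \<mu> d' = (\<chi> m. shifted \<mu> d $ Transposition.transpose j k m)"
      by (auto simp: d' shifted_def vec_eq_iff Transposition.transpose_def)
    then have "isotopic_tori (total_area (shifted \<mu> d)) (shifted \<mu> d) (shifted \<mu> d')"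
      using swap_tori[OF jk(3) shifted_pos[OF assms(1) m(1) assms(3)]] by simp
    moreover have "total_area (shifted \<mu> d) \<le> real CARD('n) * \<mu> + S + \<mu>"
      using total_area_shifted[of A d \<mu>, OF assms(3)] m(5) assms(1) by simp
    ultimately show ?thesis by (rule hamiltonian_isotopic_mono)
  qed
qed

lemma conn_tori:
  fixes d :: "'n::finite \<Rightarrow> real"
  assumes "0 < \<mu>" "conn A S d d'" "\<forall>i\<in>A. 0 < d i" "\<And>i. i \<notin> A \<Longrightarrow> d i = 0" "sum d A \<le> S" "A \<noteq> UNIV"
  shows "isotopic_tori (real CARD('n) * \<mu> + S + \<mu>) (shifted \<mu> d) (shifted \<mu> d')"
  using assms(2)
proof (induction rule: equivclp_induct)
  case base
  show ?case
    by (rule hamiltonian_isotopic_refl, rule product_torus_subset_ball)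
      (use shifted_pos[OF assms(1,3,4)] total_area_shifted[of A d \<mu>, OF assms(4)] assms(1,5) in auto)
next
  case (step y z)
  have fin: "finite A" by simp
  have "conn A S d z" using step(2) conn_move conn_trans[OF step(1)] by blast
  then have zero: "y i = 0" "z i = 0" if "i \<notin> A" for i
    using conn_invariants(3)[OF fin _ assms(3,5)] step(1) assms(4) that by metis+
  have "isotopic_tori (real CARD('n) * \<mu> + S + \<mu>) (shifted \<mu> y) (shifted \<mu> z)"
    using step(2)
  proof
    assume "move A S y z"
    then show ?thesis using zero(1) by (rule move_tori[OF assms(1) _ _ assms(6)])
  next
    assume "move A S z y"
    then show ?thesis using zero(2) by (intro hamiltonian_isotopic_sym[OF move_tori[OF assms(1) _ _ assms(6)]])
  qed
  with step.IH show ?case by (rule hamiltonian_isotopic_trans)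
qed

lemma min_area_attained:
  obtains i where "a $ i = min_area (a :: real ^ 'n)" "\<And>j. min_area a \<le> a $ j"
proof -
  have "min_area a \<in> range (\<lambda>i. a $ i)" unfolding min_area_def by (rule Min_in) auto
  moreover have "min_area a \<le> a $ j" for j unfolding min_area_def by (rule Min_le) auto
  ultimately show thesis using that by (metis imageE)
qed

text \<open>With \<open>S\<close> the larger one of the two sums of the \<open>d i\<close>, the size of the ball in which moves take place, \<open>CARD('n) * \<mu> + S + \<mu>\<close>, is
  exactly the maximum of \<open>big_area a\<close> and \<open>big_area a'\<close>.\<close>

lemma equivalent_tori:
  fixes a a' :: "real ^ 'n"
  assumes pos: "\<And>i. 0 < a $ i" and "a \<simeq> a'"
  shows "isotopic_tori (max (big_area a) (big_area a')) a a'"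
proof -
  define \<mu> where "\<mu> = min_area a"
  define d f where "d = (\<lambda>i. a $ i - \<mu>)" and "f = (\<lambda>i. a' $ i - \<mu>)"
  define A B where "A = {i. a $ i \<noteq> \<mu>}" and "B = {i. a' $ i \<noteq> \<mu>}"
  have eq: "min_area a' = \<mu>" "card {i. a $ i = \<mu>} = card {i. a' $ i = \<mu>}" "Gamma_group a = Gamma_group a'"
    using assms(2) by (auto simp: area_equiv_def \<mu>_def min_mult_def)
  have a: "shifted \<mu> d = a" "shifted \<mu> f = a'" by (auto simp: shifted_def d_def f_def vec_eq_iff)
  have ge: "\<mu> \<le> a $ i" "\<mu> \<le> a' $ i" for i
    using min_area_attained[of a] min_area_attained[of a'] eq(1) by (auto simp: \<mu>_def)
  obtain i i' where i: "a $ i = \<mu>" "a' $ i' = \<mu>" using min_area_attained[of a] min_area_attained[of a'] eq(1) by (metis \<mu>_def)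
  have \<mu>: "0 < \<mu>" using pos[of i] i by simp
  have out: "\<And>i. i \<notin> A \<Longrightarrow> d i = 0" "\<And>i. i \<notin> B \<Longrightarrow> f i = 0" by (auto simp: A_def B_def d_def f_def)
  have dpos: "\<forall>i\<in>A. 0 < d i" "\<forall>i\<in>B. 0 < f i" using ge by (auto simp: A_def B_def d_def f_def less_le)
  have ne: "A \<noteq> UNIV" "B \<noteq> UNIV" using i by (auto simp: A_def B_def)
  have "card (- {i. a $ i = \<mu>}) = card (- {i. a' $ i = \<mu>})" using eq(2) by (simp add: Compl_eq_Diff_UNIV card_Diff_subset)
  moreover have "- {i. a $ i = \<mu>} = A" "- {i. a' $ i = \<mu>} = B" by (auto simp: A_def B_def)
  ultimately have card: "card A = card B" by simp
  have spanA: "zspan e D = zspan e UNIV" if "\<And>i. i \<notin> D \<Longrightarrow> e i = 0" for e :: "'n \<Rightarrow> real" and D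
  proof -
    have "(\<Sum>i\<in>D. of_int (c i) * e i) = (\<Sum>i\<in>UNIV. of_int (c i) * e i)" for c :: "'n \<Rightarrow> int"
      by (rule sum.mono_neutral_left) (use that in auto)
    then show ?thesis by (simp add: zspan_def)
  qed
  have "zspan d UNIV = zspan f UNIV"
    using eq(3) unfolding Gamma_group_def zspan_def d_def f_def eq(1) \<mu>_def[symmetric] by simp
  then have span: "zspan d A = zspan f B" using spanA[of A d, OF out(1)] spanA[of B f, OF out(2)] by simp
  define S where "S = max (sum d A) (sum f B)"
  have S: "sum d A \<le> S" "sum f B \<le> S" by (auto simp: S_def)
  have bound: "real CARD('n) * \<mu> + S + \<mu> = max (big_area a) (big_area a')"
    using total_area_shifted[of A d \<mu>, OF out(1)] total_area_shifted[of B f \<mu>, OF out(2)] eq(1)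
    unfolding a big_area_def S_def by (simp add: \<mu>_def max_def)
  obtain d' f' where df: "conn A S d d'" "conn B S f f'" "image_mset d' (mset_set A) = image_mset f' (mset_set B)"
    using conn_common_form[OF _ _ card dpos span S] by auto
  note invd = conn_invariants[OF _ df(1) dpos(1) S(1)] and invf = conn_invariants[OF _ df(2) dpos(2) S(2)]
  have out': "\<And>i. i \<notin> A \<Longrightarrow> d' i = 0" "\<And>i. i \<notin> B \<Longrightarrow> f' i = 0"
    using invd(3) invf(3) out by auto
  have mset: "image_mset e (mset_set UNIV) = image_mset e (mset_set D) + replicate_mset (card (- D)) 0"
    if "\<And>i. i \<notin> D \<Longrightarrow> e i = 0" for e :: "'n \<Rightarrow> real" and D
  proof -
    have "mset_set (UNIV :: 'n set) = mset_set D + mset_set (- D)"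
      using mset_set_Union[of D "- D"] by (simp add: Compl_partition)
    moreover have "image_mset e (mset_set (- D)) = image_mset (\<lambda>_. 0) (mset_set (- D))"
      using that by (intro image_mset_cong) auto
    ultimately show ?thesis by (simp add: image_mset_const_eq)
  qed
  have "image_mset d' (mset_set UNIV) = image_mset f' (mset_set UNIV)"
    using mset[of A d', OF out'(1)] mset[of B f', OF out'(2)] df(3) card by (simp add: Compl_eq_Diff_UNIV card_Diff_subset)
  then obtain p where p: "p permutes UNIV" "\<forall>x\<in>UNIV. d' x = f' (p x)"
    using image_mset_eq_implies_permutes[OF finite] by metis
  let ?b = "real CARD('n) * \<mu> + S + \<mu>"
  have "shifted \<mu> d' = (\<chi> m. shifted \<mu> f' $ p m)" using p(2) by (simp add: shifted_def)
  moreover have "0 < shifted \<mu> f' $ m" for m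
    using invf(1) out'(2)[of m] \<mu> by (cases "m \<in> B") (auto simp: shifted_def add_pos_pos)
  ultimately have "isotopic_tori (total_area (shifted \<mu> f')) (shifted \<mu> f') (shifted \<mu> d')"
    using permuted_tori[OF p(1), of "shifted \<mu> f'"] by simp
  moreover have "total_area (shifted \<mu> f') \<le> ?b"
    using total_area_shifted[of B f' \<mu>, OF out'(2)] invf(4) \<mu> by simp
  ultimately have "isotopic_tori ?b (shifted \<mu> f') (shifted \<mu> d')"
    by (rule hamiltonian_isotopic_mono)
  moreover have "isotopic_tori ?b a (shifted \<mu> d')"
    using conn_tori[OF \<mu> df(1) dpos(1) out(1) S(1) ne(1)] unfolding a .
  moreover have "isotopic_tori ?b a' (shifted \<mu> f')"
    using conn_tori[OF \<mu> df(2) dpos(2) out(2) S(2) ne(2)] unfolding a .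
  ultimately show ?thesis
    unfolding bound by (meson hamiltonian_isotopic_sym hamiltonian_isotopic_trans)
qed

theorem theorem1p1:
  fixes a a' :: "real ^ 'n"
  assumes "\<forall>i. 0 < a $ i" and "\<forall>i. 0 < a' $ i"
  shows "((\<exists>p. p permutes (UNIV :: 'n set) \<and> (\<forall>i. a' $ i = a $ p i)) \<longrightarrow>
            hamiltonian_isotopic_in_ball (total_area a) (product_torus a) (product_torus a')) \<and>
         (a \<simeq> a' \<longrightarrow>
            hamiltonian_isotopic_in_ball (max (big_area a) (big_area a'))
              (product_torus a) (product_torus a'))"
proof (intro conjI impI)
  assume "\<exists>p. p permutes (UNIV :: 'n set) \<and> (\<forall>i. a' $ i = a $ p i)"
  then obtain p where p: "p permutes (UNIV :: 'n set)" "\<forall>i. a' $ i = a $ p i" by blast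
  then have "a' = (\<chi> m. a $ p m)" by (simp add: vec_eq_iff)
  then show "hamiltonian_isotopic_in_ball (total_area a) (product_torus a) (product_torus a')"
    using permuted_tori[OF p(1)] assms(1) by simp
next
  assume "a \<simeq> a'"
  then show "hamiltonian_isotopic_in_ball (max (big_area a) (big_area a')) (product_torus a) (product_torus a')"
    using assms(1) by (intro equivalent_tori) auto
qed


end
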